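(* Let $H,A,B,\alpha$ satisfy the standing assumptions listed in the context and let $T=T_\lambda$ be the transformation defined there. (Case $A$ self-adjoint.) There exist a constant $C>0$ and constants $C_s>0$, $s\in(\tfrac1{2\alpha}-1,1-\tfrac1{2\alpha})$, such that for any $N\in\mathbb N$ there exists $\lambda\in[N,N+1]$ ($\lambda>0$, $\lambda\notin\mathcal N$) such that the isomorphism $T_\lambda$ satisfies $$\|T_\lambda\|_{\mathcal L(D(A^s))}+\|T_\lambda^{-1}\|_{\mathcal L(D(A^s))}\le C_se^{C\lambda^{1/\alpha}},\qquad\forall s\in\Big(\tfrac1{2\alpha}-1,\,1-\tfrac1{2\alpha}\Big),$$ where $C$ does not depend on $(s,N,\lambda)$ and $C_s$ does not depend on $(N,\lambda)$. (Case $A$ skew-adjoint.) There exist a constant $C>0$, independent of $(s,\lambda)$, and constants $C_s>0$, independent of $\lambda$, such that for any $\lambda\ge1$ the isomorphism $T_\lambda$ satisfies the same estimate $$\|T_\lambda\|_{\mathcal L(D(A^s))}+\|T_\lambda^{-1}\|_{\mathcal L(D(A^s))}\le C_se^{C\lambda^{1/\alpha}},\qquad\forall s\in\Big(\tfrac1{2\alpha}-1,\,1-\tfrac1{2\alpha}\Big).$$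
   Context: Standing assumptions. $H$ is a complex Hilbert space; $A:D(A)\subset H\to H$ is densely defined with compact resolvent, either self-adjoint or skew-adjoint, with simple eigenvalues $(\lambda_n)_{n\in\mathbb N^*}$ ($\mathbb N^*=\{1,2,\dots\}$) and an orthonormal basis of eigenvectors $(\varphi_n)$ of $H$. If $A$ is self-adjoint, $0<-\lambda_1<-\lambda_2<\cdots\to+\infty$; if $A$ is skew-adjoint, $0<-i\lambda_1<-i\lambda_2<\cdots\to+\infty$. There are $\alpha>1$ and $c,C>0$ with $c\,n^{\alpha-1}\le|\lambda_{n+1}-\lambda_n|\le C\,n^{\alpha-1}$ and $c\,k^{\alpha-1}|k-n|\le|\lambda_k-\lambda_n|$ for all $k,n\in\mathbb N^*$. $B\in D(A)'$ (dual with pivot $H$) and $b_n:=\langle B,\varphi_n\rangle$ satisfies $0<c\le b_n\le C$ for all $n$. Notation. $\mathcal N=\{\lambda_i-\lambda_j:i,j\in\mathbb N^*\}$. $D(A^s)$ has norm $\|f\|_{D(A^s)}=(\sum_n|\lambda_n|^{2s}|\langle f,\varphi_n\rangle|^2)^{1/2}$; for $s\ge0$ it is the subspace of $H$ where this is finite, for $s<0$ it is the completion of $H$ for this norm (and $T_\lambda$, $T_\lambda^{-1}$ are understood as their continuous extensions). Transformation. For $\lambda>0$, $\lambda\notin\mathcal N$, put $$\tilde T^{-1}_{i,j}=\frac{\lambda^2}{\lambda_j-\lambda_i-\lambda}\prod_{r\ne i}\Big(1+\frac{\lambda}{\lambda_i-\lambda_r}\Big)\prod_{r\neq j}\Big(1-\frac{\lambda}{\lambda_j-\lambda_r}\Big),\quad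 k_n=\frac1{b_n}\sum_{j\in\mathbb N^*}\tilde T^{-1}_{n,j},\quad T_\lambda\varphi_n=k_n\sum_{p\in\mathbb N^*}\frac{b_p}{\lambda_p-\lambda_n-\lambda}\varphi_p .$$ *)

theory Defs
  imports "HOL-Analysis.Analysis" "HOL-Library.Function_Algebras"
begin

section \<open>Complex vector spaces and complex Hilbert spaces\<close>

class complex_vector = ab_group_add +
  fixes scaleC :: "complex \<Rightarrow> 'a \<Rightarrow> 'a"  (infixr "*\<^sub>C" 75)
  assumes scaleC_add_right: "c *\<^sub>C (x + y) = c *\<^sub>C x + c *\<^sub>C y"
    and scaleC_add_left: "(c + d) *\<^sub>C x = c *\<^sub>C x + d *\<^sub>C x"
    and scaleC_scaleC: "c *\<^sub>C d *\<^sub>C x = (c * d) *\<^sub>C x"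
    and scaleC_one: "1 *\<^sub>C x = x"

global_interpretation complex_vector: vector_space "scaleC :: complex \<Rightarrow> 'a \<Rightarrow> 'a::complex_vector"
  by unfold_locales (simp_all add: scaleC_add_right scaleC_add_left scaleC_scaleC scaleC_one)

instantiation complex :: complex_vector
begin
definition scaleC_complex :: "complex \<Rightarrow> complex \<Rightarrow> complex" where
  "scaleC_complex c z = c * z"
instance by standard (simp_all add: scaleC_complex_def algebra_simps)
end

instantiation "fun" :: (type, complex_vector) complex_vector
begin
definition scaleC_fun :: "complex \<Rightarrow> ('a \<Rightarrow> 'b) \<Rightarrow> 'a \<Rightarrow> 'b" where
  "scaleC_fun c f = (\<lambda>x. c *\<^sub>C f x)"
instance
  by standard (simp_all add: scaleC_fun_def fun_eq_iff scaleC_add_right scaleC_add_left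
      scaleC_scaleC scaleC_one)
end

text \<open>The inner product is linear in the first and antilinear in the second argument.  The
  norm, the topology and positive definiteness come from the underlying real Hilbert space,
  whose inner product is the real part of the complex one.\<close>

class complex_hilbert_space = complex_vector + real_inner + complete_space +
  fixes cinner :: "'a \<Rightarrow> 'a \<Rightarrow> complex"
  assumes scaleR_eq_scaleC: "r *\<^sub>R x = complex_of_real r *\<^sub>C x"
    and cinner_commute: "cinner x y = cnj (cinner y x)"
    and cinner_add_left: "cinner (x + y) z = cinner x z + cinner y z"
    and cinner_scaleC_left: "cinner (c *\<^sub>C x) y = c * cinner x y"
    and inner_eq_Re_cinner: "inner x y = Re (cinner x y)"

section \<open>Unbounded operators\<close>

text \<open>An operator with domain \<open>D\<close> is a function on the whole type whose values outside \<open>D\<close>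
  are irrelevant.\<close>

definition linear_on_dom :: "'a set \<Rightarrow> ('a::complex_vector \<Rightarrow> 'b::complex_vector) \<Rightarrow> bool" where
  "linear_on_dom D T \<longleftrightarrow> complex_vector.subspace D \<and>
     (\<forall>x\<in>D. \<forall>y\<in>D. T (x + y) = T x + T y) \<and> (\<forall>c. \<forall>x\<in>D. T (c *\<^sub>C x) = c *\<^sub>C T x)"

definition densely_defined_op :: "'h::complex_hilbert_space set \<Rightarrow> ('h \<Rightarrow> 'h) \<Rightarrow> bool" where
  "densely_defined_op D A \<longleftrightarrow> linear_on_dom D A \<and> closure D = UNIV"

definition adjoint_graph :: "'h::complex_hilbert_space set \<Rightarrow> ('h \<Rightarrow> 'h) \<Rightarrow> ('h \<times> 'h) set" where
  "adjoint_graph D A = {(y, z). \<forall>x\<in>D. cinner (A x) y = cinner x z}"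

definition self_adjoint :: "'h::complex_hilbert_space set \<Rightarrow> ('h \<Rightarrow> 'h) \<Rightarrow> bool" where
  "self_adjoint D A \<longleftrightarrow> densely_defined_op D A \<and> adjoint_graph D A = {(x, A x) | x. x \<in> D}"

definition skew_adjoint :: "'h::complex_hilbert_space set \<Rightarrow> ('h \<Rightarrow> 'h) \<Rightarrow> bool" where
  "skew_adjoint D A \<longleftrightarrow> densely_defined_op D A \<and> adjoint_graph D A = {(x, - A x) | x. x \<in> D}"

definition compact_resolvent :: "'h::complex_hilbert_space set \<Rightarrow> ('h \<Rightarrow> 'h) \<Rightarrow> bool" where
  "compact_resolvent D A \<longleftrightarrow> (\<exists>z. bij_betw (\<lambda>x. A x - z *\<^sub>C x) D UNIV \<and>
     (\<forall>S. bounded S \<longrightarrow> compact (closure (inv_into D (\<lambda>x. A x - z *\<^sub>C x) ` S))))"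

definition eigenvalues :: "'h::complex_hilbert_space set \<Rightarrow> ('h \<Rightarrow> 'h) \<Rightarrow> complex set" where
  "eigenvalues D A = {z. \<exists>x\<in>D. x \<noteq> 0 \<and> A x = z *\<^sub>C x}"

text \<open>\<open>D(A)'\<close> with pivot space \<open>H\<close>: \<open>f \<in> H\<close> is identified with \<open>g \<mapsto> \<langle>f, g\<rangle>\<close>, so
  the elements are antilinear functionals on \<open>D(A)\<close>, continuous for the graph norm, and the
  pairing \<open>\<langle>B, g\<rangle>\<close> is \<open>B g\<close>.\<close>

definition dual_dom :: "'h::complex_hilbert_space set \<Rightarrow> ('h \<Rightarrow> 'h) \<Rightarrow> ('h \<Rightarrow> complex) set" where
  "dual_dom D A = {B. (\<forall>x\<in>D. \<forall>y\<in>D. B (x + y) = B x + B y) \<and>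
     (\<forall>c. \<forall>x\<in>D. B (c *\<^sub>C x) = cnj c * B x) \<and>
     (\<exists>K. \<forall>x\<in>D. cmod (B x) \<le> K * (norm x + norm (A x)))}"

section \<open>Standing assumptions\<close>

text \<open>Families indexed by the positive integers are functions on \<open>nat\<close> that are only used at
  indices \<open>n \<ge> 1\<close>; the values at \<open>0\<close> are irrelevant.\<close>

locale standing_assumptions =
  fixes D :: "'h::complex_hilbert_space set" and A :: "'h \<Rightarrow> 'h"
    and ev :: "nat \<Rightarrow> complex" and \<phi> :: "nat \<Rightarrow> 'h"
    and B :: "'h \<Rightarrow> complex" and \<alpha> :: real
  assumes densely_defined: "densely_defined_op D A"
    and compact_res: "compact_resolvent D A"
    and adjointness: "self_adjoint D A \<or> skew_adjoint D A"
    and eigenvector: "\<And>n. n \<ge> 1 \<Longrightarrow> \<phi> n \<in> D \<and> A (\<phi> n) = ev n *\<^sub>C \<phi> n"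
    and eigenvalues_eq: "eigenvalues D A = ev ` {1..}"
    and eigenvalues_distinct: "inj_on ev {1..}"
    and eigenvalues_simple: "\<And>n. n \<ge> 1 \<Longrightarrow> complex_vector.dim {x \<in> D. A x = ev n *\<^sub>C x} = 1"
    and orthonormal:
      "\<And>m n. m \<ge> 1 \<Longrightarrow> n \<ge> 1 \<Longrightarrow> cinner (\<phi> m) (\<phi> n) = (if m = n then 1 else 0)"
    and total: "closure (complex_vector.span (\<phi> ` {1..})) = UNIV"
    and self_adjoint_order: "self_adjoint D A \<Longrightarrow>
      (\<forall>n\<ge>1. ev n \<in> \<real>) \<and> 0 < - Re (ev 1) \<and> (\<forall>n\<ge>1. - Re (ev n) < - Re (ev (Suc n))) \<and>
      filterlim (\<lambda>n. - Re (ev n)) at_top sequentially"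
    and skew_adjoint_order: "skew_adjoint D A \<Longrightarrow>
      (\<forall>n\<ge>1. - \<i> * ev n \<in> \<real>) \<and> 0 < Re (- \<i> * ev 1) \<and>
      (\<forall>n\<ge>1. Re (- \<i> * ev n) < Re (- \<i> * ev (Suc n))) \<and>
      filterlim (\<lambda>n. Re (- \<i> * ev n)) at_top sequentially"
    and alpha_gt_1: "\<alpha> > 1"
    and consecutive_gap: "\<exists>c>0. \<exists>C>0. \<forall>n\<ge>1.
      c * real n powr (\<alpha> - 1) \<le> cmod (ev (n + 1) - ev n) \<and>
      cmod (ev (n + 1) - ev n) \<le> C * real n powr (\<alpha> - 1)"
    and pairwise_gap: "\<exists>c>0. \<forall>k\<ge>1. \<forall>n\<ge>1.
      c * real k powr (\<alpha> - 1) * \<bar>real k - real n\<bar> \<le> cmod (ev k - ev n)"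
    and B_in_dual: "B \<in> dual_dom D A"
    and B_bounds: "\<exists>c>0. \<exists>C>0. \<forall>n\<ge>1. B (\<phi> n) \<in> \<real> \<and> c \<le> Re (B (\<phi> n)) \<and> Re (B (\<phi> n)) \<le> C"

section \<open>The spaces \<open>D(A\<^sup>s)\<close>\<close>

text \<open>Both families of spaces below are described by the weighted norm of the coefficients
  \<open>a n = \<langle>f, \<phi>\<^sub>n\<rangle>\<close>.\<close>

definition fourier :: "(nat \<Rightarrow> 'h::complex_hilbert_space) \<Rightarrow> 'h \<Rightarrow> nat \<Rightarrow> complex" where
  "fourier \<phi> f = (\<lambda>n. if n \<ge> 1 then cinner f (\<phi> n) else 0)"

definition weighted_norm :: "(nat \<Rightarrow> complex) \<Rightarrow> real \<Rightarrow> (nat \<Rightarrow> complex) \<Rightarrow> real" where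
  "weighted_norm ev s a = sqrt (\<Sum>\<^sub>\<infinity>n\<in>{1..}. cmod (ev n) powr (2 * s) * (cmod (a n))\<^sup>2)"

definition weighted_summable :: "(nat \<Rightarrow> complex) \<Rightarrow> real \<Rightarrow> (nat \<Rightarrow> complex) \<Rightarrow> bool" where
  "weighted_summable ev s a \<longleftrightarrow> (\<lambda>n. cmod (ev n) powr (2 * s) * (cmod (a n))\<^sup>2) summable_on {1..}"

text \<open>For \<open>s \<ge> 0\<close>, \<open>D(A\<^sup>s)\<close> is a subspace of \<open>H\<close>.\<close>

definition power_dom ::
    "(nat \<Rightarrow> complex) \<Rightarrow> (nat \<Rightarrow> 'h::complex_hilbert_space) \<Rightarrow> real \<Rightarrow> 'h set" where
  "power_dom ev \<phi> s = {f. weighted_summable ev s (fourier \<phi> f)}"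

definition power_norm ::
    "(nat \<Rightarrow> complex) \<Rightarrow> (nat \<Rightarrow> 'h::complex_hilbert_space) \<Rightarrow> real \<Rightarrow> 'h \<Rightarrow> real" where
  "power_norm ev \<phi> s f = weighted_norm ev s (fourier \<phi> f)"

text \<open>For \<open>s < 0\<close>, \<open>D(A\<^sup>s)\<close> is the completion of \<open>H\<close> for \<open>power_norm ev \<phi> s\<close>.  It is
  realised as the space of all coefficient sequences of finite weighted norm, into which \<open>H\<close>
  embeds through \<open>fourier \<phi>\<close>.  The lemmas \<open>fourier_in_power_completion\<close>,
  \<open>power_completion_dense\<close> and \<open>power_completion_complete\<close> show that this is a completion.\<close>

definition power_completion :: "(nat \<Rightarrow> complex) \<Rightarrow> real \<Rightarrow> (nat \<Rightarrow> complex) set" where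
  "power_completion ev s = {a. a 0 = 0 \<and> weighted_summable ev s a}"

section \<open>Isomorphisms of normed spaces given by a carrier and a norm\<close>

definition bounded_op_on ::
    "'a::complex_vector set \<Rightarrow> ('a \<Rightarrow> real) \<Rightarrow> ('a \<Rightarrow> 'a) \<Rightarrow> bool" where
  "bounded_op_on X nrm T \<longleftrightarrow> linear_on_dom X T \<and> T ` X \<subseteq> X \<and>
     (\<exists>K. \<forall>x\<in>X. nrm (T x) \<le> K * nrm x)"

text \<open>As for \<open>onorm\<close>, the quotient is \<open>0\<close> at \<open>x = 0\<close>.\<close>

definition op_norm_on :: "'a set \<Rightarrow> ('a \<Rightarrow> real) \<Rightarrow> ('a \<Rightarrow> 'a) \<Rightarrow> real" where
  "op_norm_on X nrm T = (SUP x\<in>X. nrm (T x) / nrm x)"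

definition isomorphism_on ::
    "'a::complex_vector set \<Rightarrow> ('a \<Rightarrow> real) \<Rightarrow> ('a \<Rightarrow> 'a) \<Rightarrow> bool" where
  "isomorphism_on X nrm T \<longleftrightarrow> bij_betw T X X \<and> bounded_op_on X nrm T \<and>
     bounded_op_on X nrm (inv_into X T)"

section \<open>The transformation\<close>

definition eigenvalue_differences :: "(nat \<Rightarrow> complex) \<Rightarrow> complex set" where
  "eigenvalue_differences ev = {ev i - ev j | i j. i \<ge> 1 \<and> j \<ge> 1}"

definition T_tilde_inv :: "(nat \<Rightarrow> complex) \<Rightarrow> complex \<Rightarrow> nat \<Rightarrow> nat \<Rightarrow> complex" where
  "T_tilde_inv ev \<mu> i j = \<mu>\<^sup>2 / (ev j - ev i - \<mu>) *
     (\<Prod>r. if r \<ge> 1 \<and> r \<noteq> i then 1 + \<mu> / (ev i - ev r) else 1) *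
     (\<Prod>r. if r \<ge> 1 \<and> r \<noteq> j then 1 - \<mu> / (ev j - ev r) else 1)"

definition k_coeff :: "(nat \<Rightarrow> complex) \<Rightarrow> (nat \<Rightarrow> complex) \<Rightarrow> complex \<Rightarrow> nat \<Rightarrow> complex" where
  "k_coeff ev b \<mu> n = 1 / b n * (\<Sum>\<^sub>\<infinity>j\<in>{1..}. T_tilde_inv ev \<mu> n j)"

definition T_basis :: "(nat \<Rightarrow> complex) \<Rightarrow> (nat \<Rightarrow> 'h::complex_hilbert_space) \<Rightarrow>
    (nat \<Rightarrow> complex) \<Rightarrow> complex \<Rightarrow> nat \<Rightarrow> 'h" where
  "T_basis ev \<phi> b \<mu> n =
     k_coeff ev b \<mu> n *\<^sub>C (\<Sum>\<^sub>\<infinity>p\<in>{1..}. (b p / (ev p - ev n - \<mu>)) *\<^sub>C \<phi> p)"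

text \<open>The operator on \<open>H\<close> that is determined by linearity and continuity from its values
  \<open>T_basis ev \<phi> b \<mu> n\<close> at the basis vectors \<open>\<phi> n\<close> (see \<open>T_op_basis\<close>).\<close>

definition T_op :: "(nat \<Rightarrow> complex) \<Rightarrow> (nat \<Rightarrow> 'h::complex_hilbert_space) \<Rightarrow>
    (nat \<Rightarrow> complex) \<Rightarrow> complex \<Rightarrow> 'h \<Rightarrow> 'h" where
  "T_op ev \<phi> b \<mu> f = (\<Sum>\<^sub>\<infinity>n\<in>{1..}. cinner f (\<phi> n) *\<^sub>C T_basis ev \<phi> b \<mu> n)"

text \<open>\<open>T\<close> is an isomorphism of \<open>D(A\<^sup>s)\<close> with
  \<open>\<parallel>T\<parallel> + \<parallel>T\<^sup>-\<^sup>1\<parallel> \<le> K\<close> in \<open>\<L>(D(A\<^sup>s))\<close>.  For \<open>s < 0\<close> this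
  concerns the extension \<open>S\<close> of \<open>T\<close> to the completion; it is unique by density, since
  \<open>isomorphism_on\<close> makes \<open>S\<close> continuous.\<close>

definition isomorphism_bound :: "(nat \<Rightarrow> complex) \<Rightarrow> (nat \<Rightarrow> 'h::complex_hilbert_space) \<Rightarrow>
    real \<Rightarrow> ('h \<Rightarrow> 'h) \<Rightarrow> real \<Rightarrow> bool" where
  "isomorphism_bound ev \<phi> s T K \<longleftrightarrow>
     (if s \<ge> 0 then
        isomorphism_on (power_dom ev \<phi> s) (power_norm ev \<phi> s) T \<and>
        op_norm_on (power_dom ev \<phi> s) (power_norm ev \<phi> s) T +
        op_norm_on (power_dom ev \<phi> s) (power_norm ev \<phi> s) (inv_into (power_dom ev \<phi> s) T) \<le> K
      else
        \<exists>S. (\<forall>f. S (fourier \<phi> f) = fourier \<phi> (T f)) \<and>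
          isomorphism_on (power_completion ev s) (weighted_norm ev s) S \<and>
          op_norm_on (power_completion ev s) (weighted_norm ev s) S +
          op_norm_on (power_completion ev s) (weighted_norm ev s)
            (inv_into (power_completion ev s) S) \<le> K)"


section \<open>The model of the completion\<close>

lemma cinner_sum_left:
  fixes x :: "'a \<Rightarrow> 'h::complex_hilbert_space"
  shows "cinner (sum x F) y = (\<Sum>i\<in>F. cinner (x i) y)"
proof -
  have z: "cinner 0 y = 0" using cinner_scaleC_left[of 0 0 y] by simp
  show ?thesis by (induction F rule: infinite_finite_induct) (simp_all add: cinner_add_left z)
qed

lemma cinner_add_right: "cinner x (y + z) = cinner x y + cinner x z"
  by (metis cinner_add_left cinner_commute complex_cnj_add)

lemma cinner_scaleC_right: "cinner x (c *\<^sub>C y) = cnj c * cinner x y"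
  by (metis cinner_commute cinner_scaleC_left complex_cnj_mult)

lemma norm_sq_cinner: "(norm x)\<^sup>2 = Re (cinner x x)"
  by (simp add: power2_norm_eq_inner inner_eq_Re_cinner)

context standing_assumptions
begin

lemma ev_nonzero:
  assumes "n \<ge> 1" shows "ev n \<noteq> 0"
  using adjointness
proof
  assume "self_adjoint D A"
  from self_adjoint_order[OF this]
  have h: "0 < - Re (ev 1)" "\<forall>n\<ge>1. - Re (ev n) < - Re (ev (Suc n))" by auto
  have "0 < - Re (ev n)" using assms
    by (induction n rule: dec_induct) (use h in force)+
  then show ?thesis by auto
next
  assume "skew_adjoint D A"
  from skew_adjoint_order[OF this]
  have h: "0 < Re (- \<i> * ev 1)" "\<forall>n\<ge>1. Re (- \<i> * ev n) < Re (- \<i> * ev (Suc n))" by auto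
  have "0 < Re (- \<i> * ev n)" using assms
    by (induction n rule: dec_induct) (use h in force)+
  then show ?thesis by auto
qed

lemma ev_bounded_below: "\<exists>m>0. \<forall>n\<ge>1. m \<le> cmod (ev n)"
  using adjointness
proof
  assume "self_adjoint D A"
  from self_adjoint_order[OF this]
  have h: "0 < - Re (ev 1)" "\<forall>n\<ge>1. - Re (ev n) < - Re (ev (Suc n))" by auto
  have "- Re (ev 1) \<le> - Re (ev n)" if "n \<ge> 1" for n using that
    by (induction n rule: dec_induct) (use h in force)+
  moreover have "- Re (ev n) \<le> cmod (ev n)" for n using abs_Re_le_cmod[of "ev n"] by linarith
  ultimately show ?thesis using h(1) by (meson order_trans)
next
  assume "skew_adjoint D A"
  from skew_adjoint_order[OF this]
  have h: "0 < Re (- \<i> * ev 1)" "\<forall>n\<ge>1. Re (- \<i> * ev n) < Re (- \<i> * ev (Suc n))" by auto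
  have "Re (- \<i> * ev 1) \<le> Re (- \<i> * ev n)" if "n \<ge> 1" for n using that
    by (induction n rule: dec_induct) (use h in force)+
  moreover have "Re (- \<i> * ev n) \<le> cmod (ev n)" for n using abs_Im_le_cmod[of "ev n"] by simp
  ultimately show ?thesis using h(1) by (meson order_trans)
qed

lemma bessel:
  assumes "finite F" "F \<subseteq> {1..}"
  shows "(\<Sum>n\<in>F. (cmod (cinner f (\<phi> n)))\<^sup>2) \<le> (norm f)\<^sup>2"
proof -
  define p where "p = (\<Sum>n\<in>F. cinner f (\<phi> n) *\<^sub>C \<phi> n)"
  define S where "S = (\<Sum>n\<in>F. (cmod (cinner f (\<phi> n)))\<^sup>2)"
  have pf: "cinner p f = of_real S"
    unfolding p_def S_def cinner_sum_left cinner_scaleC_left of_real_sum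
    by (intro sum.cong refl) (metis cinner_commute complex_norm_square)
  have fp: "cinner f p = of_real S" using pf cinner_commute[of f p] by simp
  have pn: "cinner p (\<phi> m) = cinner f (\<phi> m)" if "m \<in> F" for m
  proof -
    have "cinner p (\<phi> m) = (\<Sum>n\<in>F. if n = m then cinner f (\<phi> n) else 0)"
      unfolding p_def cinner_sum_left cinner_scaleC_left
      using that assms by (intro sum.cong refl) (auto simp: orthonormal subset_iff)
    then show ?thesis using that assms(1) by simp
  qed
  have pp: "cinner p p = of_real S"
  proof -
    have "cinner p p = (\<Sum>n\<in>F. cinner f (\<phi> n) * cinner (\<phi> n) p)"
      by (subst (1) p_def) (simp add: cinner_sum_left cinner_scaleC_left)
    also have "\<dots> = (\<Sum>n\<in>F. of_real ((cmod (cinner f (\<phi> n)))\<^sup>2))"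
      by (intro sum.cong refl) (metis pn cinner_commute complex_norm_square)
    finally show ?thesis by (simp add: S_def)
  qed
  have "inner (f - p) (f - p) = inner f f - inner f p - inner p f + inner p p"
    by (simp add: inner_diff_left inner_diff_right)
  also have "\<dots> = (norm f)\<^sup>2 - S"
    by (simp add: inner_eq_Re_cinner norm_sq_cinner pf fp pp)
  finally show ?thesis using inner_ge_zero[of "f - p"] by (simp add: S_def)
qed

lemma weighted_summableI:
  assumes "\<And>F. finite F \<Longrightarrow> F \<subseteq> {1..} \<Longrightarrow>
    (\<Sum>n\<in>F. cmod (ev n) powr (2 * s) * (cmod (a n))\<^sup>2) \<le> K"
  shows "weighted_summable ev s a"
  unfolding weighted_summable_def
  by (rule nonneg_bdd_above_summable_on) (auto intro!: bdd_aboveI2[where M = K] assms)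

lemma weighted_norm_nonneg: "weighted_norm ev s a \<ge> 0"
  unfolding weighted_norm_def by (auto intro!: infsum_nonneg)

lemma weighted_norm_leI:
  assumes "K \<ge> 0" and "\<And>F. finite F \<Longrightarrow> F \<subseteq> {1..} \<Longrightarrow>
    (\<Sum>n\<in>F. cmod (ev n) powr (2 * s) * (cmod (a n))\<^sup>2) \<le> K\<^sup>2"
  shows "weighted_norm ev s a \<le> K"
proof -
  have "(\<Sum>\<^sub>\<infinity>n\<in>{1..}. cmod (ev n) powr (2 * s) * (cmod (a n))\<^sup>2) \<le> K\<^sup>2"
    using weighted_summableI[OF assms(2)] assms(2)
    by (intro infsum_le_finite_sums) (auto simp: weighted_summable_def)
  then show ?thesis unfolding weighted_norm_def
    using assms(1) by (simp add: real_le_lsqrt infsum_nonneg)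
qed

lemma finite_sum_le_weighted_norm:
  assumes "weighted_summable ev s a" "finite F" "F \<subseteq> {1..}"
  shows "(\<Sum>n\<in>F. cmod (ev n) powr (2 * s) * (cmod (a n))\<^sup>2) \<le> (weighted_norm ev s a)\<^sup>2"
proof -
  have "(\<Sum>n\<in>F. cmod (ev n) powr (2 * s) * (cmod (a n))\<^sup>2)
      \<le> (\<Sum>\<^sub>\<infinity>n\<in>{1..}. cmod (ev n) powr (2 * s) * (cmod (a n))\<^sup>2)"
    using assms by (intro finite_sum_le_infsum) (auto simp: weighted_summable_def)
  then show ?thesis unfolding weighted_norm_def by (simp add: infsum_nonneg)
qed

lemma weighted_summable_diff:
  assumes "weighted_summable ev s a" "weighted_summable ev s b"
  shows "weighted_summable ev s (a - b)"
proof (rule weighted_summableI)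
  fix F :: "nat set" assume F: "finite F" "F \<subseteq> {1..}"
  have *: "(cmod (a n - b n))\<^sup>2 \<le> 2 * (cmod (a n))\<^sup>2 + 2 * (cmod (b n))\<^sup>2" for n
  proof -
    have "(cmod (a n - b n))\<^sup>2 \<le> (cmod (a n) + cmod (b n))\<^sup>2"
      by (intro power_mono norm_triangle_ineq4) auto
    also have "\<dots> \<le> 2 * (cmod (a n))\<^sup>2 + 2 * (cmod (b n))\<^sup>2"
      using zero_le_power2[of "cmod (a n) - cmod (b n)"] by (simp add: power2_sum power2_diff)
    finally show ?thesis .
  qed
  have "(\<Sum>n\<in>F. cmod (ev n) powr (2 * s) * (cmod ((a - b) n))\<^sup>2)
      \<le> (\<Sum>n\<in>F. cmod (ev n) powr (2 * s) * (2 * (cmod (a n))\<^sup>2 + 2 * (cmod (b n))\<^sup>2))"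
    using * by (intro sum_mono mult_left_mono) auto
  also have "\<dots> = 2 * (\<Sum>n\<in>F. cmod (ev n) powr (2 * s) * (cmod (a n))\<^sup>2)
      + 2 * (\<Sum>n\<in>F. cmod (ev n) powr (2 * s) * (cmod (b n))\<^sup>2)"
    by (simp add: sum.distrib sum_distrib_left algebra_simps)
  also have "\<dots> \<le> 2 * (weighted_norm ev s a)\<^sup>2 + 2 * (weighted_norm ev s b)\<^sup>2"
    using finite_sum_le_weighted_norm[OF assms(1) F] finite_sum_le_weighted_norm[OF assms(2) F]
    by simp
  finally show "(\<Sum>n\<in>F. cmod (ev n) powr (2 * s) * (cmod ((a - b) n))\<^sup>2)
      \<le> 2 * (weighted_norm ev s a)\<^sup>2 + 2 * (weighted_norm ev s b)\<^sup>2" .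
qed

lemma fourier_in_power_completion:
  assumes "s \<le> 0"
  shows "fourier \<phi> f \<in> power_completion ev s"
proof -
  obtain m where m: "m > 0" "\<And>n. n \<ge> 1 \<Longrightarrow> m \<le> cmod (ev n)" using ev_bounded_below by blast
  have "weighted_summable ev s (fourier \<phi> f)"
  proof (rule weighted_summableI)
    fix F :: "nat set" assume F: "finite F" "F \<subseteq> {1..}"
    have "(\<Sum>n\<in>F. cmod (ev n) powr (2 * s) * (cmod (fourier \<phi> f n))\<^sup>2)
       \<le> (\<Sum>n\<in>F. m powr (2 * s) * (cmod (cinner f (\<phi> n)))\<^sup>2)"
      using F(2) m assms
      by (intro sum_mono mult_mono powr_mono2') (auto simp: fourier_def subset_iff)
    also have "\<dots> \<le> m powr (2 * s) * (norm f)\<^sup>2"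
      using bessel[OF F, of f] by (simp add: sum_distrib_left[symmetric] mult_left_mono)
    finally show "(\<Sum>n\<in>F. cmod (ev n) powr (2 * s) * (cmod (fourier \<phi> f n))\<^sup>2)
      \<le> m powr (2 * s) * (norm f)\<^sup>2" .
  qed
  then show ?thesis by (simp add: power_completion_def fourier_def)
qed

lemma power_completion_dense:
  assumes a: "a \<in> power_completion ev s" and "e > 0"
  shows "\<exists>f. weighted_norm ev s (a - fourier \<phi> f) < e"
proof -
  let ?w = "\<lambda>n. cmod (ev n) powr (2 * s) * (cmod (a n))\<^sup>2"
  have sm: "?w summable_on {1..}" and a0: "a 0 = 0"
    using a by (auto simp: power_completion_def weighted_summable_def)
  have "(sum ?w \<longlongrightarrow> infsum ?w {1..}) (finite_subsets_at_top {1..})"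
    using has_sum_infsum[OF sm] unfolding has_sum_def .
  then have "\<forall>\<^sub>F F in finite_subsets_at_top {1..}. dist (sum ?w F) (infsum ?w {1..}) < e\<^sup>2 / 2"
    using \<open>e > 0\<close> by (intro tendstoD) auto
  then have "\<exists>F. finite F \<and> F \<subseteq> {1..} \<and> (\<forall>G. finite G \<and> F \<subseteq> G \<and> G \<subseteq> {1..} \<longrightarrow>
      dist (sum ?w G) (infsum ?w {1..}) < e\<^sup>2 / 2)"
    by (simp only: eventually_finite_subsets_at_top)
  then obtain F where F: "finite F" "F \<subseteq> {1..}"
    and d: "\<forall>G. finite G \<and> F \<subseteq> G \<and> G \<subseteq> {1..} \<longrightarrow>
      dist (sum ?w G) (infsum ?w {1..}) < e\<^sup>2 / 2"
    by (elim exE conjE) (rule that)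
  define f where "f = (\<Sum>n\<in>F. a n *\<^sub>C \<phi> n)"
  have cf: "fourier \<phi> f m = (if m \<in> F then a m else 0)" for m
  proof (cases "m \<ge> 1")
    case True
    have "cinner f (\<phi> m) = (\<Sum>n\<in>F. if n = m then a n else 0)"
      unfolding f_def cinner_sum_left cinner_scaleC_left
      using True F by (intro sum.cong refl) (auto simp: orthonormal subset_iff)
    then show ?thesis using True F(1) by (simp add: fourier_def)
  next
    case False
    then show ?thesis using F(2) by (auto simp: fourier_def)
  qed
  define r where "r = sqrt (infsum ?w {1..} - sum ?w F)"
  have nn: "sum ?w F \<le> infsum ?w {1..}"
    using sm F by (intro finite_sum_le_infsum) auto
  have "weighted_norm ev s (a - fourier \<phi> f) \<le> r"
  proof (rule weighted_norm_leI)
    show "r \<ge> 0" using nn by (simp add: r_def)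
    fix G :: "nat set" assume G: "finite G" "G \<subseteq> {1..}"
    have "(\<Sum>n\<in>G. cmod (ev n) powr (2 * s) * (cmod ((a - fourier \<phi> f) n))\<^sup>2)
       = (\<Sum>n\<in>G. if n \<in> F then 0 else ?w n)"
      by (intro sum.cong refl) (simp add: cf)
    also have "\<dots> = sum ?w (G - F)"
      using G by (simp add: sum.If_cases Diff_eq Compl_eq)
    also have "\<dots> = sum ?w (F \<union> G) - sum ?w F"
      using F G sum_diff[of "F \<union> G" F ?w] by (simp add: Un_Diff)
    also have "\<dots> \<le> infsum ?w {1..} - sum ?w F"
      using F G sm by (intro diff_right_mono finite_sum_le_infsum) auto
    finally show "(\<Sum>n\<in>G. cmod (ev n) powr (2 * s) * (cmod ((a - fourier \<phi> f) n))\<^sup>2) \<le> r\<^sup>2"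
      using nn by (simp add: r_def)
  qed
  also have "r < e"
  proof -
    have "infsum ?w {1..} - sum ?w F < e\<^sup>2"
      using d[rule_format, OF conjI[OF F(1) conjI[OF order_refl F(2)]]]
        zero_less_power[OF \<open>e > 0\<close>, of 2]
      unfolding dist_real_def by linarith
    then have "r < sqrt (e\<^sup>2)" unfolding r_def by (rule real_sqrt_less_mono)
    then show ?thesis using \<open>e > 0\<close> by simp
  qed
  finally show ?thesis by blast
qed

lemma power_completion_complete:
  assumes x: "\<And>k. x k \<in> power_completion ev s"
    and cauchy: "\<And>e. e > 0 \<Longrightarrow> \<exists>M. \<forall>k\<ge>M. \<forall>l\<ge>M. weighted_norm ev s (x k - x l) < e"
  shows "\<exists>a\<in>power_completion ev s. (\<lambda>k. weighted_norm ev s (x k - a)) \<longlonglongrightarrow> 0"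
proof -
  have ws: "weighted_summable ev s (x k)" and x0: "x k 0 = 0" for k
    using x by (auto simp: power_completion_def)
  have coord: "Cauchy (\<lambda>k. x k n)" for n
  proof (cases "n \<ge> 1")
    case True
    let ?w = "cmod (ev n) powr (2 * s)"
    have w: "?w > 0" using ev_nonzero[OF True] by simp
    show ?thesis
    proof (rule metric_CauchyI)
      fix e :: real assume "e > 0"
      then obtain M where M: "\<And>k l. k \<ge> M \<Longrightarrow> l \<ge> M \<Longrightarrow> weighted_norm ev s (x k - x l) < sqrt ?w * e"
        using cauchy[of "sqrt ?w * e"] w by auto
      have "dist (x k n) (x l n) < e" if "k \<ge> M" "l \<ge> M" for k l
      proof -
        have "?w * (cmod (x k n - x l n))\<^sup>2 \<le> (weighted_norm ev s (x k - x l))\<^sup>2"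
          using finite_sum_le_weighted_norm[OF weighted_summable_diff[OF ws ws], of "{n}"] True
          by simp
        also have "\<dots> < (sqrt ?w * e)\<^sup>2"
          using M[OF that] weighted_norm_nonneg by (intro power_strict_mono) auto
        also have "\<dots> = ?w * e\<^sup>2" using w by (simp add: power_mult_distrib)
        finally have "(cmod (x k n - x l n))\<^sup>2 < e\<^sup>2" using w by simp
        then show ?thesis using \<open>e > 0\<close> by (simp add: dist_norm power_less_imp_less_base)
      qed
      then show "\<exists>M. \<forall>m\<ge>M. \<forall>n'\<ge>M. dist (x m n) (x n' n) < e" by blast
    qed
  next
    case False
    then have "n = 0" by simp
    then have "(\<lambda>k. x k n) = (\<lambda>k. 0)" using x0 by auto
    then show ?thesis by (simp add: convergent_Cauchy convergent_const)
  qed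
  define a where "a n = lim (\<lambda>k. x k n)" for n
  have lim: "(\<lambda>k. x k n) \<longlonglongrightarrow> a n" for n
    unfolding a_def using coord[of n] by (simp add: Cauchy_convergent convergent_LIMSEQ_iff[symmetric])
  have key: "\<exists>M. \<forall>k\<ge>M. weighted_summable ev s (x k - a) \<and> weighted_norm ev s (x k - a) \<le> e"
    if e: "e > 0" for e
  proof -
    obtain M where M: "\<And>k l. k \<ge> M \<Longrightarrow> l \<ge> M \<Longrightarrow> weighted_norm ev s (x k - x l) < e"
      using cauchy[OF e] by blast
    have fin: "(\<Sum>n\<in>F. cmod (ev n) powr (2 * s) * (cmod ((x k - a) n))\<^sup>2) \<le> e\<^sup>2"
      if "k \<ge> M" "finite F" "F \<subseteq> {1..}" for k F
    proof (rule LIMSEQ_le_const2)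
      show "(\<lambda>l. \<Sum>n\<in>F. cmod (ev n) powr (2 * s) * (cmod ((x k - x l) n))\<^sup>2)
        \<longlonglongrightarrow> (\<Sum>n\<in>F. cmod (ev n) powr (2 * s) * (cmod ((x k - a) n))\<^sup>2)"
        unfolding minus_apply by (intro tendsto_intros lim)
      have "(\<Sum>n\<in>F. cmod (ev n) powr (2 * s) * (cmod ((x k - x l) n))\<^sup>2) \<le> e\<^sup>2" if "l \<ge> M" for l
      proof -
        have "(\<Sum>n\<in>F. cmod (ev n) powr (2 * s) * (cmod ((x k - x l) n))\<^sup>2)
            \<le> (weighted_norm ev s (x k - x l))\<^sup>2"
          by (rule finite_sum_le_weighted_norm[OF weighted_summable_diff[OF ws ws]]) fact+
        also have "\<dots> \<le> e\<^sup>2"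
          using M[OF \<open>k \<ge> M\<close> that] weighted_norm_nonneg by (intro power_mono) auto
        finally show ?thesis .
      qed
      then show "\<exists>N. \<forall>l\<ge>N. (\<Sum>n\<in>F. cmod (ev n) powr (2 * s) * (cmod ((x k - x l) n))\<^sup>2) \<le> e\<^sup>2"
        by blast
    qed
    then show ?thesis using e
      by (intro exI[of _ M] allI impI conjI weighted_summableI[where K = "e\<^sup>2"] weighted_norm_leI) auto
  qed
  obtain k where "weighted_summable ev s (x k - a)" using key[of 1] by auto
  from weighted_summable_diff[OF ws[of k] this] have "weighted_summable ev s a" by simp
  moreover have "a 0 = 0" using lim[of 0] by (simp add: x0 LIMSEQ_const_iff)
  moreover have "(\<lambda>k. weighted_norm ev s (x k - a)) \<longlonglongrightarrow> 0"
  proof (rule LIMSEQ_I)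
    fix e :: real assume "e > 0"
    then obtain M where "\<forall>k\<ge>M. weighted_norm ev s (x k - a) \<le> e / 2" using key[of "e / 2"] by auto
    then show "\<exists>M. \<forall>k\<ge>M. norm (weighted_norm ev s (x k - a) - 0) < e"
      using \<open>e > 0\<close> weighted_norm_nonneg by (intro exI[of _ M]) fastforce
  qed
  ultimately show ?thesis by (auto simp: power_completion_def)
qed

lemma T_op_basis:
  assumes "n \<ge> 1"
  shows "T_op ev \<phi> b \<mu> (\<phi> n) = T_basis ev \<phi> b \<mu> n"
proof -
  have "T_op ev \<phi> b \<mu> (\<phi> n) = (\<Sum>\<^sub>\<infinity>m\<in>{n}. cinner (\<phi> n) (\<phi> m) *\<^sub>C T_basis ev \<phi> b \<mu> m)"
    unfolding T_op_def using assms by (intro infsum_cong_neutral) (auto simp: orthonormal)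
  then show ?thesis using assms by (simp add: orthonormal)
qed

end

end

(* The operator T is diag(b) C diag(k) with the infinite Cauchy matrix
   C p n = 1 / (ev p - ev n - mu).  Partial fractions of the rational functions
   (PROD r. (ev r + mu - z) / (ev r - z)), followed by a dominated passage to infinitely many
   factors, evaluate k n in closed form and give an explicit inverse of T, again a diagonally
   scaled Cauchy matrix.  The diagonal factors are the products gap_prod, bounded by
   exp (C * mu powr (1 / alpha)) because |ev j - ev r| is at least of order |j - r| powr alpha.
   The entries of both matrices are thus dominated by a multiple of 1 / (1 + |ev p - ev n|), and
   the Schur test with the weights n powr (-1/2) shows that this kernel acts boundedly on the
   weighted sequence spaces for s in the stated range.  What remains is the distance of
   mu to the eigenvalue differences: it is at least 1 in the skew-adjoint case, and in the
   self-adjoint case only polynomially many differences meet [N - 1, N + 2], so that some mu in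
   [N, N + 1] is at a polynomially small distance from all of them. *)

theory Submission
  imports Defs
begin

section \<open>Partial fractions\<close>

text \<open>No lower bound on the products is ever needed: the inverse of T is again a scaled Cauchy
  matrix with gap products as numerators, \<mu> and -\<mu> being exchanged, so one upper bound
  serves both operators. The interval for s comes from the weight n^(-1/2). With it the rows of the
  kernel lead to the sum of n^(-\<tau>-\<alpha>) with \<tau> = \<alpha> s + 1/2, which converges for
  \<tau> > 1 - \<alpha>, that is, for s > 1/(2\<alpha>) - 1; the columns give the same with -s,
  hence the other end point. The constants separate because \<mu> enters only through the size
  \<open>L\<close> of a dominating kernel, and s only through the kernel norm
  \<open>kern_const s\<close>. The obstacle is that T is given by infinite sums in H, whereas the
  estimates range over spaces larger and smaller than H. The sums are therefore evaluated once, in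
  the unweighted space; from then on a single matrix is studied on all weighted sequence spaces, and
  it is itself the extension wanted for s < 0.\<close>

text \<open>Induction on the poles: a new factor is 1 + \<open>d\<close> / (\<open>x s\<close> - z),
  and each product of two simple poles splits into a difference. The induction hypothesis at
  \<open>x s\<close> itself then identifies the coefficient of the new pole.\<close>

lemma prod_quotient_partial_fractions:
  fixes x y :: "'i \<Rightarrow> 'a::field"
  assumes "finite S" "inj_on x S" "z \<notin> x ` S"
  shows "(\<Prod>r\<in>S. (y r - z) / (x r - z)) =
    1 + (\<Sum>j\<in>S. (y j - x j) * (\<Prod>r\<in>S - {j}. (y r - x j) / (x r - x j)) / (x j - z))"
  using assms
proof (induction S arbitrary: z rule: finite_induct)
  case empty
  then show ?case by simp
next
  case (insert s S)
  define R where "R j = (y j - x j) * (\<Prod>r\<in>S - {j}. (y r - x j) / (x r - x j))" for j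
  define d where "d = y s - x s"
  have inj: "inj_on x S" and xs: "x s \<notin> x ` S" and z: "z \<notin> x ` S" "x s - z \<noteq> 0"
    using insert.prems insert.hyps by auto
  have IH: "(\<Prod>r\<in>S. (y r - w) / (x r - w)) = 1 + (\<Sum>j\<in>S. R j / (x j - w))" if "w \<notin> x ` S" for w
    using insert.IH[OF inj that] by (simp add: R_def)
  have new: "(y j - x j) * (\<Prod>r\<in>insert s S - {j}. (y r - x j) / (x r - x j))
      = R j * (1 + d / (x s - x j))" if "j \<in> S" for j
  proof -
    have *: "insert s S - {j} = insert s (S - {j})" using that insert.hyps by auto
    have "x s - x j \<noteq> 0" using xs that by auto
    then have "(y s - x j) / (x s - x j) = 1 + d / (x s - x j)" by (simp add: d_def field_simps)
    then show ?thesis using insert.hyps by (simp add: * R_def)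
  qed
  have split: "R j / (x j - z) * (d / (x s - z))
      = R j * (d / (x s - x j)) / (x j - z) - d / (x s - z) * (R j / (x s - x j))"
    if "j \<in> S" for j
  proof -
    have "x s - x j \<noteq> 0" "x j - z \<noteq> 0" using xs z that by auto
    then show ?thesis using z(2) by (simp add: divide_simps) (simp add: algebra_simps)
  qed
  have "(\<Prod>r\<in>insert s S. (y r - z) / (x r - z))
      = (1 + d / (x s - z)) * (1 + (\<Sum>j\<in>S. R j / (x j - z)))"
    using insert.hyps z by (simp add: IH d_def field_simps)
  also have "\<dots> = 1 + d / (x s - z) + (\<Sum>j\<in>S. R j / (x j - z))
      + (\<Sum>j\<in>S. R j / (x j - z) * (d / (x s - z)))"
    unfolding sum_distrib_right[symmetric] by (simp only: ring_distribs mult_1_left mult_1_right add.assoc add.commute add.left_commute mult.commute)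
  also have "(\<Sum>j\<in>S. R j / (x j - z) * (d / (x s - z)))
      = (\<Sum>j\<in>S. R j * (d / (x s - x j)) / (x j - z)) - d / (x s - z) * (\<Sum>j\<in>S. R j / (x s - x j))"
    by (simp add: sum_distrib_left flip: sum_subtractf) (intro sum.cong refl, use split in simp)
  also have "(\<Sum>j\<in>S. R j / (x s - x j)) = - (\<Sum>j\<in>S. R j / (x j - x s))"
    unfolding sum_negf[symmetric]
    by (intro sum.cong refl) (metis minus_diff_eq minus_divide_right)
  also have "1 + d / (x s - z) + (\<Sum>j\<in>S. R j / (x j - z))
      + ((\<Sum>j\<in>S. R j * (d / (x s - x j)) / (x j - z)) - d / (x s - z) * - (\<Sum>j\<in>S. R j / (x j - x s)))
      = 1 + d * (1 + (\<Sum>j\<in>S. R j / (x j - x s))) / (x s - z)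
      + (\<Sum>j\<in>S. R j * (1 + d / (x s - x j)) / (x j - z))"
    by (simp add: algebra_simps sum.distrib add_divide_distrib)
  also have "\<dots> = 1 + (\<Sum>j\<in>insert s S. (y j - x j) *
      (\<Prod>r\<in>insert s S - {j}. (y r - x j) / (x r - x j)) / (x j - z))"
    using insert.hyps by (simp add: new IH[OF xs, symmetric] d_def cong: sum.cong)
  finally show ?case .
qed

text \<open>Here \<open>x k\<close> is a pole without a matching zero, and no constant term 1
  remains. The formula follows from the previous expansion taken at both z and
  \<open>x k\<close>.\<close>

lemma prod_quotient_partial_fractions':
  fixes x y :: "'i \<Rightarrow> 'a::field"
  assumes "finite S" "inj_on x (insert k S)" "z \<notin> x ` insert k S" "k \<notin> S"
  shows "(\<Prod>r\<in>S. (y r - z) / (x r - z)) / (x k - z) =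
    (\<Prod>r\<in>S. (y r - x k) / (x r - x k)) / (x k - z) +
    (\<Sum>j\<in>S. (y j - x j) * (\<Prod>r\<in>S - {j}. (y r - x j) / (x r - x j)) / ((x k - x j) * (x j - z)))"
proof -
  define R where "R j = (y j - x j) * (\<Prod>r\<in>S - {j}. (y r - x j) / (x r - x j))" for j
  have xk: "x k \<notin> x ` S" and zk: "x k - z \<noteq> 0" and z: "z \<notin> x ` S" and inj: "inj_on x S"
    using assms by auto
  have IH: "(\<Prod>r\<in>S. (y r - w) / (x r - w)) = 1 + (\<Sum>j\<in>S. R j / (x j - w))" if "w \<notin> x ` S" for w
    using prod_quotient_partial_fractions[OF assms(1) inj that] by (simp add: R_def)
  have "R j / (x j - z) / (x k - z) = R j / (x j - x k) / (x k - z) + R j / ((x k - x j) * (x j - z))"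
    if "j \<in> S" for j
  proof -
    have "x k - x j \<noteq> 0" "x j - x k \<noteq> 0" "x j - z \<noteq> 0" using xk z imageI[OF that, of x] by auto
    then show ?thesis using zk by (simp add: divide_simps) (simp add: algebra_simps)
  qed
  then show ?thesis
    unfolding IH[OF xk] IH[OF z] R_def[symmetric]
    by (simp add: add_divide_distrib sum_divide_distrib sum.distrib cong: sum.cong)
qed

section \<open>Finite gap products and identities for the truncated Cauchy matrix\<close>

text \<open>For pairwise distinct x this is, up to the factor \<mu>, the coefficient of the pole
  \<open>x j\<close> in the partial fractions of the product of (\<open>x r\<close> + \<mu> - z) /
  (\<open>x r\<close> - z) over r in {1..N}.\<close>

definition partial_gap_prod :: "(nat \<Rightarrow> complex) \<Rightarrow> complex \<Rightarrow> nat \<Rightarrow> nat \<Rightarrow> complex" where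
  "partial_gap_prod x \<mu> N j = (\<Prod>r\<in>{1..N} - {j}. 1 - \<mu> / (x j - x r))"

definition gap_prod :: "(nat \<Rightarrow> complex) \<Rightarrow> complex \<Rightarrow> nat \<Rightarrow> complex" where
  "gap_prod x \<mu> j = (\<Prod>r. if r \<ge> 1 \<and> r \<noteq> j then 1 - \<mu> / (x j - x r) else 1)"

lemma partial_gap_prod_alt:
  fixes x :: "nat \<Rightarrow> 'a::field"
  assumes "inj_on x {1..}" "j \<ge> 1" "S \<subseteq> {1..} - {j}"
  shows "(\<Prod>r\<in>S. 1 - \<mu> / (x j - x r)) = (\<Prod>r\<in>S. (x r + \<mu> - x j) / (x r - x j))"
proof (intro prod.cong refl)
  fix r assume "r \<in> S"
  then have "r \<noteq> j" "r \<in> {1..}" using assms by auto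
  then have "x r \<noteq> x j" using inj_onD[OF assms(1)] assms(2) by auto
  then have "x r - x j \<noteq> 0" by simp
  moreover have "\<mu> / (x j - x r) = - (\<mu> / (x r - x j))" by (metis minus_diff_eq minus_divide_right)
  ultimately show "1 - \<mu> / (x j - x r) = (x r + \<mu> - x j) / (x r - x j)"
    by (simp add: field_simps)
qed

text \<open>The point \<open>x i\<close> + \<mu> is a zero of the rational function, so its partial
  fraction expansion there reads 0 = 1 + sum. In the limit this sum rule evaluates
  \<open>k_coeff\<close>.\<close>

lemma partial_gap_prod_sum:
  assumes inj: "inj_on x {1..}" and i: "i \<in> {1..N}" and ne: "\<And>r. r \<ge> 1 \<Longrightarrow> x r - x i \<noteq> \<mu>"
  shows "(\<Sum>j\<in>{1..N}. \<mu> * partial_gap_prod x \<mu> N j / (x j - x i - \<mu>)) = -1"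
proof -
  have z: "x i + \<mu> \<notin> x ` {1..N}" proof
    assume "x i + \<mu> \<in> x ` {1..N}"
    then obtain r where "r \<ge> 1" "x r = x i + \<mu>" by auto
    then show False using ne[of r] by simp
  qed
  have "0 = (\<Prod>r\<in>{1..N}. (x r + \<mu> - (x i + \<mu>)) / (x r - (x i + \<mu>)))"
    using i by (intro prod_zero[symmetric]) auto
  also have "\<dots> = 1 + (\<Sum>j\<in>{1..N}. (x j + \<mu> - x j) *
      (\<Prod>r\<in>{1..N} - {j}. (x r + \<mu> - x j) / (x r - x j)) / (x j - (x i + \<mu>)))"
    by (intro prod_quotient_partial_fractions z) (auto intro: inj_on_subset[OF inj])
  also have "\<dots> = 1 + (\<Sum>j\<in>{1..N}. \<mu> * partial_gap_prod x \<mu> N j / (x j - x i - \<mu>))"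
    unfolding partial_gap_prod_def
    by (intro arg_cong2[where f = plus] refl sum.cong, subst partial_gap_prod_alt[OF inj])
       (auto simp: algebra_simps)
  finally show ?thesis by (simp add: eq_neg_iff_add_eq_0 add.commute)
qed

text \<open>Deleting the numerator factor of index i leaves a rational function that vanishes at
  every \<open>x n\<close> + \<mu> with n in {1..N} except n = i, where its product part is the
  reciprocal of \<open>partial_gap_prod x (-\<mu>) N i\<close>. Its partial fractions at these
  points are the entries of a product of two Cauchy matrices.\<close>

lemma partial_gap_prod_orthogonality:
  assumes inj: "inj_on x {1..}" and i: "i \<in> {1..N}" and n: "n \<in> {1..N}" and \<mu>: "\<mu> \<noteq> 0"
    and ne: "\<And>r m. r \<ge> 1 \<Longrightarrow> m \<ge> 1 \<Longrightarrow> x r - x m \<noteq> \<mu>"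
  shows "partial_gap_prod x (-\<mu>) N i * (\<Sum>j\<in>{1..N}. \<mu>\<^sup>2 * partial_gap_prod x \<mu> N j /
      ((x j - x i - \<mu>) * (x j - x n - \<mu>))) = (if i = n then 1 else 0)"
proof -
  define S where "S = {1..N} - {i}"
  define z where "z = x n + \<mu>"
  have S: "finite S" "i \<notin> S" "insert i S = {1..N}" using i by (auto simp: S_def)
  have zS: "z \<notin> x ` insert i S" 
  proof
    assume "z \<in> x ` insert i S"
    then obtain r where "r \<ge> 1" "x r = x n + \<mu>" unfolding S z_def by auto
    then show False using ne[of r n] n by simp
  qed
  have injS: "inj_on x (insert i S)" unfolding S by (auto intro: inj_on_subset[OF inj])
  have Qi: "(\<Prod>r\<in>S. (x r + \<mu> - x i) / (x r - x i)) = partial_gap_prod x \<mu> N i"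
    unfolding partial_gap_prod_def S_def using i by (subst partial_gap_prod_alt[OF inj]) auto
  \<comment> \<open>Passing from \<open>S\<close> to {1..N} restores the factor of index i, whose
    numerator becomes the denominator \<open>x j\<close> - \<open>x i\<close> - \<mu> up to
    sign.\<close>
  have Qj: "(\<Prod>r\<in>S - {j}. (x r + \<mu> - x j) / (x r - x j)) / (x i - x j) = 
      - partial_gap_prod x \<mu> N j / (x j - x i - \<mu>)" if "j \<in> S" for j
  proof -
    have j: "j \<in> {1..N}" "j \<noteq> i" "i \<ge> 1" using that i by (auto simp: S_def)
    define P e where "P = (\<Prod>r\<in>S - {j}. (x r + \<mu> - x j) / (x r - x j))" and "e = x i + \<mu> - x j"
    have "x i \<noteq> x j" using inj_onD[OF inj, of i j] j by auto
    then have a: "x i - x j \<noteq> 0" by simp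
    have e: "e \<noteq> 0" "x j - x i - \<mu> = - e" using ne[of j i] j by (auto simp: e_def algebra_simps)
    have *: "{1..N} - {j} = insert i (S - {j})" using j i by (auto simp: S_def)
    have "partial_gap_prod x \<mu> N j = (\<Prod>r\<in>insert i (S - {j}). (x r + \<mu> - x j) / (x r - x j))"
      unfolding partial_gap_prod_def * using j
      by (intro partial_gap_prod_alt[OF inj]) (auto simp: S_def)
    also have "\<dots> = e / (x i - x j) * P"
      using S(1,2) by (simp add: P_def e_def)
    finally have "partial_gap_prod x \<mu> N j = e / (x i - x j) * P" .
    then show ?thesis unfolding P_def[symmetric] e(2) using a e(1) by (simp add: field_simps)
  qed
  have xi: "x i - z \<noteq> 0" using zS by auto
  have mi: "(x i - x i - \<mu>) = -\<mu>" by simp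
  have "(\<Prod>r\<in>S. (x r + \<mu> - z) / (x r - z)) / (x i - z)
      = partial_gap_prod x \<mu> N i / (x i - z) + (\<Sum>j\<in>S. (x j + \<mu> - x j) *
      (\<Prod>r\<in>S - {j}. (x r + \<mu> - x j) / (x r - x j)) / ((x i - x j) * (x j - z)))"
    using prod_quotient_partial_fractions'[OF S(1) injS zS S(2), of "\<lambda>r. x r + \<mu>"] unfolding Qi .
  also have "(\<Sum>j\<in>S. (x j + \<mu> - x j) *
      (\<Prod>r\<in>S - {j}. (x r + \<mu> - x j) / (x r - x j)) / ((x i - x j) * (x j - z)))
     = (\<Sum>j\<in>S. - (\<mu> * partial_gap_prod x \<mu> N j / ((x j - x i - \<mu>) * (x j - x n - \<mu>))))"
  proof (intro sum.cong refl)
    fix j assume "j \<in> S"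
    have "(x j + \<mu> - x j) * (\<Prod>r\<in>S - {j}. (x r + \<mu> - x j) / (x r - x j)) / ((x i - x j) * (x j - z))
      = \<mu> * ((\<Prod>r\<in>S - {j}. (x r + \<mu> - x j) / (x r - x j)) / (x i - x j)) / (x j - z)"
      by simp
    then show "(x j + \<mu> - x j) * (\<Prod>r\<in>S - {j}. (x r + \<mu> - x j) / (x r - x j)) / ((x i - x j) * (x j - z))
      = - (\<mu> * partial_gap_prod x \<mu> N j / ((x j - x i - \<mu>) * (x j - x n - \<mu>)))"
      unfolding Qj[OF \<open>j \<in> S\<close>] by (simp add: z_def algebra_simps)
  qed
  also have "partial_gap_prod x \<mu> N i / (x i - z) + \<dots>
     = - (\<Sum>j\<in>{1..N}. \<mu> * partial_gap_prod x \<mu> N j / ((x j - x i - \<mu>) * (x j - x n - \<mu>)))"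
    unfolding S(3)[symmetric] sum.insert[OF S(1,2)] sum_negf using \<mu>
    by (simp add: z_def diff_diff_eq)
  finally have main: "(\<Sum>j\<in>{1..N}. \<mu>\<^sup>2 * partial_gap_prod x \<mu> N j /
      ((x j - x i - \<mu>) * (x j - x n - \<mu>))) = - \<mu> * ((\<Prod>r\<in>S. (x r + \<mu> - z) / (x r - z)) / (x i - z))"
    by (simp add: sum_distrib_left sum_negf power2_eq_square mult.assoc)
  show ?thesis
  proof (cases "i = n")
    case False
    then have "(\<Prod>r\<in>S. (x r + \<mu> - z) / (x r - z)) = 0"
      using n by (intro prod_zero) (auto simp: S_def z_def)
    then show ?thesis using main False by simp
  next
    case True
    have "partial_gap_prod x (-\<mu>) N i * (\<Prod>r\<in>S. (x r + \<mu> - z) / (x r - z)) = 1"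
      unfolding partial_gap_prod_def S_def[symmetric] prod.distrib[symmetric]
    proof (intro prod.neutral ballI)
      fix r assume "r \<in> S"
      then have r: "r \<ge> 1" "r \<noteq> i" "i \<ge> 1" using i by (auto simp: S_def)
      have "x i \<noteq> x r" using inj_onD[OF inj, of i r] r by auto
      moreover have "x r - x i \<noteq> \<mu>" using ne[of r i] r by auto
      ultimately show "(1 - (-\<mu>) / (x i - x r)) * ((x r + \<mu> - z) / (x r - z)) = 1"
        using True by (simp add: z_def divide_simps) (simp add: algebra_simps)
    qed
    then show ?thesis using main True \<mu> by (simp add: z_def)
  qed
qed

section \<open>Sums of powers and logarithms\<close>

text \<open>Every distance from j occurs at most twice, once on each side of j. This turns bounds in
  |r - j| into bounds uniform in j.\<close>

lemma sum_abs_diff_le: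
  fixes h :: "nat \<Rightarrow> real"
  assumes h: "summable h" "\<And>m. h m \<ge> 0" and F: "finite F"
  shows "(\<Sum>r\<in>F. h (nat \<bar>int r - int j\<bar>)) \<le> 2 * suminf h"
proof -
  have part: "(\<Sum>r\<in>G. h (nat \<bar>int r - int j\<bar>)) \<le> suminf h"
    if "G \<subseteq> F" "inj_on (\<lambda>r. nat \<bar>int r - int j\<bar>) G" for G
  proof -
    have "(\<Sum>r\<in>G. h (nat \<bar>int r - int j\<bar>)) = sum h ((\<lambda>r. nat \<bar>int r - int j\<bar>) ` G)"
      using that(2) by (simp add: sum.reindex)
    also have "\<dots> \<le> suminf h"
      using h that(1) F by (intro sum_le_suminf) (auto intro: finite_subset)
    finally show ?thesis .
  qed
  have "(\<Sum>r\<in>F. h (nat \<bar>int r - int j\<bar>)) = (\<Sum>r\<in>F \<inter> {..j}. h (nat \<bar>int r - int j\<bar>))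
      + (\<Sum>r\<in>F - {..j}. h (nat \<bar>int r - int j\<bar>))"
    using sum.Int_Diff[OF F] .
  also have "\<dots> \<le> suminf h + suminf h"
    by (intro add_mono part) (auto simp: inj_on_def)
  finally show ?thesis by simp
qed

lemma summable_powr_neg:
  fixes \<beta> :: real
  assumes "\<beta> > 1"
  shows "summable (\<lambda>m. real m powr - \<beta>)"
  using assms summable_real_powr_iff[of "-\<beta>"] by simp

text \<open>Telescoping: with p = sqrt (K + 1) and q = sqrt K, the relations (p - q)^2 \<ge> 0 and
  p^2 = q^2 + 1 give 1 / p \<le> 2 (p - q).\<close>

lemma sum_inverse_sqrt_le: "(\<Sum>m\<in>{1..K}. real m powr - (1/2)) \<le> 2 * sqrt (real K)"
proof (induction K)
  case (Suc K)
  have "real (Suc K) powr - (1/2) = 1 / sqrt (real (Suc K))"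
    by (simp add: powr_minus powr_half_sqrt inverse_eq_divide)
  also have "\<dots> \<le> 2 * (sqrt (real (Suc K)) - sqrt (real K))"
  proof -
    define p q where "p = sqrt (real (Suc K))" and "q = sqrt (real K)"
    have pq: "p > 0" "q \<le> p" "p * p = q * q + 1" by (auto simp: p_def q_def)
    have "0 \<le> (p - q) * (p - q)" by simp
    then have "1 \<le> 2 * (p - q) * p" using pq(3) by (simp add: algebra_simps)
    then show ?thesis using pq(1) unfolding p_def[symmetric] q_def[symmetric] by (simp add: field_simps)
  qed
  finally show ?case using Suc by simp
qed simp

text \<open>Comparison with the integral of z^(-\<alpha>), carried out as a telescoping sum through
  the mean value theorem for z^(1-\<alpha>).\<close>

lemma sum_powr_tail_le:
  fixes \<alpha> :: real
  assumes "\<alpha> > 1" "K \<ge> 1"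
  shows "(\<Sum>m\<in>{K<..L}. real m powr - \<alpha>) \<le> real K powr (1 - \<alpha>) / (\<alpha> - 1)"
proof (cases "K \<le> L")
  case True
  have one: "real (Suc m) powr - \<alpha> \<le> (real m powr (1 - \<alpha>) - real (Suc m) powr (1 - \<alpha>)) / (\<alpha> - 1)"
    if "m \<ge> 1" for m
  proof -
    have "\<exists>z. real m < z \<and> z < real (Suc m) \<and> real (Suc m) powr (1 - \<alpha>) - real m powr (1 - \<alpha>)
        = (real (Suc m) - real m) * ((1 - \<alpha>) * z powr (1 - \<alpha> - 1))"
      using that by (intro MVT2) (auto intro!: derivative_eq_intros simp: has_real_derivative_powr)
    then obtain z where z: "real m < z" "z < real (Suc m)"
      "real (Suc m) powr (1 - \<alpha>) - real m powr (1 - \<alpha>) = (1 - \<alpha>) * z powr - \<alpha>" by auto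
    have "real (Suc m) powr - \<alpha> \<le> z powr - \<alpha>"
      using z that assms by (intro powr_mono2') auto
    then have "(\<alpha> - 1) * real (Suc m) powr - \<alpha> \<le> real m powr (1 - \<alpha>) - real (Suc m) powr (1 - \<alpha>)"
      using z(3) assms mult_left_mono[of "real (Suc m) powr - \<alpha>" "z powr - \<alpha>" "\<alpha> - 1"]
      by (simp add: algebra_simps)
    then show ?thesis using assms by (simp add: field_simps)
  qed
  have "(\<Sum>m\<in>{K<..L}. real m powr - \<alpha>) \<le> (real K powr (1 - \<alpha>) - real L powr (1 - \<alpha>)) / (\<alpha> - 1)"
    using True
  proof (induction L rule: dec_induct)
    case (step L)
    have "{K<..Suc L} = insert (Suc L) {K<..L}" using step by auto
    then show ?case using step.IH one[of L] step.hyps assms(2)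
      by (simp add: diff_divide_distrib)
  qed simp
  also have "\<dots> \<le> real K powr (1 - \<alpha>) / (\<alpha> - 1)"
    using assms by (intro divide_right_mono) auto
  finally show ?thesis .
qed (use assms in auto)

text \<open>Up to y = 1 the bound ln (1 + y) \<le> y suffices; beyond it the logarithm is applied to
  the subadditivity (1 + y)^\<beta> \<le> 1 + y^\<beta>.\<close>

lemma ln_one_plus_le_powr:
  fixes y \<beta> :: real
  assumes "y \<ge> 0" "0 < \<beta>" "\<beta> \<le> 1"
  shows "ln (1 + y) \<le> y powr \<beta> / \<beta>"
proof (cases "y \<le> 1")
  case True
  have "ln (1 + y) \<le> y" using ln_add_one_self_le_self assms by auto
  also have "y \<le> y powr \<beta>"
  proof (cases "y = 0")
    case False
    then show ?thesis using assms True powr_mono'[of \<beta> 1 y] by auto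
  qed simp
  also have "\<dots> \<le> y powr \<beta> / \<beta>" using assms by (simp add: field_simps mult_left_le_one_le)
  finally show ?thesis .
next
  case False
  have "\<beta> * ln (1 + y) = ln ((1 + y) powr \<beta>)" using assms by (simp add: ln_powr)
  also have "(1 + y) powr \<beta> \<le> 1 + y powr \<beta>"
  proof -
    have "(1 + y) powr \<beta> = (1 + y) * (1 + y) powr (\<beta> - 1)"
      using assms by (simp add: powr_diff)
    also have "\<dots> = (1 + y) powr (\<beta> - 1) + y * (1 + y) powr (\<beta> - 1)" by (simp add: algebra_simps)
    also have "\<dots> \<le> 1 + y * y powr (\<beta> - 1)"
    proof (intro add_mono mult_left_mono)
      show "(1 + y) powr (\<beta> - 1) \<le> 1"
        using assms powr_mono2'[of "\<beta> - 1" 1 "1 + y"] by simp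
      show "(1 + y) powr (\<beta> - 1) \<le> y powr (\<beta> - 1)"
        using assms False by (intro powr_mono2') auto
    qed (use assms in auto)
    also have "y * y powr (\<beta> - 1) = y powr \<beta>" using False by (simp add: powr_diff)
    finally show ?thesis .
  qed
  then have "ln ((1 + y) powr \<beta>) \<le> ln (1 + y powr \<beta>)" using assms
    by (subst ln_le_cancel_iff) (auto intro: add_pos_nonneg)
  also have "\<dots> \<le> y powr \<beta>" by (rule ln_add_one_self_le_self) auto
  finally show ?thesis using assms by (simp add: field_simps)
qed

text \<open>Splitting at \<open>m \<approx> \<mu>\<^bsup>1/\<alpha>\<^esup>\<close>: below it the logarithm is compared with a square root, above it
  with its argument.\<close>

lemma sum_ln_le_powr:
  fixes \<alpha> c :: real
  assumes \<alpha>: "\<alpha> > 1" and c: "c > 0"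
  shows "\<exists>C>0. \<forall>\<mu>\<ge>0. \<forall>F. finite F \<longrightarrow>
    (\<Sum>m\<in>F. ln (1 + \<mu> / (c * real m powr \<alpha>))) \<le> C * \<mu> powr (1 / \<alpha>)"
proof -
  define Z where "Z = (\<Sum>m. real m powr - \<alpha>)"
  \<comment> \<open>This exponent makes the \<beta>-th power of \<mu> / (c m^\<alpha>) a multiple of
    sqrt a times m^(-1/2), where a = \<mu>^(1/\<alpha>); summed up to m \<le> a it gives a multiple
    of a.\<close>
  define \<beta> where "\<beta> = 1 / (2 * \<alpha>)"
  define C1 where "C1 = Z / c"
  define C2 where "C2 = 2 * (1 / c) powr \<beta> / \<beta> + 2 powr (\<alpha> - 1) / (c * (\<alpha> - 1))"
  have sm: "summable (\<lambda>m. real m powr - \<alpha>)" using summable_powr_neg[OF \<alpha>] .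
  have Z: "Z \<ge> 0" unfolding Z_def using sm by (intro suminf_nonneg) auto
  have \<beta>: "0 < \<beta>" "\<beta> \<le> 1" using \<alpha> by (auto simp: \<beta>_def field_simps)
  have C12: "C1 \<ge> 0" "C2 > 0" using Z c \<beta> \<alpha> by (auto simp: C1_def C2_def intro!: add_pos_pos)
  have main: "(\<Sum>m\<in>F. ln (1 + \<mu> / (c * real m powr \<alpha>))) \<le> (C1 + C2) * \<mu> powr (1 / \<alpha>)"
    if \<mu>: "\<mu> \<ge> 0" and F: "finite F" for \<mu> F
  proof (cases "\<mu> = 0")
    case False
    define a where "a = \<mu> powr (1 / \<alpha>)"
    have a: "a > 0" "\<mu> = a powr \<alpha>" using \<mu> False \<alpha> by (auto simp: a_def powr_powr)
    define f where "f m = ln (1 + \<mu> / (c * real m powr \<alpha>))" for m :: nat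
    have f_nonneg: "f m \<ge> 0" for m unfolding f_def using \<mu> c by (intro ln_ge_zero) auto
    have f_le: "f m \<le> \<mu> / c * real m powr - \<alpha>" for m
    proof -
      have "f m \<le> \<mu> / (c * real m powr \<alpha>)"
        unfolding f_def using \<mu> c by (intro ln_add_one_self_le_self) auto
      then show ?thesis by (simp add: powr_minus divide_inverse mult_ac)
    qed
    show ?thesis
    proof (cases "a < 1")
      \<comment> \<open>No positive index lies below the splitting point. Comparing each logarithm
        with its argument gives a multiple of \<mu> = a^\<alpha>, which is at most a since a <
        1.\<close>
      case True
      have "sum f F \<le> (\<Sum>m\<in>F. \<mu> / c * real m powr - \<alpha>)" by (intro sum_mono f_le)
      also have "\<dots> \<le> \<mu> / c * Z"
        unfolding sum_distrib_left[symmetric] Z_def using \<mu> c F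
        by (intro mult_left_mono sum_le_suminf sm) auto
      also have "\<dots> = C1 * \<mu>" by (simp add: C1_def)
      also have "\<dots> \<le> C1 * a"
        using C12 a True \<alpha> powr_mono'[of 1 \<alpha> a] by (intro mult_left_mono) auto
      also have "\<dots> \<le> (C1 + C2) * a" using C12 a by (intro mult_right_mono) auto
      finally show ?thesis by (simp add: f_def a_def)
    next
      case False
      define K where "K = nat \<lfloor>a\<rfloor>"
      define L where "L = Max (insert K F)"
      have K: "K \<ge> 1" "real K \<le> a" "a / 2 \<le> real K"
      proof -
        have "1 \<le> \<lfloor>a\<rfloor>" using False by simp
        then have "1 \<le> real_of_int \<lfloor>a\<rfloor>" "real K = real_of_int \<lfloor>a\<rfloor>" by (auto simp: K_def)
        then show "K \<ge> 1" "real K \<le> a" "a / 2 \<le> real K" by linarith+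
      qed
      have "F \<subseteq> {0} \<union> {1..K} \<union> {K<..L}" using F by (auto simp: L_def)
      then have "sum f F \<le> sum f ({0} \<union> {1..K} \<union> {K<..L})"
        by (intro sum_mono2) (auto simp: f_nonneg)
      also have "\<dots> = sum f ({0} \<union> {1..K}) + sum f {K<..L}" by (intro sum.union_disjoint) auto
      \<comment> \<open>The term at 0 vanishes, since 0 powr \<alpha> = 0, division by 0 gives 0,
        and ln 1 = 0.\<close>
      also have "sum f ({0} \<union> {1..K}) = sum f {1..K}"
        using \<alpha> by (subst sum.union_disjoint) (auto simp: f_def)
      also have "sum f {1..K} \<le> (\<Sum>m\<in>{1..K}. (1 / c) powr \<beta> / \<beta> * sqrt a * real m powr - (1/2))"
      proof (intro sum_mono)
        fix m assume m: "m \<in> {1..K}"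
        have "f m \<le> (\<mu> / (c * real m powr \<alpha>)) powr \<beta> / \<beta>"
          unfolding f_def using \<mu> c \<beta> by (intro ln_one_plus_le_powr) auto
        also have "(\<mu> / (c * real m powr \<alpha>)) powr \<beta>
            = (1 / c) powr \<beta> * sqrt a * real m powr - (1/2)"
          using m a c \<alpha>
          by (simp add: powr_mult powr_divide powr_powr \<beta>_def powr_minus powr_half_sqrt field_simps)
        finally show "f m \<le> (1 / c) powr \<beta> / \<beta> * sqrt a * real m powr - (1/2)" by simp
      qed
      also have "\<dots> \<le> (1 / c) powr \<beta> / \<beta> * sqrt a * (2 * sqrt a)"
        unfolding sum_distrib_left[symmetric]
        using \<beta> a K order_trans[OF sum_inverse_sqrt_le, of K "2 * sqrt a"]
        by (intro mult_left_mono) auto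
      also have "\<dots> = 2 * (1 / c) powr \<beta> / \<beta> * a" using a by simp
      also have "sum f {K<..L} \<le> (\<Sum>m\<in>{K<..L}. \<mu> / c * real m powr - \<alpha>)" by (intro sum_mono f_le)
      also have "\<dots> \<le> \<mu> / c * (real K powr (1 - \<alpha>) / (\<alpha> - 1))"
        unfolding sum_distrib_left[symmetric] using \<mu> c sum_powr_tail_le[OF \<alpha> K(1)]
        by (intro mult_left_mono) auto
      also have "\<dots> \<le> \<mu> / c * ((a / 2) powr (1 - \<alpha>) / (\<alpha> - 1))"
        using \<mu> c \<alpha> a K by (intro mult_left_mono divide_right_mono powr_mono2') auto
      also have "\<dots> = 2 powr (\<alpha> - 1) / (c * (\<alpha> - 1)) * a"
      proof -
        have "(a / 2) powr (1 - \<alpha>) = a * 2 powr (\<alpha> - 1) / \<mu>"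
          using a by (simp add: powr_divide powr_diff)
        then show ?thesis using a by simp
      qed
      finally have "sum f F \<le> C2 * a" by (simp add: C2_def algebra_simps)
      also have "\<dots> \<le> (C1 + C2) * a" using C12 a by (intro mult_right_mono) auto
      finally show ?thesis by (simp add: f_def a_def)
    qed
  qed simp
  show ?thesis using main C12 by (intro exI[of _ "C1 + C2"]) auto
qed

section \<open>Sequences with polynomial gaps\<close>

text \<open>Tannery's theorem for sums whose terms and range both depend on N. It carries the finite
  Cauchy identities over to infinitely many eigenvalues.\<close>

lemma dominated_partial_sums_tendsto:
  fixes f :: "nat \<Rightarrow> nat \<Rightarrow> complex"
  assumes lim: "\<And>j. j \<ge> 1 \<Longrightarrow> (\<lambda>N. f N j) \<longlonglongrightarrow> g j"
    and bound: "\<And>N j. j \<in> {1..N} \<Longrightarrow> cmod (f N j) \<le> M j"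
    and M: "summable M"
  shows "(\<lambda>j. norm (g j)) summable_on {1..}" "(\<lambda>N. \<Sum>j\<in>{1..N}. f N j) \<longlonglongrightarrow> infsum g {1..}"
proof -
  define a where "a j N = (if j \<in> {1..N} then f N j else 0)" for j N
  define b where "b j = (if j \<ge> 1 then g j else 0)" for j
  \<comment> \<open>\<open>M 0\<close> is unconstrained and may be negative, so index 0 is cut off
    before the comparison.\<close>
  define M' where "M' j = (if j \<ge> 1 then \<bar>M j\<bar> else 0)" for j
  have M_nonneg: "j \<ge> 1 \<Longrightarrow> M j \<ge> 0" for j
    using order_trans[OF norm_ge_zero bound[of j j]] by simp
  have M': "summable M'"
    by (rule summable_cong[THEN iffD2, OF _ M])
       (use M_nonneg in \<open>auto simp: M'_def eventually_at_top_linorder intro!: exI[of _ 1]\<close>)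
  have "(\<lambda>N. a j N) \<longlonglongrightarrow> b j" for j
  proof (cases "j \<ge> 1")
    case True
    have "eventually (\<lambda>N. f N j = a j N) sequentially"
      using eventually_ge_at_top[of j] by eventually_elim (use True in \<open>simp add: a_def\<close>)
    then show ?thesis using lim[OF True] True by (simp add: b_def tendsto_cong)
  next
    case False
    then have "j = 0" by simp
    then show ?thesis by (simp add: a_def b_def)
  qed
  moreover have "\<forall>\<^sub>F (k, N) in at_top \<times>\<^sub>F sequentially. cmod (a k N) \<le> M' k"
  proof (intro always_eventually allI, clarify)
    fix k N show "cmod (a k N) \<le> M' k"
      using order_trans[OF bound abs_ge_self, of k N] by (auto simp: a_def M'_def)
  qed
  ultimately have T: "summable (\<lambda>k. norm (b k))" "(\<lambda>N. \<Sum>k. a k N) \<longlonglongrightarrow> suminf b"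
    using tannerys_theorem[where F = sequentially and a = a and b = b and M = M'] M' by auto
  have bs: "(\<lambda>j. norm (b j)) summable_on UNIV"
    using T(1) by (intro norm_summable_imp_summable_on) simp
  then show "(\<lambda>j. norm (g j)) summable_on {1..}"
    by (rule summable_on_cong_neutral[THEN iffD1, rotated -1]) (auto simp: b_def)
  have "(b has_sum suminf b) UNIV"
    using norm_summable_imp_has_sum[OF T(1)] summable_sums[OF summable_norm_cancel[OF T(1)]] by blast
  then have "infsum b UNIV = suminf b" by (rule infsumI)
  moreover have "infsum b UNIV = infsum g {1..}"
    by (rule infsum_cong_neutral) (auto simp: b_def)
  moreover have "(\<Sum>k. a k N) = (\<Sum>j\<in>{1..N}. f N j)" for N
    by (subst suminf_finite[of "{1..N}"]) (auto simp: a_def)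
  ultimately show "(\<lambda>N. \<Sum>j\<in>{1..N}. f N j) \<longlonglongrightarrow> infsum g {1..}" using T(2) by simp
qed

section \<open>The kernel, infinite gap products and Schur row sums\<close>

text \<open>A symmetric real majorant of the Cauchy matrix that no longer contains \<mu>; the added
  1 takes care of the diagonal.\<close>

definition kern :: "(nat \<Rightarrow> complex) \<Rightarrow> nat \<Rightarrow> nat \<Rightarrow> real" where
  "kern x p n = 1 / (1 + cmod (x p - x n))"

lemma kern_bounds: "kern x p n \<ge> 0" "kern x p n \<le> 1" "kern x p p = 1"
  by (auto simp: kern_def divide_le_eq add_pos_nonneg)

lemma kern_commute: "kern x p n = kern x n p"
  by (simp add: kern_def norm_minus_commute)

text \<open>With t for the modulus of the denominator, 1 + |x p - x n| \<le> 1 + |\<mu>| + t, and t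
  \<ge> \<delta> turns the constant part into a multiple of t. The loss (1 + |\<mu>|) / \<delta> is
  the price of small denominators.\<close>

lemma kern_resolvent_bound:
  assumes "\<delta> > 0" "\<delta> \<le> cmod (x p - x n - \<mu>)"
  shows "1 / cmod (x p - x n - \<mu>) \<le> (1 + (1 + cmod \<mu>) / \<delta>) * kern x p n"
proof -
  define t where "t = cmod (x p - x n - \<mu>)"
  have t: "t \<ge> \<delta>" using assms by (simp add: t_def)
  have "1 + cmod (x p - x n) \<le> 1 + cmod \<mu> + t"
    unfolding t_def using norm_triangle_ineq[of "x p - x n - \<mu>" \<mu>] by simp
  also have "\<dots> \<le> (1 + cmod \<mu>) / \<delta> * t + t"
  proof -
    have "(1 + cmod \<mu>) * 1 \<le> (1 + cmod \<mu>) * (t / \<delta>)"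
      using t assms by (intro mult_left_mono) auto
    then show ?thesis by simp
  qed
  finally have "1 + cmod (x p - x n) \<le> (1 + (1 + cmod \<mu>) / \<delta>) * t" by (simp add: algebra_simps)
  moreover have "1 + cmod (x p - x n) > 0" "t > 0"
    using t assms(1) norm_ge_zero[of "x p - x n"] by linarith+
  ultimately show ?thesis unfolding kern_def t_def[symmetric] by (simp add: divide_simps)
qed

locale gap_sequence =
  fixes x :: "nat \<Rightarrow> complex" and \<alpha> c :: real
  assumes alpha: "\<alpha> > 1" and c_pos: "c > 0"
    and gap: "\<And>k n. k \<ge> 1 \<Longrightarrow> n \<ge> 1 \<Longrightarrow>
      c * real k powr (\<alpha> - 1) * \<bar>real k - real n\<bar> \<le> cmod (x k - x n)"
begin

lemma inj: "inj_on x {1..}"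
proof (rule inj_onI, rule ccontr)
  fix k n assume *: "k \<in> {1..}" "n \<in> {1..}" "x k = x n" "k \<noteq> n"
  then have "c * real k powr (\<alpha> - 1) * \<bar>real k - real n\<bar> > 0"
    using c_pos by (intro mult_pos_pos) auto
  then show False using gap[of k n] * by simp
qed

text \<open>The gap condition is used with the larger index k, since |k - n| \<le> k allows
  k^(\<alpha>-1) to be replaced by |k - n|^(\<alpha>-1).\<close>

lemma gap_dist:
  assumes "k \<ge> 1" "n \<ge> 1"
  shows "c * real (nat \<bar>int k - int n\<bar>) powr \<alpha> \<le> cmod (x k - x n)"
proof -
  have *: "c * real (nat \<bar>int k - int n\<bar>) powr \<alpha> \<le> cmod (x k - x n)"
    if "k \<ge> 1" "n \<ge> 1" "n \<le> k" for k n
  proof -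
    define m where "m = nat \<bar>int k - int n\<bar>"
    have m: "real m = \<bar>real k - real n\<bar>" "m \<le> k" using that by (auto simp: m_def)
    have "real m powr \<alpha> = real m powr (\<alpha> - 1) * real m" by (cases "m = 0") (auto simp: powr_diff)
    also have "\<dots> \<le> real k powr (\<alpha> - 1) * real m"
      using alpha m by (intro mult_right_mono powr_mono2) auto
    finally have "c * real m powr \<alpha> \<le> c * real k powr (\<alpha> - 1) * real m"
      using c_pos by (simp add: mult.assoc)
    then show ?thesis using gap[OF that(1,2)] m unfolding m_def[symmetric] by simp
  qed
  show ?thesis
    using *[of k n] *[of n k] assms
    by (cases "n \<le> k") (auto simp: norm_minus_commute abs_minus_commute)
qed

lemma factor_bound:
  assumes "j \<ge> 1" "r \<ge> 1"
  shows "cmod (\<mu> / (x j - x r)) \<le> cmod \<mu> / (c * real (nat \<bar>int r - int j\<bar>) powr \<alpha>)"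
proof (cases "r = j")
  case False
  have "c * real (nat \<bar>int r - int j\<bar>) powr \<alpha> > 0" using False c_pos by simp
  then show ?thesis using gap_dist[of r j] assms
    by (auto simp: norm_divide norm_minus_commute intro!: divide_left_mono mult_pos_pos)
\<comment> \<open>For r = j both sides are 0, by the conventions for division by 0 and 0 powr
  \<alpha>.\<close>
qed auto

lemma summable_reciprocal_powr: "summable (\<lambda>m. B / (c * real m powr \<alpha>))"
proof -
  have "summable (\<lambda>m. B / c * real m powr - \<alpha>)"
    by (intro summable_mult summable_powr_neg alpha)
  then show ?thesis by (simp add: powr_minus divide_inverse mult_ac)
qed

text \<open>By \<open>factor_bound\<close> the deviations of the factors from 1 are absolutely
  summable, so the infinite product converges.\<close>

lemma partial_gap_prod_tendsto:
  assumes j: "j \<ge> 1"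
  shows "(\<lambda>N. partial_gap_prod x \<mu> N j) \<longlonglongrightarrow> gap_prod x \<mu> j"
proof -
  define f where "f r = (if r \<ge> 1 \<and> r \<noteq> j then 1 - \<mu> / (x j - x r) else 1)" for r
  define h where "h m = cmod \<mu> / (c * real m powr \<alpha>)" for m :: nat
  have h: "summable h" "\<And>m. h m \<ge> 0"
    using summable_reciprocal_powr[of "cmod \<mu>"] c_pos by (auto simp: h_def[abs_def])
  have "summable (\<lambda>r. norm (f r - 1))"
  proof (rule summableI_nonneg_bounded)
    fix n
    have "(\<Sum>r<n. norm (f r - 1)) \<le> (\<Sum>r<n. h (nat \<bar>int r - int j\<bar>))"
    proof (intro sum_mono)
      fix r show "norm (f r - 1) \<le> h (nat \<bar>int r - int j\<bar>)"
      proof (cases "r \<ge> 1 \<and> r \<noteq> j")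
        case True
        then show ?thesis using factor_bound[OF j, of r \<mu>] by (simp add: f_def h_def)
      next
        case False
        then have "f r = 1" by (auto simp: f_def)
        then show ?thesis using h(2) by simp
      qed
    qed
    also have "\<dots> \<le> 2 * suminf h" by (intro sum_abs_diff_le h) auto
    finally show "(\<Sum>r<n. norm (f r - 1)) \<le> 2 * suminf h" .
  qed simp
  then have "convergent_prod f"
    by (intro abs_convergent_prod_imp_convergent_prod summable_imp_abs_convergent_prod)
  then have "(\<lambda>N. \<Prod>r\<le>N. f r) \<longlonglongrightarrow> prodinf f" by (rule convergent_prod_LIMSEQ)
  moreover have "(\<Prod>r\<le>N. f r) = partial_gap_prod x \<mu> N j" for N
    unfolding partial_gap_prod_def
    by (rule prod.mono_neutral_cong_right) (auto simp: f_def)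
  ultimately show ?thesis by (simp add: gap_prod_def f_def[abs_def])
qed

text \<open>A factor at distance m from j has modulus at most 1 + |\<mu>| / (c m^\<alpha>), so
  \<open>sum_ln_le_powr\<close> bounds the logarithm of the product uniformly in N and j; the factor
  2 counts both sides of j.\<close>

lemma partial_gap_prod_bound:
  "\<exists>C>0. \<forall>\<mu> N j. j \<ge> 1 \<longrightarrow> cmod (partial_gap_prod x \<mu> N j) \<le> exp (C * cmod \<mu> powr (1 / \<alpha>))"
proof -
  obtain C where C: "C > 0" "\<And>t F. t \<ge> 0 \<Longrightarrow> finite F \<Longrightarrow>
      (\<Sum>m\<in>F. ln (1 + t / (c * real m powr \<alpha>))) \<le> C * t powr (1 / \<alpha>)"
    using sum_ln_le_powr[OF alpha c_pos] by blast
  have "cmod (partial_gap_prod x \<mu> N j) \<le> exp (2 * C * cmod \<mu> powr (1 / \<alpha>))" if j: "j \<ge> 1" for \<mu> N j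
  proof -
    define h where "h m = ln (1 + cmod \<mu> / (c * real m powr \<alpha>))" for m :: nat
    have h0: "h m \<ge> 0" for m unfolding h_def using c_pos by (intro ln_ge_zero) auto
    have h: "summable h"
      by (rule summableI_nonneg_bounded[OF h0, where x = "C * cmod \<mu> powr (1 / \<alpha>)"])
         (use C(2)[of "cmod \<mu>"] in \<open>auto simp: h_def\<close>)
    have "suminf h \<le> C * cmod \<mu> powr (1 / \<alpha>)"
      using C(2)[of "cmod \<mu>"] by (intro suminf_le_const h) (auto simp: h_def)
    moreover have "(\<Sum>r\<in>{1..N} - {j}. h (nat \<bar>int r - int j\<bar>)) \<le> 2 * suminf h"
      by (intro sum_abs_diff_le h h0) auto
    ultimately have s: "(\<Sum>r\<in>{1..N} - {j}. h (nat \<bar>int r - int j\<bar>)) \<le> 2 * C * cmod \<mu> powr (1 / \<alpha>)"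
      by linarith
    have "cmod (partial_gap_prod x \<mu> N j) = (\<Prod>r\<in>{1..N} - {j}. cmod (1 - \<mu> / (x j - x r)))"
      by (simp add: partial_gap_prod_def prod_norm)
    also have "\<dots> \<le> (\<Prod>r\<in>{1..N} - {j}. exp (h (nat \<bar>int r - int j\<bar>)))"
    proof (intro prod_mono conjI norm_ge_zero)
      fix r assume "r \<in> {1..N} - {j}"
      then have "cmod (1 - \<mu> / (x j - x r)) \<le> 1 + cmod \<mu> / (c * real (nat \<bar>int r - int j\<bar>) powr \<alpha>)"
        using norm_triangle_ineq4[of 1 "\<mu> / (x j - x r)"] factor_bound[OF j, of r \<mu>] by auto
      also have "\<dots> = exp (h (nat \<bar>int r - int j\<bar>))"
        unfolding h_def using c_pos by (subst exp_ln) (auto intro!: add_pos_nonneg)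
      finally show "cmod (1 - \<mu> / (x j - x r)) \<le> exp (h (nat \<bar>int r - int j\<bar>))" .
    qed
    also have "\<dots> = exp (\<Sum>r\<in>{1..N} - {j}. h (nat \<bar>int r - int j\<bar>))" by (simp add: exp_sum)
    also have "\<dots> \<le> exp (2 * C * cmod \<mu> powr (1 / \<alpha>))" using s by simp
    finally show ?thesis .
  qed
  then show ?thesis using C(1) by (intro exI[of _ "2 * C"]) auto
qed

text \<open>Fixed by choice so that one constant, depending on neither \<mu> nor \<delta>, can be
  quoted in later statements. Up to an added 1 it is the final rate C.\<close>

definition growth :: real where
  "growth = (SOME C. C > 0 \<and> (\<forall>\<mu> N j. j \<ge> 1 \<longrightarrow>
     cmod (partial_gap_prod x \<mu> N j) \<le> exp (C * cmod \<mu> powr (1 / \<alpha>))))"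

lemma growth_pos: "growth > 0"
  and partial_gap_prod_le:
    "j \<ge> 1 \<Longrightarrow> cmod (partial_gap_prod x \<mu> N j) \<le> exp (growth * cmod \<mu> powr (1 / \<alpha>))"
  using someI_ex[OF partial_gap_prod_bound] unfolding growth_def by blast+

lemma gap_prod_le:
  assumes "j \<ge> 1"
  shows "cmod (gap_prod x \<mu> j) \<le> exp (growth * cmod \<mu> powr (1 / \<alpha>))"
  by (rule tendsto_upperbound[OF tendsto_norm[OF partial_gap_prod_tendsto[OF assms]]])
     (auto intro: always_eventually partial_gap_prod_le assms)

text \<open>Three regimes. For indices comparable up to the factor 2 the ratio is bounded and the
  kernel decays like |n - p|^(-\<alpha>). For p > 2n the kernel is at most of order p^(-\<alpha>),
  and \<tau> \<le> \<alpha> trades p for n. For n > 2p it is at most of order n^(-\<alpha>), and a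
  negative \<tau> costs n^(-\<tau>).\<close>

lemma schur_row_pointwise:
  assumes \<tau>: "\<tau> \<le> \<alpha>" and p: "p \<ge> 1" and n: "n \<ge> 1"
  shows "(real p / real n) powr \<tau> * kern x p n \<le>
    max 1 (1 / c) * (2 powr \<bar>\<tau>\<bar> * (if p = n then 1 else real (nat \<bar>int n - int p\<bar>) powr - \<alpha>)
      + 2 * real n powr - \<alpha> + 2 * real n powr (- \<tau> - \<alpha>))"
proof -
  define m where "m = real (nat \<bar>int n - int p\<bar>)"
  define D where "D = max 1 (1 / c)"
  have D: "D \<ge> 1" "D \<ge> 1 / c" by (auto simp: D_def)
  have m: "m = \<bar>real p - real n\<bar>" by (simp add: m_def)
  have k_le: "kern x p n \<le> D / t" if "t > 0" "c * t \<le> cmod (x p - x n)" for t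
  proof -
    have "kern x p n \<le> 1 / (c * t)"
      unfolding kern_def using that c_pos by (intro divide_left_mono mult_pos_pos) (auto intro: add_pos_nonneg)
    also have "\<dots> = (1 / c) / t" by simp
    also have "\<dots> \<le> D / t" using that D by (intro divide_right_mono) auto
    finally show ?thesis .
  qed
  consider "p = n" | "p \<noteq> n" "p \<le> 2 * n" "n \<le> 2 * p" | "p > 2 * n" | "n > 2 * p" by linarith
  then have "(real p / real n) powr \<tau> * kern x p n \<le>
    D * (2 powr \<bar>\<tau>\<bar> * (if p = n then 1 else m powr - \<alpha>)) + D * (2 * real n powr - \<alpha>)
      + D * (2 * real n powr (- \<tau> - \<alpha>))" (is "_ \<le> ?a + ?b + ?c")
  proof cases
    case 1
    have "1 \<le> D * (2 powr \<bar>\<tau>\<bar> * 1)"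
      using D mult_mono[of 1 D 1 "2 powr \<bar>\<tau>\<bar>"] by (simp add: ge_one_powr_ge_zero)
    moreover have "?b \<ge> 0" "?c \<ge> 0" using D by auto
    ultimately show ?thesis using 1 n by (simp add: kern_bounds)
  next
    case 2
    have "m > 0" using 2 m by auto
    then have k: "kern x p n \<le> D * m powr - \<alpha>"
      using k_le[of "m powr \<alpha>"] gap_dist[OF p n]
      by (simp add: m_def abs_minus_commute powr_minus divide_inverse)
    have "(real p / real n) powr \<tau> \<le> 2 powr \<bar>\<tau>\<bar>"
    proof (cases "\<tau> \<ge> 0")
      case True
      then show ?thesis using 2 n by (auto intro!: powr_mono2 simp: field_simps)
    next
      case False
      have "(real p / real n) powr \<tau> = (real n / real p) powr \<bar>\<tau>\<bar>"
        using p n False by (simp add: powr_divide powr_minus field_simps)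
      also have "\<dots> \<le> 2 powr \<bar>\<tau>\<bar>" using 2 p by (intro powr_mono2) (auto simp: field_simps)
      finally show ?thesis .
    qed
    then have "(real p / real n) powr \<tau> * kern x p n \<le> 2 powr \<bar>\<tau>\<bar> * (D * m powr - \<alpha>)"
      using k by (intro mult_mono) (auto simp: kern_bounds)
    also have "\<dots> = ?a" using 2 by simp
    moreover have "?b \<ge> 0" "?c \<ge> 0" using D by auto
    ultimately show ?thesis by linarith
  next
    case 3
    have "c * (real p powr \<alpha> / 2) \<le> c * real p powr (\<alpha> - 1) * \<bar>real p - real n\<bar>"
      using 3 c_pos p by (simp add: powr_diff field_simps)
    from k_le[OF _ order_trans[OF this gap[OF p n]]] have "kern x p n \<le> 2 * D * real p powr - \<alpha>"
      using p by (simp add: powr_minus_divide mult.commute)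
    then have "(real p / real n) powr \<tau> * kern x p n \<le> (real p / real n) powr \<tau> * (2 * D * real p powr - \<alpha>)"
      by (intro mult_left_mono) auto
    also have "\<dots> = 2 * D * real n powr - \<tau> * real p powr (\<tau> - \<alpha>)"
      using p n by (simp add: powr_divide powr_minus powr_diff field_simps)
    also have "\<dots> \<le> 2 * D * real n powr - \<tau> * real n powr (\<tau> - \<alpha>)"
      using 3 \<tau> n D by (intro mult_left_mono powr_mono2') auto
    also have "\<dots> = ?b" using n by (simp add: powr_minus powr_diff field_simps)
    finally show ?thesis using D by (auto intro: order_trans[where y = "?b"] add_increasing add_increasing2)
  next
    case 4
    have "c * (real n powr \<alpha> / 2) \<le> c * real n powr (\<alpha> - 1) * \<bar>real n - real p\<bar>"
      using 4 c_pos n by (simp add: powr_diff field_simps)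
    from k_le[OF _ order_trans[OF this gap[OF n p, unfolded norm_minus_commute[of "x n"]]]]
    have "kern x p n \<le> 2 * D * real n powr - \<alpha>" using n by (simp add: powr_minus_divide mult.commute)
    then have *: "(real p / real n) powr \<tau> * kern x p n \<le> (real p / real n) powr \<tau> * (2 * D * real n powr - \<alpha>)"
      by (intro mult_left_mono) auto
    show ?thesis
    proof (cases "\<tau> \<ge> 0")
      case True
      have "(real p / real n) powr \<tau> \<le> 1" using True 4 n by (intro powr_le1) auto
      then have "(real p / real n) powr \<tau> * (2 * D * real n powr - \<alpha>) \<le> ?b"
        using D mult_right_mono[of "(real p / real n) powr \<tau>" 1 "2 * D * real n powr - \<alpha>"] by simp
      moreover have "?a \<ge> 0" "?c \<ge> 0" using D by auto
      ultimately show ?thesis using * by linarith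
    next
      case False
      have "real p powr \<tau> \<le> 1" using False p powr_mono2'[of \<tau> 1 "real p"] by simp
      then have "real p powr \<tau> * (2 * D * real n powr (- \<tau> - \<alpha>)) \<le> ?c"
        using D mult_right_mono[of "real p powr \<tau>" 1 "2 * D * real n powr (- \<tau> - \<alpha>)"] by simp
      moreover have "(real p / real n) powr \<tau> * (2 * D * real n powr - \<alpha>)
          = real p powr \<tau> * (2 * D * real n powr (- \<tau> - \<alpha>))"
        using p n by (simp add: powr_divide powr_diff powr_minus field_simps)
      moreover have "?a \<ge> 0" "?b \<ge> 0" using D by auto
      ultimately show ?thesis using * by linarith
    qed
  qed
  then show ?thesis unfolding D_def[symmetric] m_def[symmetric] by (simp only: distrib_left)
qed

text \<open>The condition \<tau> > 1 - \<alpha> makes n^(-\<tau>-\<alpha>) summable; the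
  near-diagonal part is summed over the distance |n - p|.\<close>

lemma schur_row:
  assumes \<tau>: "1 - \<alpha> < \<tau>" "\<tau> \<le> \<alpha>"
  shows "\<exists>S>0. \<forall>p\<ge>1. \<forall>F. finite F \<and> F \<subseteq> {1..} \<longrightarrow>
    (\<Sum>n\<in>F. (real p / real n) powr \<tau> * kern x p n) \<le> S"
proof -
  \<comment> \<open>The value at 0 stands for the diagonal entry n = p, where 0 powr -\<alpha> would
    give 0.\<close>
  define h where "h m = (if m = 0 then 1 else real m powr - \<alpha>)" for m :: nat
  define g where "g n = 2 * real n powr - \<alpha> + 2 * real n powr (- \<tau> - \<alpha>)" for n :: nat
  define D where "D = max 1 (1 / c)"
  have h: "summable h" "\<And>m. h m \<ge> 0"
    using summable_powr_neg[OF alpha]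
    by (auto simp: h_def intro: summable_cong[THEN iffD1, rotated] eventually_mono[OF eventually_gt_at_top[of 0]])
  have g: "summable g" "\<And>m. g m \<ge> 0"
    unfolding g_def using summable_powr_neg[of "\<tau> + \<alpha>"] summable_powr_neg[OF alpha] \<tau>
    by (auto intro!: summable_add summable_mult)
  have bound: "(\<Sum>n\<in>F. (real p / real n) powr \<tau> * kern x p n) \<le> D * (2 powr \<bar>\<tau>\<bar> * (2 * suminf h) + suminf g)"
    if p: "p \<ge> 1" and F: "finite F" "F \<subseteq> {1..}" for p F
  proof -
    have "(\<Sum>n\<in>F. (real p / real n) powr \<tau> * kern x p n)
       \<le> (\<Sum>n\<in>F. D * (2 powr \<bar>\<tau>\<bar> * h (nat \<bar>int n - int p\<bar>) + g n))"
    proof (intro sum_mono)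
      fix n assume "n \<in> F"
      then have "n \<ge> 1" using F by auto
      from schur_row_pointwise[OF \<tau>(2) p this]
      show "(real p / real n) powr \<tau> * kern x p n \<le> D * (2 powr \<bar>\<tau>\<bar> * h (nat \<bar>int n - int p\<bar>) + g n)"
        by (cases "p = n") (simp_all add: D_def h_def g_def add.assoc)
    qed
    also have "\<dots> = D * (2 powr \<bar>\<tau>\<bar> * (\<Sum>n\<in>F. h (nat \<bar>int n - int p\<bar>)) + sum g F)"
      by (simp add: sum_distrib_left[symmetric] sum.distrib)
    also have "\<dots> \<le> D * (2 powr \<bar>\<tau>\<bar> * (2 * suminf h) + suminf g)"
      using F by (intro mult_left_mono add_mono sum_abs_diff_le h sum_le_suminf g) (auto simp: D_def g)
    finally show ?thesis .
  qed
  define S where "S = D * (2 powr \<bar>\<tau>\<bar> * (2 * suminf h) + suminf g)"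
  have "S \<ge> 0" using suminf_nonneg[OF h] suminf_nonneg[OF g] by (auto simp: S_def D_def)
  then show ?thesis using bound[folded S_def]
    by (intro exI[of _ "S + 1"]) (auto intro: add_increasing2)
qed

lemma summable_kern:
  assumes "p \<ge> 1"
  shows "summable (\<lambda>n. kern x p n)"
proof -
  obtain S where S: "\<forall>p\<ge>1. \<forall>F. finite F \<and> F \<subseteq> {1..} \<longrightarrow>
      (\<Sum>n\<in>F. (real p / real n) powr 0 * kern x p n) \<le> S"
    using schur_row[of 0] alpha by auto
  have S: "(\<Sum>n\<in>F. kern x p n) \<le> S" if "finite F" "F \<subseteq> {1..}" for F
  proof -
    have "(\<Sum>n\<in>F. kern x p n) = (\<Sum>n\<in>F. (real p / real n) powr 0 * kern x p n)"
      using that assms by (intro sum.cong) auto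
    then show ?thesis using S assms that by simp
  qed
  show ?thesis
  proof (rule summableI_nonneg_bounded[where x = "1 + S"])
    fix n
    \<comment> \<open>Index 0 lies outside the gap hypothesis; its term is simply bounded by
      1.\<close>
    have "sum (kern x p) {..<n} \<le> sum (kern x p) ({0} \<union> {1..<n})"
      by (intro sum_mono2) (auto simp: kern_bounds)
    also have "\<dots> \<le> 1 + S"
    proof -
      have "{1..<n} \<subseteq> {1..}" by auto
      then have "kern x p 0 + sum (kern x p) {1..<n} \<le> 1 + S"
        by (intro add_mono kern_bounds S) auto
      then show ?thesis by (subst sum.union_disjoint) auto
    qed
    finally show "sum (kern x p) {..<n} \<le> 1 + S" .
  qed (simp add: kern_bounds)
qed

end

section \<open>The infinite Cauchy matrix identities\<close>

locale separated_gap_sequence = gap_sequence +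
  fixes \<mu> :: complex and \<delta> :: real
  assumes mu_nonzero: "\<mu> \<noteq> 0" and delta_pos: "\<delta> > 0"
    and separated: "\<And>p n. p \<ge> 1 \<Longrightarrow> n \<ge> 1 \<Longrightarrow> \<delta> \<le> cmod (x p - x n - \<mu>)"
begin

lemma ne: "p \<ge> 1 \<Longrightarrow> n \<ge> 1 \<Longrightarrow> x p - x n \<noteq> \<mu>"
  using separated[of p n] delta_pos by auto

text \<open>Exchanging the two indices turns a distance to \<mu> into one to -\<mu>. Through this
  symmetry the relations for a left inverse also yield those for a right inverse.\<close>

lemma reflected: "separated_gap_sequence x \<alpha> c (-\<mu>) \<delta>"
proof
  fix p n :: nat assume "p \<ge> 1" "n \<ge> 1"
  then have "\<delta> \<le> cmod (x n - x p - \<mu>)" by (rule separated[rotated])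
  also have "\<dots> = cmod (- (x n - x p - \<mu>))" by (rule norm_minus_cancel[symmetric])
  finally show "\<delta> \<le> cmod (x p - x n - - \<mu>)" by (simp add: algebra_simps)
qed (use mu_nonzero delta_pos in auto)

definition res_const :: real where "res_const = 1 + (1 + cmod \<mu>) / \<delta>"

lemma res_const_ge_1: "res_const \<ge> 1"
  using delta_pos by (simp add: res_const_def)

lemma resolvent_bound:
  "p \<ge> 1 \<Longrightarrow> n \<ge> 1 \<Longrightarrow> 1 / cmod (x p - x n - \<mu>) \<le> res_const * kern x p n"
  unfolding res_const_def by (intro kern_resolvent_bound delta_pos separated)

text \<open>The finite sums equal -1 as soon as N \<ge> i; the uniform bound on the gap products and
  \<open>summable_kern\<close> supply the domination needed for the limit.\<close>

lemma gap_prod_sum: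
  assumes i: "i \<ge> 1"
  shows "(\<Sum>\<^sub>\<infinity>j\<in>{1..}. \<mu> * gap_prod x \<mu> j / (x j - x i - \<mu>)) = -1"
proof -
  define E where "E = cmod \<mu> * exp (growth * cmod \<mu> powr (1 / \<alpha>)) * res_const"
  have bound: "cmod (\<mu> * partial_gap_prod x \<mu> N j / (x j - x i - \<mu>)) \<le> E * kern x i j"
    if "j \<in> {1..N}" for N j
  proof -
    have "cmod (\<mu> * partial_gap_prod x \<mu> N j / (x j - x i - \<mu>))
        = cmod \<mu> * cmod (partial_gap_prod x \<mu> N j) * (1 / cmod (x j - x i - \<mu>))"
      by (simp add: norm_mult norm_divide)
    also have "\<dots> \<le> cmod \<mu> * exp (growth * cmod \<mu> powr (1 / \<alpha>)) * (res_const * kern x j i)"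
      using that i by (intro mult_mono partial_gap_prod_le resolvent_bound) auto
    finally show ?thesis by (simp add: E_def kern_commute mult.assoc)
  qed
  have "(\<lambda>N. \<Sum>j\<in>{1..N}. \<mu> * partial_gap_prod x \<mu> N j / (x j - x i - \<mu>))
      \<longlonglongrightarrow> (\<Sum>\<^sub>\<infinity>j\<in>{1..}. \<mu> * gap_prod x \<mu> j / (x j - x i - \<mu>))"
    using ne i by (intro dominated_partial_sums_tendsto[where M = "\<lambda>j. E * kern x i j"] bound
        tendsto_intros partial_gap_prod_tendsto summable_mult summable_kern) auto
  moreover have "eventually (\<lambda>N. (\<Sum>j\<in>{1..N}. \<mu> * partial_gap_prod x \<mu> N j / (x j - x i - \<mu>)) = -1) sequentially"
    using eventually_ge_at_top[of i]
    by eventually_elim (use partial_gap_prod_sum[OF inj] ne i in auto)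
  ultimately show ?thesis
    by (blast intro: LIMSEQ_unique tendsto_eventually)
qed

text \<open>Limit of the finite orthogonality relation: one denominator is dominated by the summable
  kernel, the other simply by 1 / \<delta>.\<close>

lemma gap_prod_orthogonality:
  assumes i: "i \<ge> 1" and n: "n \<ge> 1"
  shows "(\<lambda>j. gap_prod x \<mu> j / ((x j - x i - \<mu>) * (x j - x n - \<mu>))) summable_on {1..}"
    and "\<mu>\<^sup>2 * gap_prod x (-\<mu>) i * (\<Sum>\<^sub>\<infinity>j\<in>{1..}. gap_prod x \<mu> j /
      ((x j - x i - \<mu>) * (x j - x n - \<mu>))) = (if i = n then 1 else 0)"
proof -
  define E where "E = exp (growth * cmod \<mu> powr (1 / \<alpha>)) * res_const * (1 / \<delta>)"
  define f where "f N j = partial_gap_prod x \<mu> N j / ((x j - x i - \<mu>) * (x j - x n - \<mu>))" for N j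
  define g where "g j = gap_prod x \<mu> j / ((x j - x i - \<mu>) * (x j - x n - \<mu>))" for j
  have bound: "cmod (f N j) \<le> E * kern x i j" if "j \<in> {1..N}" for N j
  proof -
    have "cmod (f N j) = cmod (partial_gap_prod x \<mu> N j) * (1 / cmod (x j - x i - \<mu>)) * (1 / cmod (x j - x n - \<mu>))"
      by (simp add: f_def norm_mult norm_divide)
    also have "\<dots> \<le> exp (growth * cmod \<mu> powr (1 / \<alpha>)) * (res_const * kern x j i) * (1 / \<delta>)"
      using that i n separated[of j n] delta_pos res_const_ge_1
      by (intro mult_mono partial_gap_prod_le resolvent_bound divide_left_mono)
         (auto intro!: mult_nonneg_nonneg mult_pos_pos simp: kern_bounds)
    finally show ?thesis by (simp add: E_def kern_commute mult_ac)
  qed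
  have flim: "(\<lambda>N. f N j) \<longlonglongrightarrow> g j" if "j \<ge> 1" for j
    unfolding f_def g_def using ne that i n
    by (intro tendsto_intros partial_gap_prod_tendsto) auto
  note T = dominated_partial_sums_tendsto[of f g, OF flim bound summable_mult[OF summable_kern[OF i]]]
  show "g summable_on {1..}" using T(1) by (rule abs_summable_summable)
  have "(\<lambda>N. \<mu>\<^sup>2 * partial_gap_prod x (-\<mu>) N i * (\<Sum>j\<in>{1..N}. f N j))
      \<longlonglongrightarrow> \<mu>\<^sup>2 * gap_prod x (-\<mu>) i * infsum g {1..}"
    by (intro tendsto_intros partial_gap_prod_tendsto i T(2))
  moreover have "eventually (\<lambda>N. \<mu>\<^sup>2 * partial_gap_prod x (-\<mu>) N i * (\<Sum>j\<in>{1..N}. f N j)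
      = (if i = n then 1 else 0)) sequentially"
    using eventually_ge_at_top[of "max i n"]
  proof eventually_elim
    case (elim N)
    have "partial_gap_prod x (-\<mu>) N i * (\<Sum>j\<in>{1..N}. \<mu>\<^sup>2 * partial_gap_prod x \<mu> N j /
      ((x j - x i - \<mu>) * (x j - x n - \<mu>))) = (if i = n then 1 else 0)"
      using elim i n by (intro partial_gap_prod_orthogonality inj mu_nonzero ne) auto
    then show ?case by (simp add: f_def sum_distrib_left mult_ac)
  qed
  ultimately show "\<mu>\<^sup>2 * gap_prod x (-\<mu>) i * infsum g {1..} = (if i = n then 1 else 0)"
    by (blast intro: LIMSEQ_unique tendsto_eventually)
qed

text \<open>The diagonal orthogonality relation has the value 1, so none of its factors
  vanishes.\<close>

lemma gap_prod_nonzero: "i \<ge> 1 \<Longrightarrow> gap_prod x (-\<mu>) i \<noteq> 0"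
  using gap_prod_orthogonality(2)[of i i] by auto

end

section \<open>Matrices on weighted sequence spaces\<close>

text \<open>In every row Cauchy-Schwarz is applied to k y = sqrt (k u) times sqrt (k / u) y. The row
  bound controls the first factor, and the column bound absorbs v once the sums are
  exchanged.\<close>

lemma schur_test:
  fixes k :: "'a \<Rightarrow> 'b \<Rightarrow> real"
  assumes k: "\<And>p n. p \<in> G \<Longrightarrow> n \<in> F \<Longrightarrow> k p n \<ge> 0"
    and u: "\<And>n. n \<in> F \<Longrightarrow> u n > 0" and S: "S \<ge> 0"
    and row: "\<And>p. p \<in> G \<Longrightarrow> (\<Sum>n\<in>F. k p n * u n) \<le> S * v p"
    and col: "\<And>n. n \<in> F \<Longrightarrow> (\<Sum>p\<in>G. k p n * v p) \<le> S * u n"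
  shows "(\<Sum>p\<in>G. (\<Sum>n\<in>F. k p n * y n)\<^sup>2) \<le> S\<^sup>2 * (\<Sum>n\<in>F. (y n)\<^sup>2)"
proof -
  have "(\<Sum>n\<in>F. k p n * y n)\<^sup>2 \<le> (S * v p) * (\<Sum>n\<in>F. k p n * (y n)\<^sup>2 / u n)" if p: "p \<in> G" for p
  proof -
    have "(\<Sum>n\<in>F. k p n * y n) = (\<Sum>n\<in>F. sqrt (k p n * u n) * (sqrt (k p n / u n) * y n))"
    proof (intro sum.cong refl)
      fix n assume n: "n \<in> F"
      have "sqrt (k p n * u n) * sqrt (k p n / u n) = k p n"
        using k[OF p n] u[OF n] by (simp flip: real_sqrt_mult add: power2_eq_square[symmetric])
      then show "k p n * y n = sqrt (k p n * u n) * (sqrt (k p n / u n) * y n)"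
        by (simp flip: mult.assoc)
    qed
    also have "(\<dots>)\<^sup>2 \<le> (\<Sum>n\<in>F. (sqrt (k p n * u n))\<^sup>2) * (\<Sum>n\<in>F. (sqrt (k p n / u n) * y n)\<^sup>2)"
      by (rule Cauchy_Schwarz_ineq_sum)
    also have "(\<Sum>n\<in>F. (sqrt (k p n * u n))\<^sup>2) = (\<Sum>n\<in>F. k p n * u n)"
      using k[OF p] u by (intro sum.cong refl) (simp add: less_imp_le)
    also have "(\<Sum>n\<in>F. (sqrt (k p n / u n) * y n)\<^sup>2) = (\<Sum>n\<in>F. k p n * (y n)\<^sup>2 / u n)"
      using k[OF p] u by (intro sum.cong refl) (simp add: less_imp_le power_mult_distrib)
    also have "(\<Sum>n\<in>F. k p n * u n) * (\<Sum>n\<in>F. k p n * (y n)\<^sup>2 / u n)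
        \<le> (S * v p) * (\<Sum>n\<in>F. k p n * (y n)\<^sup>2 / u n)"
      using k[OF p] u by (intro mult_right_mono row p sum_nonneg) (auto simp: less_imp_le)
    finally show ?thesis .
  qed
  then have "(\<Sum>p\<in>G. (\<Sum>n\<in>F. k p n * y n)\<^sup>2) \<le> (\<Sum>p\<in>G. (S * v p) * (\<Sum>n\<in>F. k p n * (y n)\<^sup>2 / u n))"
    by (rule sum_mono)
  also have "\<dots> = (\<Sum>p\<in>G. \<Sum>n\<in>F. S * ((y n)\<^sup>2 / u n) * (k p n * v p))"
    by (simp add: sum_distrib_left mult_ac)
  also have "\<dots> = (\<Sum>n\<in>F. S * ((y n)\<^sup>2 / u n) * (\<Sum>p\<in>G. k p n * v p))"
    by (subst sum.swap) (simp add: sum_distrib_left)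
  also have "\<dots> \<le> (\<Sum>n\<in>F. S * ((y n)\<^sup>2 / u n) * (S * u n))"
    using S u by (intro sum_mono mult_left_mono col) (auto simp: less_imp_le)
  also have "\<dots> = S\<^sup>2 * (\<Sum>n\<in>F. (y n)\<^sup>2)"
    unfolding sum_distrib_left
  proof (intro sum.cong refl)
    fix n assume "n \<in> F"
    then have "u n \<noteq> 0" using u[of n] by simp
    then show "S * ((y n)\<^sup>2 / u n) * (S * u n) = S\<^sup>2 * (y n)\<^sup>2" by (simp add: power2_eq_square)
  qed
  finally show ?thesis .
qed

text \<open>The value 0 at index 0 meets the normalisation of
  \<open>power_completion\<close>.\<close>

definition mat_act :: "(nat \<Rightarrow> nat \<Rightarrow> complex) \<Rightarrow> (nat \<Rightarrow> complex) \<Rightarrow> nat \<Rightarrow> complex" where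
  "mat_act M a p = (if p \<ge> 1 then \<Sum>\<^sub>\<infinity>n\<in>{1..}. M p n * a n else 0)"

definition truncate :: "nat set \<Rightarrow> (nat \<Rightarrow> complex) \<Rightarrow> nat \<Rightarrow> complex" where
  "truncate F a n = (if n \<in> F then a n else 0)"

lemma has_sum_finite_sum:
  fixes f :: "'i \<Rightarrow> 'a \<Rightarrow> 'b::{topological_comm_monoid_add}"
  assumes "\<And>i. i \<in> I \<Longrightarrow> (f i has_sum S i) A"
  shows "((\<lambda>x. \<Sum>i\<in>I. f i x) has_sum (\<Sum>i\<in>I. S i)) A"
  using assms by (induction I rule: infinite_finite_induct) (auto intro!: has_sum_add)

lemma mat_act_truncate:
  assumes "finite F" "F \<subseteq> {1..}"
  shows "mat_act M (truncate F a) p = (if p \<ge> 1 then \<Sum>n\<in>F. M p n * a n else 0)"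
proof -
  have "(\<Sum>\<^sub>\<infinity>n\<in>{1..}. M p n * truncate F a n) = (\<Sum>\<^sub>\<infinity>n\<in>F. M p n * a n)"
    using assms by (intro infsum_cong_neutral) (auto simp: truncate_def)
  then show ?thesis using assms by (simp add: mat_act_def)
qed

text \<open>On finitely supported sequences only a finite sum has to pass through the infinite sum
  over p, so the relation between the entries suffices. Boundedness extends it later.\<close>

lemma mat_act_truncate_inverse:
  assumes F: "finite F" "F \<subseteq> {1..}"
    and inv: "\<And>i n. i \<ge> 1 \<Longrightarrow> n \<ge> 1 \<Longrightarrow>
      ((\<lambda>p. R i p * M p n) has_sum (if i = n then 1 else 0)) {1..}"
  shows "mat_act R (mat_act M (truncate F a)) = truncate F a"
proof
  fix i
  show "mat_act R (mat_act M (truncate F a)) i = truncate F a i"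
  proof (cases "i \<ge> 1")
    case True
    have "((\<lambda>p. \<Sum>n\<in>F. R i p * M p n * a n) has_sum (\<Sum>n\<in>F. (if i = n then 1 else 0) * a n)) {1..}"
      using F True by (intro has_sum_finite_sum has_sum_cmult_left inv) auto
    moreover have "(\<Sum>n\<in>F. (if i = n then 1 else 0) * a n) = (\<Sum>n\<in>F. if i = n then a n else 0)"
      by (intro sum.cong) auto
    moreover have "\<dots> = truncate F a i" using F by (simp add: truncate_def)
    ultimately have "((\<lambda>p. \<Sum>n\<in>F. R i p * M p n * a n) has_sum truncate F a i) {1..}" by simp
    moreover have "R i p * mat_act M (truncate F a) p = (\<Sum>n\<in>F. R i p * M p n * a n)" if "p \<in> {1..}" for p
      using that F by (simp add: mat_act_truncate sum_distrib_left mult.assoc)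
    ultimately have "((\<lambda>p. R i p * mat_act M (truncate F a) p) has_sum truncate F a i) {1..}"
      by (rule has_sum_cong[THEN iffD2, rotated])
    then show ?thesis using True by (simp add: mat_act_def[of R] infsumI)
  next
    case False
    then show ?thesis using F by (auto simp: mat_act_def truncate_def)
  qed
qed

text \<open>The squared norm of the remainder is the tail of a convergent series.\<close>

lemma weighted_norm_truncate_tendsto:
  assumes a: "weighted_summable ev s a"
  shows "((\<lambda>F. weighted_norm ev s (a - truncate F a)) \<longlongrightarrow> 0) (finite_subsets_at_top {1..})"
proof -
  define t where "t n = cmod (ev n) powr (2 * s) * (cmod (a n))\<^sup>2" for n
  have t: "t summable_on {1..}" using a by (simp add: weighted_summable_def t_def[abs_def])
  have eq: "weighted_norm ev s (a - truncate F a) = sqrt (infsum t {1..} - sum t F)"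
    if F: "finite F" "F \<subseteq> {1..}" for F
  proof -
    have "(\<Sum>\<^sub>\<infinity>n\<in>{1..}. cmod (ev n) powr (2 * s) * (cmod ((a - truncate F a) n))\<^sup>2) = infsum t ({1..} - F)"
      by (rule infsum_cong_neutral) (auto simp: truncate_def t_def)
    also have "\<dots> = infsum t {1..} - sum t F"
      using infsum_Diff[OF t summable_on_finite[OF F(1)] F(2)] F(1) by simp
    finally show ?thesis by (simp add: weighted_norm_def)
  qed
  have "((\<lambda>F. sqrt (infsum t {1..} - sum t F)) \<longlongrightarrow> sqrt (infsum t {1..} - infsum t {1..})) (finite_subsets_at_top {1..})"
    using infsum_tendsto[OF t] by (intro tendsto_intros)
  then show ?thesis
    unfolding diff_self real_sqrt_zero
    by (rule Lim_transform_eventually) (intro eventually_finite_subsets_at_top_weakI, simp add: eq)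
qed

section \<open>Eigenvalue growth and weighted kernel estimates\<close>

context standing_assumptions
begin

text \<open>The eigenvalues lie on one ray from 0, with t n = -Re (ev n) or t n = Im (ev n). From
  here on both cases are treated alike, through an increasing real sequence.\<close>

lemma ev_profile:
  obtains t :: "nat \<Rightarrow> real" where "0 < t 1" "\<And>n. n \<ge> 1 \<Longrightarrow> t n < t (Suc n)"
    "\<And>n. n \<ge> 1 \<Longrightarrow> cmod (ev n) = \<bar>t n\<bar>"
    "\<And>m n. m \<ge> 1 \<Longrightarrow> n \<ge> 1 \<Longrightarrow> cmod (ev m - ev n) = \<bar>t m - t n\<bar>"
  using adjointness
proof
  assume "self_adjoint D A"
  from self_adjoint_order[OF this]
  have h: "\<And>n. n \<ge> 1 \<Longrightarrow> Im (ev n) = 0" "0 < - Re (ev 1)" "\<And>n. n \<ge> 1 \<Longrightarrow> - Re (ev n) < - Re (ev (Suc n))"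
    by (auto simp: complex_is_Real_iff)
  show ?thesis
    by (rule that[of "\<lambda>n. - Re (ev n)"])
       (use h in \<open>auto simp: cmod_def abs_minus_commute\<close>)
next
  assume "skew_adjoint D A"
  from skew_adjoint_order[OF this]
  have h: "\<And>n. n \<ge> 1 \<Longrightarrow> Re (ev n) = 0" "0 < Im (ev 1)" "\<And>n. n \<ge> 1 \<Longrightarrow> Im (ev n) < Im (ev (Suc n))"
    by (auto simp: complex_is_Real_iff)
  show ?thesis
    by (rule that[of "\<lambda>n. Im (ev n)"])
       (use h in \<open>auto simp: cmod_def abs_minus_commute\<close>)
qed

text \<open>From below, the pairwise gap between n and 1 is used, with n - 1 \<ge> n / 2 for n \<ge>
  2; from above, the consecutive gaps are summed.\<close>

lemma ev_growth: "\<exists>c>0. \<exists>C>0. \<forall>n\<ge>1. c * real n powr \<alpha> \<le> cmod (ev n) \<and> cmod (ev n) \<le> C * real n powr \<alpha>"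
proof -
  obtain t where t: "0 < t 1" "\<And>n. n \<ge> 1 \<Longrightarrow> t n < t (Suc n)"
    "\<And>n. n \<ge> 1 \<Longrightarrow> cmod (ev n) = \<bar>t n\<bar>"
    "\<And>m n. m \<ge> 1 \<Longrightarrow> n \<ge> 1 \<Longrightarrow> cmod (ev m - ev n) = \<bar>t m - t n\<bar>" using ev_profile by blast
  obtain c where c: "c > 0" "\<And>k n. k \<ge> 1 \<Longrightarrow> n \<ge> 1 \<Longrightarrow>
      c * real k powr (\<alpha> - 1) * \<bar>real k - real n\<bar> \<le> cmod (ev k - ev n)" using pairwise_gap by blast
  obtain C where C: "C > 0" "\<And>n. n \<ge> 1 \<Longrightarrow> cmod (ev (n + 1) - ev n) \<le> C * real n powr (\<alpha> - 1)"
    using consecutive_gap by blast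
  have t1: "t 1 \<le> t n" if "n \<ge> 1" for n
    using that by (induction n rule: dec_induct) (use t(2) in force)+
  have ev: "cmod (ev n) = t n" if "n \<ge> 1" for n using t(1,3) t1[OF that] that by simp
  have lower: "min (t 1) (c / 2) * real n powr \<alpha> \<le> t n" if n: "n \<ge> 1" for n
  proof (cases "n = 1")
    case False
    have "c / 2 * real n powr \<alpha> \<le> c * real n powr (\<alpha> - 1) * \<bar>real n - real 1\<bar>"
      using False n c by (simp add: powr_diff field_simps)
    also have "\<dots> \<le> t n - t 1" using c(2)[OF n, of 1] t(4)[OF n, of 1] t1[OF n] by simp
    also have "\<dots> \<le> t n" using t(1) by simp
    finally have "c / 2 * real n powr \<alpha> \<le> t n" .
    moreover have "min (t 1) (c / 2) * real n powr \<alpha> \<le> c / 2 * real n powr \<alpha>"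
      by (intro mult_right_mono) auto
    ultimately show ?thesis by linarith
  qed auto
  have upper: "t n \<le> t 1 + C * real n powr \<alpha>" if "n \<ge> 1" for n
    using that
  proof (induction n rule: dec_induct)
    case (step n)
    have "t (Suc n) \<le> t n + C * real n powr (\<alpha> - 1)"
      using C(2)[OF step.hyps(1)] t(4)[of "Suc n" n] step.hyps(1) by simp
    also have "\<dots> \<le> t 1 + C * (real n powr \<alpha> + real n powr (\<alpha> - 1))"
      using step.IH by (simp add: algebra_simps)
    \<comment> \<open>The inequality n^(\<alpha>-1) (n + 1) \<le> (n + 1)^\<alpha> closes the
      induction without an integral.\<close>
    also have "real n powr \<alpha> + real n powr (\<alpha> - 1) = real n powr (\<alpha> - 1) * real (Suc n)"
      using step.hyps(1) by (simp add: powr_diff field_simps)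
    also have "\<dots> \<le> real (Suc n) powr (\<alpha> - 1) * real (Suc n)"
      using alpha_gt_1 by (intro mult_right_mono powr_mono2) auto
    also have "\<dots> = real (Suc n) powr \<alpha>" by (simp add: powr_diff)
    finally show ?case using C(1) by simp
  qed (use C in auto)
  have "t n \<le> (t 1 + C) * real n powr \<alpha>" if n: "n \<ge> 1" for n
  proof -
    have "t 1 * 1 \<le> t 1 * real n powr \<alpha>"
      using t(1) n alpha_gt_1 by (intro mult_left_mono ge_one_powr_ge_zero) auto
    then show ?thesis using upper[OF n] by (simp add: algebra_simps)
  qed
  then show ?thesis using lower ev t(1) c(1) C(1)
    by (intro exI[of _ "min (t 1) (c / 2)"] exI[of _ "t 1 + C"] conjI) auto
qed

text \<open>Replaces eigenvalue weights by powers of the index. For negative s the quotient is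
  inverted, so both signs use the same comparison of moduli.\<close>

lemma weight_ratio:
  "\<exists>R>0. \<forall>p\<ge>1. \<forall>n\<ge>1. cmod (ev p) powr s / cmod (ev n) powr s \<le> R * (real p / real n) powr (\<alpha> * s)"
proof -
  obtain c C where cC: "c > 0" "C > 0"
    "\<And>n. n \<ge> 1 \<Longrightarrow> c * real n powr \<alpha> \<le> cmod (ev n)" "\<And>n. n \<ge> 1 \<Longrightarrow> cmod (ev n) \<le> C * real n powr \<alpha>"
    using ev_growth by blast
  have quot: "cmod (ev p) / cmod (ev n) \<le> C / c * (real p / real n) powr \<alpha>" if "p \<ge> 1" "n \<ge> 1" for p n
  proof -
    have "cmod (ev p) / cmod (ev n) \<le> (C * real p powr \<alpha>) / (c * real n powr \<alpha>)"
      using that cC by (intro frac_le) auto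
    then show ?thesis using that by (simp add: powr_divide)
  qed
  have "cmod (ev p) powr s / cmod (ev n) powr s \<le> (C / c) powr \<bar>s\<bar> * (real p / real n) powr (\<alpha> * s)"
    if pn: "p \<ge> 1" "n \<ge> 1" for p n
  proof (cases "s \<ge> 0")
    case True
    have "cmod (ev p) powr s / cmod (ev n) powr s = (cmod (ev p) / cmod (ev n)) powr s"
      by (simp add: powr_divide)
    also have "\<dots> \<le> (C / c * (real p / real n) powr \<alpha>) powr s"
      using True by (intro powr_mono2 quot pn) auto
    also have "\<dots> = (C / c) powr \<bar>s\<bar> * (real p / real n) powr (\<alpha> * s)"
      unfolding powr_mult powr_powr using True by simp
    finally show ?thesis .
  next
    case False
    have "cmod (ev p) powr s / cmod (ev n) powr s = (cmod (ev n) / cmod (ev p)) powr \<bar>s\<bar>"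
      using False ev_nonzero pn by (simp add: powr_divide powr_minus field_simps)
    also have "\<dots> \<le> (C / c * (real n / real p) powr \<alpha>) powr \<bar>s\<bar>"
      by (intro powr_mono2 quot pn) auto
    also have "\<dots> = (C / c) powr \<bar>s\<bar> * (real n / real p) powr (\<alpha> * \<bar>s\<bar>)"
      unfolding powr_mult powr_powr by simp
    also have "(real n / real p) powr (\<alpha> * \<bar>s\<bar>) = (real p / real n) powr (\<alpha> * s)"
      using False pn by (simp add: powr_divide powr_minus field_simps)
    finally show ?thesis .
  qed
  then show ?thesis using cC by (intro exI[of _ "(C / c) powr \<bar>s\<bar>"]) auto
qed

lemma gap_sequence_ev: "\<exists>c. gap_sequence ev \<alpha> c"
  using pairwise_gap alpha_gt_1 by (auto simp: gap_sequence_def)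

lemma weighted_row_bound:
  assumes s: "1 / (2 * \<alpha>) - 1 < s" "s < 1 - 1 / (2 * \<alpha>)"
  shows "\<exists>S>0. \<forall>p\<ge>1. \<forall>F. finite F \<and> F \<subseteq> {1..} \<longrightarrow>
    (\<Sum>n\<in>F. cmod (ev p) powr s / cmod (ev n) powr s * kern ev p n * real n powr - (1/2))
      \<le> S * real p powr - (1/2)"
proof -
  obtain c where "gap_sequence ev \<alpha> c" using gap_sequence_ev by blast
  then interpret gap_sequence ev \<alpha> c .
  \<comment> \<open>The 1/2 comes from the Schur weights n^(-1/2). The lower end of the interval for
    s amounts exactly to \<tau> > 1 - \<alpha>.\<close>
  define \<tau> where "\<tau> = \<alpha> * s + 1/2"
  have \<tau>: "1 - \<alpha> < \<tau>" "\<tau> \<le> \<alpha>" using s alpha_gt_1 by (auto simp: \<tau>_def field_simps)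
  obtain S where S: "S > 0" "\<And>p F. p \<ge> 1 \<Longrightarrow> finite F \<Longrightarrow> F \<subseteq> {1..} \<Longrightarrow>
    (\<Sum>n\<in>F. (real p / real n) powr \<tau> * kern ev p n) \<le> S" using schur_row[OF \<tau>] by blast
  obtain R where R: "R > 0" "\<And>p n. p \<ge> 1 \<Longrightarrow> n \<ge> 1 \<Longrightarrow>
     cmod (ev p) powr s / cmod (ev n) powr s \<le> R * (real p / real n) powr (\<alpha> * s)"
    using weight_ratio by blast
  have "(\<Sum>n\<in>F. cmod (ev p) powr s / cmod (ev n) powr s * kern ev p n * real n powr - (1/2))
      \<le> R * S * real p powr - (1/2)" if p: "p \<ge> 1" and F: "finite F" "F \<subseteq> {1..}" for p F
  proof -
    have "(\<Sum>n\<in>F. cmod (ev p) powr s / cmod (ev n) powr s * kern ev p n * real n powr - (1/2))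
       \<le> (\<Sum>n\<in>F. R * real p powr - (1/2) * ((real p / real n) powr \<tau> * kern ev p n))"
    proof (intro sum_mono)
      fix n assume "n \<in> F"
      then have n: "n \<ge> 1" using F by auto
      have "cmod (ev p) powr s / cmod (ev n) powr s * kern ev p n * real n powr - (1/2)
        \<le> R * (real p / real n) powr (\<alpha> * s) * kern ev p n * real n powr - (1/2)"
        using R p n by (intro mult_right_mono) (auto simp: kern_bounds)
      also have "(real p / real n) powr (\<alpha> * s) = (real p / real n) powr \<tau> * real p powr - (1/2) / real n powr - (1/2)"
      proof -
        define q where "q = real p / real n"
        have "q powr (1/2) * (real p powr - (1/2) / real n powr - (1/2)) = 1"
          using p n by (simp add: q_def powr_divide powr_minus)
        moreover have "q powr \<tau> * real p powr - (1/2) / real n powr - (1/2)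
            = q powr (\<alpha> * s) * (q powr (1/2) * (real p powr - (1/2) / real n powr - (1/2)))"
          unfolding \<tau>_def powr_add by (simp only: mult.assoc times_divide_eq_right)
        ultimately show ?thesis by (simp add: q_def)
      qed
      finally show "cmod (ev p) powr s / cmod (ev n) powr s * kern ev p n * real n powr - (1/2)
        \<le> R * real p powr - (1/2) * ((real p / real n) powr \<tau> * kern ev p n)"
        using n by (simp add: mult_ac)
    qed
    also have "\<dots> \<le> R * real p powr - (1/2) * S"
      unfolding sum_distrib_left[symmetric] using R by (intro mult_left_mono S p F) auto
    finally show ?thesis by (simp add: mult_ac)
  qed
  then show ?thesis using R S by (intro exI[of _ "R * S"]) auto
qed

text \<open>The kernel is symmetric, so the column sums for s are the row sums for -s, and the
  interval for s is symmetric about 0.\<close>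

lemma weighted_kern_bound:
  assumes s: "1 / (2 * \<alpha>) - 1 < s" "s < 1 - 1 / (2 * \<alpha>)"
  shows "\<exists>S>0. \<forall>a F G. finite F \<and> F \<subseteq> {1..} \<and> finite G \<and> G \<subseteq> {1..} \<longrightarrow>
    (\<Sum>p\<in>G. cmod (ev p) powr (2 * s) * (\<Sum>n\<in>F. kern ev p n * cmod (a n))\<^sup>2)
      \<le> S\<^sup>2 * (\<Sum>n\<in>F. cmod (ev n) powr (2 * s) * (cmod (a n))\<^sup>2)"
proof -
  define k where "k p n = cmod (ev p) powr s / cmod (ev n) powr s * kern ev p n" for p n
  obtain S1 where S1: "S1 > 0" "\<And>p F. p \<ge> 1 \<Longrightarrow> finite F \<Longrightarrow> F \<subseteq> {1..} \<Longrightarrow>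
    (\<Sum>n\<in>F. k p n * real n powr - (1/2)) \<le> S1 * real p powr - (1/2)"
    using weighted_row_bound[OF s] unfolding k_def by blast
  obtain S2 where S2: "S2 > 0" "\<And>p F. p \<ge> 1 \<Longrightarrow> finite F \<Longrightarrow> F \<subseteq> {1..} \<Longrightarrow>
    (\<Sum>n\<in>F. cmod (ev p) powr (-s) / cmod (ev n) powr (-s) * kern ev p n * real n powr - (1/2))
      \<le> S2 * real p powr - (1/2)"
    using weighted_row_bound[of "-s"] s by force
  have k2: "cmod (ev p) powr (-s) / cmod (ev n) powr (-s) * kern ev p n = k n p" for p n
    by (simp add: k_def powr_minus kern_commute divide_inverse mult_ac)
  define S where "S = max S1 S2"
  have "(\<Sum>p\<in>G. cmod (ev p) powr (2 * s) * (\<Sum>n\<in>F. kern ev p n * cmod (a n))\<^sup>2)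
      \<le> S\<^sup>2 * (\<Sum>n\<in>F. cmod (ev n) powr (2 * s) * (cmod (a n))\<^sup>2)"
    if FG: "finite F" "F \<subseteq> {1..}" "finite G" "G \<subseteq> {1..}" for a F G
  proof -
    define y where "y n = cmod (ev n) powr s * cmod (a n)" for n
    have sq: "cmod (ev n) powr (2 * s) = (cmod (ev n) powr s)\<^sup>2" for n
      by (simp add: power2_eq_square flip: powr_add)
    have "(\<Sum>p\<in>G. (\<Sum>n\<in>F. k p n * y n)\<^sup>2) \<le> S\<^sup>2 * (\<Sum>n\<in>F. (y n)\<^sup>2)"
    proof (rule schur_test[where u = "\<lambda>n. real n powr - (1/2)" and v = "\<lambda>n. real n powr - (1/2)"])
      fix p assume "p \<in> G"
      then have p: "p \<ge> 1" using FG by auto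
      have "(\<Sum>n\<in>F. k p n * real n powr - (1/2)) \<le> S1 * real p powr - (1/2)"
        by (intro S1 p FG)
      also have "\<dots> \<le> S * real p powr - (1/2)" by (intro mult_right_mono) (auto simp: S_def)
      finally show "(\<Sum>n\<in>F. k p n * real n powr - (1/2)) \<le> S * real p powr - (1/2)" .
    next
      fix n assume "n \<in> F"
      then have n: "n \<ge> 1" using FG by auto
      have "(\<Sum>p\<in>G. k p n * real p powr - (1/2)) \<le> S2 * real n powr - (1/2)"
        using S2(2)[OF n FG(3,4)] by (simp only: k2)
      also have "\<dots> \<le> S * real n powr - (1/2)" by (intro mult_right_mono) (auto simp: S_def)
      finally show "(\<Sum>p\<in>G. k p n * real p powr - (1/2)) \<le> S * real n powr - (1/2)" .
    qed (use FG S1(1) in \<open>auto simp: k_def kern_bounds S_def\<close>)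
    moreover have "(\<Sum>n\<in>F. k p n * y n) = cmod (ev p) powr s * (\<Sum>n\<in>F. kern ev p n * cmod (a n))" for p
      unfolding sum_distrib_left
    proof (intro sum.cong refl)
      fix n assume "n \<in> F"
      then have "ev n \<noteq> 0" using FG ev_nonzero by auto
      then show "k p n * y n = cmod (ev p) powr s * (kern ev p n * cmod (a n))"
        by (simp add: k_def y_def)
    qed
    ultimately show ?thesis by (simp add: sq y_def power_mult_distrib)
  qed
  then show ?thesis using S1(1) by (intro exI[of _ S]) (auto simp: S_def)
qed

lemma weighted_summable_truncate:
  assumes "weighted_summable ev s a"
  shows "weighted_summable ev s (truncate F a)"
  unfolding weighted_summable_def
  by (rule summable_on_comparison_test[OF assms[unfolded weighted_summable_def]])
     (auto simp: truncate_def)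

lemma coordinate_le_weighted_norm:
  assumes "weighted_summable ev s a" "i \<ge> 1"
  shows "cmod (ev i) powr s * cmod (a i) \<le> weighted_norm ev s a"
proof -
  have "(cmod (ev i) powr s * cmod (a i))\<^sup>2 \<le> (weighted_norm ev s a)\<^sup>2"
    using finite_sum_le_weighted_norm[OF assms(1), of "{i}"] assms(2)
    by (simp add: power_mult_distrib power2_eq_square[of "_ powr _"] flip: powr_add)
  then show ?thesis using weighted_norm_nonneg by (rule power2_le_imp_le)
qed

text \<open>Independent of \<mu>; the only way in which s enters the final constants.\<close>

definition kern_const :: "real \<Rightarrow> real" where
  "kern_const s = (SOME S. S > 0 \<and> (\<forall>a F G. finite F \<and> F \<subseteq> {1..} \<and> finite G \<and> G \<subseteq> {1..} \<longrightarrow>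
    (\<Sum>p\<in>G. cmod (ev p) powr (2 * s) * (\<Sum>n\<in>F. kern ev p n * cmod (a n))\<^sup>2)
      \<le> S\<^sup>2 * (\<Sum>n\<in>F. cmod (ev n) powr (2 * s) * (cmod (a n))\<^sup>2)))"

text \<open>\<open>L\<close> will gather everything that depends on \<mu> and \<delta>.\<close>

definition kern_dominated :: "real \<Rightarrow> (nat \<Rightarrow> nat \<Rightarrow> complex) \<Rightarrow> bool" where
  "kern_dominated L M \<longleftrightarrow> L \<ge> 0 \<and> (\<forall>p\<ge>1. \<forall>n\<ge>1. cmod (M p n) \<le> L * kern ev p n)"

section \<open>Kernel-dominated matrices on the weighted spaces\<close>

context
  fixes s :: real
  assumes s: "1 / (2 * \<alpha>) - 1 < s" "s < 1 - 1 / (2 * \<alpha>)"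
begin

lemma kern_const_pos: "kern_const s > 0"
  and kern_const: "finite F \<Longrightarrow> F \<subseteq> {1..} \<Longrightarrow> finite G \<Longrightarrow> G \<subseteq> {1..} \<Longrightarrow>
    (\<Sum>p\<in>G. cmod (ev p) powr (2 * s) * (\<Sum>n\<in>F. kern ev p n * cmod (a n))\<^sup>2)
      \<le> (kern_const s)\<^sup>2 * (\<Sum>n\<in>F. cmod (ev n) powr (2 * s) * (cmod (a n))\<^sup>2)"
  using someI_ex[OF weighted_kern_bound[OF s]] unfolding kern_const_def by blast+

text \<open>The kernel estimate with \<open>G\<close> = {p} controls a single row, because the
  weight at p is positive.\<close>

lemma mat_act_row_summable:
  assumes M: "kern_dominated L M" and a: "weighted_summable ev s a" and p: "p \<ge> 1"
  shows "(\<lambda>n. M p n * a n) summable_on {1..}"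
proof -
  define K where "K = kern_const s * weighted_norm ev s a"
  define w where "w = cmod (ev p) powr (2 * s)"
  have w: "w > 0" using ev_nonzero[OF p] by (simp add: w_def)
  have "(\<Sum>n\<in>F. kern ev p n * cmod (a n)) \<le> sqrt (K\<^sup>2 / w)" if F: "finite F" "F \<subseteq> {1..}" for F
  proof -
    have "w * (\<Sum>n\<in>F. kern ev p n * cmod (a n))\<^sup>2
        \<le> (kern_const s)\<^sup>2 * (\<Sum>n\<in>F. cmod (ev n) powr (2 * s) * (cmod (a n))\<^sup>2)"
      using kern_const[OF F, of "{p}" a] p by (simp add: w_def)
    also have "\<dots> \<le> K\<^sup>2" unfolding K_def power_mult_distrib
      by (intro mult_left_mono finite_sum_le_weighted_norm a F) auto
    finally show ?thesis using w by (intro real_le_rsqrt) (simp add: field_simps)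
  qed
  then have "(\<lambda>n. kern ev p n * cmod (a n)) summable_on {1..}"
    by (intro nonneg_bdd_above_summable_on bdd_aboveI2[where M = "sqrt (K\<^sup>2 / w)"])
       (auto simp: kern_bounds)
  then have "(\<lambda>n. L * (kern ev p n * cmod (a n))) summable_on {1..}" by (rule summable_on_cmult_right)
  then have "(\<lambda>n. norm (M p n * a n)) summable_on {1..}"
  proof (rule summable_on_comparison_test)
    fix n :: nat assume "n \<in> {1..}"
    then have "cmod (M p n) * cmod (a n) \<le> L * kern ev p n * cmod (a n)"
      using M p by (intro mult_right_mono) (auto simp: kern_dominated_def)
    then show "norm (M p n * a n) \<le> L * (kern ev p n * cmod (a n))"
      by (simp add: norm_mult mult.assoc)
  qed auto
  then show ?thesis by (rule abs_summable_summable)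
qed

text \<open>The estimate is known for finite sections. The columns are exhausted first, for a fixed
  finite set \<open>G\<close> of rows; then \<open>G\<close> is arbitrary.\<close>

lemma mat_act_bounded:
  assumes M: "kern_dominated L M" and a: "weighted_summable ev s a"
  shows "weighted_summable ev s (mat_act M a)"
    "weighted_norm ev s (mat_act M a) \<le> kern_const s * L * weighted_norm ev s a"
proof -
  define K where "K = kern_const s * L * weighted_norm ev s a"
  have L: "L \<ge> 0" using M by (simp add: kern_dominated_def)
  have K: "K \<ge> 0" using kern_const_pos L weighted_norm_nonneg by (simp add: K_def)
  have fin: "(\<Sum>p\<in>G. cmod (ev p) powr (2 * s) * (cmod (mat_act M a p))\<^sup>2) \<le> K\<^sup>2"
    if G: "finite G" "G \<subseteq> {1..}" for G
  proof (rule tendsto_upperbound)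
    show "((\<lambda>F. \<Sum>p\<in>G. cmod (ev p) powr (2 * s) * (cmod (\<Sum>n\<in>F. M p n * a n))\<^sup>2)
      \<longlongrightarrow> (\<Sum>p\<in>G. cmod (ev p) powr (2 * s) * (cmod (mat_act M a p))\<^sup>2)) (finite_subsets_at_top {1..})"
    proof (intro tendsto_intros)
      fix p assume "p \<in> G"
      then have "p \<ge> 1" using G by auto
      then show "((\<lambda>F. \<Sum>n\<in>F. M p n * a n) \<longlongrightarrow> mat_act M a p) (finite_subsets_at_top {1..})"
        using infsum_tendsto[OF mat_act_row_summable[OF M a]] by (simp add: mat_act_def)
    qed
    show "\<forall>\<^sub>F F in finite_subsets_at_top {1..}.
      (\<Sum>p\<in>G. cmod (ev p) powr (2 * s) * (cmod (\<Sum>n\<in>F. M p n * a n))\<^sup>2) \<le> K\<^sup>2"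
    proof (rule eventually_finite_subsets_at_top_weakI)
      fix F :: "nat set" assume F: "finite F" "F \<subseteq> {1..}"
      have "(\<Sum>p\<in>G. cmod (ev p) powr (2 * s) * (cmod (\<Sum>n\<in>F. M p n * a n))\<^sup>2)
         \<le> (\<Sum>p\<in>G. cmod (ev p) powr (2 * s) * (L * (\<Sum>n\<in>F. kern ev p n * cmod (a n)))\<^sup>2)"
      proof (intro sum_mono mult_left_mono power_mono)
        fix p assume "p \<in> G"
        then have p: "p \<ge> 1" using G by auto
        have "cmod (\<Sum>n\<in>F. M p n * a n) \<le> (\<Sum>n\<in>F. cmod (M p n) * cmod (a n))"
          by (intro order_trans[OF norm_sum]) (simp add: norm_mult)
        also have "\<dots> \<le> (\<Sum>n\<in>F. L * kern ev p n * cmod (a n))"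
          using F p M by (intro sum_mono mult_right_mono) (auto simp: kern_dominated_def)
        finally show "cmod (\<Sum>n\<in>F. M p n * a n) \<le> L * (\<Sum>n\<in>F. kern ev p n * cmod (a n))"
          by (simp add: sum_distrib_left mult.assoc)
      qed auto
      also have "\<dots> = L\<^sup>2 * (\<Sum>p\<in>G. cmod (ev p) powr (2 * s) * (\<Sum>n\<in>F. kern ev p n * cmod (a n))\<^sup>2)"
        by (simp add: power_mult_distrib sum_distrib_left[of "L\<^sup>2"] mult.left_commute)
      also have "\<dots> \<le> L\<^sup>2 * ((kern_const s)\<^sup>2 * (\<Sum>n\<in>F. cmod (ev n) powr (2 * s) * (cmod (a n))\<^sup>2))"
        by (intro mult_left_mono kern_const F G) auto
      also have "\<dots> \<le> L\<^sup>2 * ((kern_const s)\<^sup>2 * (weighted_norm ev s a)\<^sup>2)"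
        by (intro mult_left_mono finite_sum_le_weighted_norm a F) auto
      also have "\<dots> = K\<^sup>2" by (simp add: K_def power_mult_distrib)
      finally show "(\<Sum>p\<in>G. cmod (ev p) powr (2 * s) * (cmod (\<Sum>n\<in>F. M p n * a n))\<^sup>2) \<le> K\<^sup>2" .
    qed
  qed auto
  show "weighted_summable ev s (mat_act M a)" by (rule weighted_summableI[OF fin])
  show "weighted_norm ev s (mat_act M a) \<le> kern_const s * L * weighted_norm ev s a"
    unfolding K_def[symmetric] by (rule weighted_norm_leI[OF K fin])
qed

lemma mat_act_add:
  assumes "kern_dominated L M" "weighted_summable ev s a" "weighted_summable ev s b"
  shows "mat_act M (a + b) = mat_act M a + mat_act M b"
  using mat_act_row_summable[OF assms(1,2)] mat_act_row_summable[OF assms(1,3)]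
  by (auto simp: fun_eq_iff mat_act_def algebra_simps infsum_add)

lemma mat_act_diff:
  assumes "kern_dominated L M" "weighted_summable ev s a" "weighted_summable ev s b"
  shows "mat_act M (a - b) = mat_act M a - mat_act M b"
  using mat_act_add[OF assms(1) weighted_summable_diff[OF assms(2,3)] assms(3)]
  by (simp add: algebra_simps)

text \<open>The relation holds on truncations, and both matrices are bounded. Hence the error in
  coordinate i is controlled by the norm of \<open>a - truncate F a\<close>, which tends to
  0.\<close>

lemma mat_act_inverse:
  assumes M: "kern_dominated L M" and R: "kern_dominated L' R"
    and inv: "\<And>i n. i \<ge> 1 \<Longrightarrow> n \<ge> 1 \<Longrightarrow>
      ((\<lambda>p. R i p * M p n) has_sum (if i = n then 1 else 0)) {1..}"
    and a: "a \<in> power_completion ev s"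
  shows "mat_act R (mat_act M a) = a"
proof
  fix i
  have ws: "weighted_summable ev s a" using a by (simp add: power_completion_def)
  define K where "K = kern_const s * L' * (kern_const s * L)"
  show "mat_act R (mat_act M a) i = a i"
  proof (cases "i \<ge> 1")
    case True
    define w where "w = cmod (ev i) powr s"
    have w: "w > 0" using ev_nonzero[OF True] by (simp add: w_def)
    have "w * cmod (mat_act R (mat_act M a) i - a i) \<le> (K + 1) * weighted_norm ev s (a - truncate F a)"
      if F: "finite F" "F \<subseteq> {1..}" for F
    proof -
      define d where "d = a - truncate F a"
      have wt: "weighted_summable ev s (truncate F a)" by (rule weighted_summable_truncate[OF ws])
      have wd: "weighted_summable ev s d" unfolding d_def by (rule weighted_summable_diff[OF ws wt])
      have "mat_act R (mat_act M d) = mat_act R (mat_act M a) - truncate F a"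
        unfolding d_def mat_act_diff[OF M ws wt]
        by (simp add: mat_act_diff[OF R mat_act_bounded(1)[OF M ws] mat_act_bounded(1)[OF M wt]]
            mat_act_truncate_inverse[OF F inv])
      then have "mat_act R (mat_act M a) i - a i = mat_act R (mat_act M d) i - d i"
        by (simp add: d_def)
      then have "w * cmod (mat_act R (mat_act M a) i - a i)
          \<le> w * cmod (mat_act R (mat_act M d) i) + w * cmod (d i)"
        using norm_triangle_ineq4[of "mat_act R (mat_act M d) i" "d i"] w
        by (simp flip: distrib_left)
      also have "\<dots> \<le> weighted_norm ev s (mat_act R (mat_act M d)) + weighted_norm ev s d"
        unfolding w_def
        by (intro add_mono coordinate_le_weighted_norm mat_act_bounded(1)[OF R]
            mat_act_bounded(1)[OF M] wd True)
      also have "weighted_norm ev s (mat_act R (mat_act M d)) \<le> kern_const s * L' * weighted_norm ev s (mat_act M d)"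
        by (intro mat_act_bounded(2)[OF R] mat_act_bounded(1)[OF M] wd)
      also have "\<dots> \<le> kern_const s * L' * (kern_const s * L * weighted_norm ev s d)"
        using R kern_const_pos by (intro mult_left_mono mat_act_bounded(2)[OF M] wd)
          (auto simp: kern_dominated_def)
      finally show ?thesis unfolding K_def d_def[symmetric] by (simp add: algebra_simps)
    qed
    then have "\<forall>\<^sub>F F in finite_subsets_at_top {1..}. w * cmod (mat_act R (mat_act M a) i - a i)
        \<le> (K + 1) * weighted_norm ev s (a - truncate F a)"
      by (intro eventually_finite_subsets_at_top_weakI) auto
    moreover have "((\<lambda>F. (K + 1) * weighted_norm ev s (a - truncate F a)) \<longlongrightarrow> (K + 1) * 0)
        (finite_subsets_at_top {1..})"
      by (intro tendsto_intros weighted_norm_truncate_tendsto ws)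
    ultimately have "w * cmod (mat_act R (mat_act M a) i - a i) \<le> (K + 1) * 0"
      by (intro tendsto_lowerbound) auto
    then show ?thesis using w by (simp add: mult_le_0_iff)
  next
    case False
    then have "i = 0" by simp
    then show ?thesis using a by (simp add: mat_act_def power_completion_def)
  qed
qed

end

end

section \<open>Transport to the Hilbert space\<close>

lemma isomorphism_onI:
  fixes X :: "'a::complex_vector set"
  assumes X: "complex_vector.subspace X"
    and nrm: "\<And>x. x \<in> X \<Longrightarrow> nrm x \<ge> 0" and K: "K \<ge> 0"
    and T: "linear_on_dom X T" "\<And>x. x \<in> X \<Longrightarrow> T x \<in> X" "\<And>x. x \<in> X \<Longrightarrow> nrm (T x) \<le> K * nrm x"
    and R: "linear_on_dom X R" "\<And>x. x \<in> X \<Longrightarrow> R x \<in> X" "\<And>x. x \<in> X \<Longrightarrow> nrm (R x) \<le> K * nrm x"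
    and RT: "\<And>x. x \<in> X \<Longrightarrow> R (T x) = x" and TR: "\<And>x. x \<in> X \<Longrightarrow> T (R x) = x"
  shows "isomorphism_on X nrm T \<and>
    op_norm_on X nrm T + op_norm_on X nrm (inv_into X T) \<le> 2 * K"
proof
  have bij: "bij_betw T X X"
    by (rule bij_betw_byWitness[where f' = R]) (use T R RT TR in auto)
  then have inv: "inv_into X T y = R y" if "y \<in> X" for y
    using that R(2) TR by (metis bij_betw_inv_into_left)
  have closed: "x + y \<in> X" "c *\<^sub>C x \<in> X" if "x \<in> X" "y \<in> X" for x y c
    using X that by (auto simp: complex_vector.subspace_def)
  have "linear_on_dom X (inv_into X T)"
    using R(1) closed by (auto simp: linear_on_dom_def inv)
  then show "isomorphism_on X nrm T"
    unfolding isomorphism_on_def bounded_op_on_def using bij T R(2,3) inv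
    by (auto intro!: exI[of _ K])
  have norm_le: "op_norm_on X nrm S \<le> K" if "\<And>x. x \<in> X \<Longrightarrow> nrm (S x) \<le> K * nrm x" for S
    unfolding op_norm_on_def
  proof (rule cSUP_least)
    show "X \<noteq> {}" using X by (auto simp: complex_vector.subspace_def)
    fix x assume x: "x \<in> X"
    show "nrm (S x) / nrm x \<le> K"
      using that[OF x] nrm[OF x] K by (cases "nrm x = 0") (auto simp: divide_le_eq)
  qed
  show "op_norm_on X nrm T + op_norm_on X nrm (inv_into X T) \<le> 2 * K"
    using norm_le[of T] norm_le[of "inv_into X T"] T(3) R(3) inv by fastforce
qed

text \<open>Through this formula \<open>cinner\<close> inherits continuity from the real inner
  product.\<close>

lemma cinner_eq_Complex_inner:
  fixes x :: "'h::complex_hilbert_space"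
  shows "cinner x y = Complex (inner x y) (inner x (\<i> *\<^sub>C y))"
  by (simp add: complex_eq_iff inner_eq_Re_cinner cinner_scaleC_right)

lemma tendsto_cinner_left:
  fixes f :: "'i \<Rightarrow> 'h::complex_hilbert_space"
  assumes "(f \<longlongrightarrow> l) F"
  shows "((\<lambda>n. cinner (f n) y) \<longlongrightarrow> cinner l y) F"
  unfolding cinner_eq_Complex_inner by (intro tendsto_intros assms)

lemma cinner_zero_left [simp]: "cinner 0 y = 0"
  using cinner_scaleC_left[of 0 0 y] by simp

lemma cinner_zero_right [simp]: "cinner x 0 = 0"
  using cinner_commute[of x 0] by simp

lemma cinner_diff_left: "cinner (x - z) y = cinner x y - cinner z y"
  using cinner_add_left[of "x - z" z y] by simp

lemma scaleC_fun_apply: "(c *\<^sub>C a) n = c * a n" for a :: "'i \<Rightarrow> complex"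
  by (simp add: scaleC_fun_def scaleC_complex_def)

lemma fourier_zero: "fourier \<phi> 0 = 0"
  by (auto simp: fourier_def fun_eq_iff)

lemma fourier_add: "fourier \<phi> (f + g) = fourier \<phi> f + fourier \<phi> g"
  by (auto simp: fourier_def fun_eq_iff cinner_add_left)

lemma fourier_diff: "fourier \<phi> (f - g) = fourier \<phi> f - fourier \<phi> g"
  by (auto simp: fourier_def fun_eq_iff cinner_diff_left)

lemma fourier_scaleC: "fourier \<phi> (c *\<^sub>C f) = c *\<^sub>C fourier \<phi> f"
  by (auto simp: fourier_def fun_eq_iff cinner_scaleC_left scaleC_fun_def scaleC_complex_def)

context standing_assumptions
begin

lemma weighted_summable_add:
  assumes "weighted_summable ev s a" "weighted_summable ev s b"
  shows "weighted_summable ev s (a + b)"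
proof -
  have "weighted_summable ev s (0 - b)"
    using assms(2) by (simp add: weighted_summable_def)
  from weighted_summable_diff[OF assms(1) this] show ?thesis by simp
qed

lemma weighted_summable_scaleC:
  assumes "weighted_summable ev s a"
  shows "weighted_summable ev s (c *\<^sub>C a)"
  using summable_on_cmult_right[OF assms[unfolded weighted_summable_def], of "(cmod c)\<^sup>2"]
  by (simp add: weighted_summable_def scaleC_fun_def scaleC_complex_def norm_mult power_mult_distrib mult_ac)

lemma subspace_power_completion: "complex_vector.subspace (power_completion ev s)"
proof -
  have "weighted_summable ev s 0" by (simp add: weighted_summable_def)
  then show ?thesis
    by (auto simp: complex_vector.subspace_def power_completion_def weighted_summable_add
        weighted_summable_scaleC scaleC_fun_apply)
qed

lemma subspace_power_dom: "complex_vector.subspace (power_dom ev \<phi> s)"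
proof -
  have "weighted_summable ev s (fourier \<phi> 0)" by (simp add: weighted_summable_def fourier_zero)
  then show ?thesis
    by (auto simp: complex_vector.subspace_def power_dom_def fourier_add fourier_scaleC
        weighted_summable_add weighted_summable_scaleC)
qed

section \<open>Coefficients and synthesis in H\<close>

text \<open>The vectors orthogonal to f contain the span of the eigenvectors, hence by closedness
  and density everything, including f itself.\<close>

lemma eq_zero_if_fourier_zero:
  assumes "\<And>n. n \<ge> 1 \<Longrightarrow> cinner f (\<phi> n) = 0"
  shows "f = 0"
proof -
  have "complex_vector.subspace {y. cinner f y = 0}"
    by (auto simp: complex_vector.subspace_def cinner_add_right cinner_scaleC_right)
  then have "complex_vector.span (\<phi> ` {1..}) \<subseteq> {y. cinner f y = 0}"
    using assms by (intro complex_vector.span_minimal) auto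
  then have "complex_vector.span (\<phi> ` {1..}) \<subseteq> {y. inner f y = 0}"
    by (auto simp: inner_eq_Re_cinner)
  moreover have "closed {y. inner f y = 0}"
    by (intro closed_Collect_eq continuous_intros)
  ultimately have "closure (complex_vector.span (\<phi> ` {1..})) \<subseteq> {y. inner f y = 0}"
    by (rule closure_minimal)
  then have "inner f f = 0" using total by blast
  then show ?thesis by simp
qed

lemma fourier_inject:
  assumes "fourier \<phi> f = fourier \<phi> g"
  shows "f = g"
proof -
  have "cinner (f - g) (\<phi> n) = 0" if "n \<ge> 1" for n
    using fun_cong[OF assms, of n] that by (simp add: fourier_def cinner_diff_left)
  then show ?thesis using eq_zero_if_fourier_zero[of "f - g"] by simp
qed

lemma fourier_finite_sum:
  assumes "finite F" "F \<subseteq> {1..}"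
  shows "fourier \<phi> (\<Sum>n\<in>F. a n *\<^sub>C \<phi> n) = truncate F a"
proof
  fix m
  show "fourier \<phi> (\<Sum>n\<in>F. a n *\<^sub>C \<phi> n) m = truncate F a m"
  proof (cases "m \<ge> 1")
    case True
    have "cinner (\<Sum>n\<in>F. a n *\<^sub>C \<phi> n) (\<phi> m) = (\<Sum>n\<in>F. if n = m then a n else 0)"
      unfolding cinner_sum_left cinner_scaleC_left
      using True assms by (intro sum.cong refl) (auto simp: orthonormal subset_iff)
    then show ?thesis using True assms(1) by (simp add: fourier_def truncate_def)
  qed (use assms in \<open>auto simp: fourier_def truncate_def\<close>)
qed

lemma norm_finite_sum:
  assumes "finite F" "F \<subseteq> {1..}"
  shows "(norm (\<Sum>n\<in>F. a n *\<^sub>C \<phi> n))\<^sup>2 = (\<Sum>n\<in>F. (cmod (a n))\<^sup>2)"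
proof -
  define f where "f = (\<Sum>n\<in>F. a n *\<^sub>C \<phi> n)"
  have "cinner f f = (\<Sum>n\<in>F. a n * cinner (\<phi> n) f)"
    by (subst (1) f_def) (simp add: cinner_sum_left cinner_scaleC_left)
  also have "\<dots> = (\<Sum>n\<in>F. of_real ((cmod (a n))\<^sup>2))"
  proof (intro sum.cong refl)
    fix n assume n: "n \<in> F"
    then have "cinner f (\<phi> n) = a n"
      using fun_cong[OF fourier_finite_sum[OF assms, of a], of n] assms(2)
      by (auto simp: f_def fourier_def truncate_def)
    then show "a n * cinner (\<phi> n) f = of_real ((cmod (a n))\<^sup>2)"
      using cinner_commute[of "\<phi> n" f] by (simp only: complex_norm_square)
  qed
  finally show ?thesis by (simp add: norm_sq_cinner f_def[symmetric])
qed

text \<open>The partial sums are Cauchy because their squared distances are differences of the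
  bounded increasing sequence \<open>S\<close>.\<close>

lemma riesz_fischer:
  assumes "a \<in> power_completion ev 0"
  shows "\<exists>f. fourier \<phi> f = a \<and> norm f \<le> weighted_norm ev 0 a"
proof -
  have a: "weighted_summable ev 0 a" "a 0 = 0" using assms by (auto simp: power_completion_def)
  define P where "P N = (\<Sum>n\<in>{1..N}. a n *\<^sub>C \<phi> n)" for N
  define S where "S N = (\<Sum>n\<in>{1..N}. (cmod (a n))\<^sup>2)" for N
  have S_le: "S N \<le> (weighted_norm ev 0 a)\<^sup>2" for N
  proof -
    \<comment> \<open>The weight with exponent 0 is 1 only for nonzero eigenvalues, as 0 powr 0 =
      0.\<close>
    have "S N = (\<Sum>n\<in>{1..N}. cmod (ev n) powr (2 * 0) * (cmod (a n))\<^sup>2)"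
      unfolding S_def by (intro sum.cong) (auto simp: ev_nonzero)
    then show ?thesis using finite_sum_le_weighted_norm[OF a(1), of "{1..N}"] by auto
  qed
  have "incseq S" unfolding S_def by (intro incseq_SucI) simp
  then have "Cauchy S"
    using incseq_convergent[of S "(weighted_norm ev 0 a)\<^sup>2"] S_le by (metis LIMSEQ_imp_Cauchy)
  have dist_P: "(dist (P m) (P n))\<^sup>2 = S n - S m" if "m \<le> n" for m n
  proof -
    have "{1..n} = {1..m} \<union> {m<..n}" using that by auto
    then have PS: "P n = P m + (\<Sum>i\<in>{m<..n}. a i *\<^sub>C \<phi> i)"
      "S n = S m + (\<Sum>i\<in>{m<..n}. (cmod (a i))\<^sup>2)"
      unfolding P_def S_def by (auto intro: sum.union_disjoint)
    have "{m<..n} \<subseteq> {1..}" by auto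
    then show ?thesis
      unfolding dist_norm PS by (simp add: norm_finite_sum)
  qed
  have "Cauchy P"
  proof (rule metric_CauchyI)
    fix e :: real assume e: "e > 0"
    then obtain M where M: "\<And>m n. m \<ge> M \<Longrightarrow> n \<ge> M \<Longrightarrow> dist (S m) (S n) < e\<^sup>2"
      using metric_CauchyD[OF \<open>Cauchy S\<close>, of "e\<^sup>2"] by auto
    have "dist (P m) (P n) < e" if "m \<ge> M" "n \<ge> M" for m n
    proof -
      have "(dist (P m) (P n))\<^sup>2 = \<bar>S n - S m\<bar>"
        using dist_P[of m n] dist_P[of n m] zero_le_power2[of "dist (P m) (P n)"]
        by (cases "m \<le> n") (auto simp: dist_commute abs_minus_commute)
      also have "\<dots> < e\<^sup>2" using M[OF that] by (simp add: dist_real_def abs_minus_commute)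
      finally show ?thesis using e by (simp add: power_less_imp_less_base)
    qed
    then show "\<exists>M. \<forall>m\<ge>M. \<forall>n\<ge>M. dist (P m) (P n) < e" by blast
  qed
  then obtain f where f: "P \<longlonglongrightarrow> f" using Cauchy_convergent convergent_def by blast
  have "fourier \<phi> f m = a m" for m
  proof (cases "m \<ge> 1")
    case True
    have "eventually (\<lambda>N. cinner (P N) (\<phi> m) = a m) sequentially"
      using eventually_ge_at_top[of m]
    proof eventually_elim
      case (elim N)
      then show ?case using fun_cong[OF fourier_finite_sum[of "{1..N}" a], of m] True
        by (auto simp: P_def fourier_def truncate_def)
    qed
    then have "(\<lambda>N. cinner (P N) (\<phi> m)) \<longlonglongrightarrow> a m" by (rule tendsto_eventually)
    then show ?thesis using LIMSEQ_unique[OF tendsto_cinner_left[OF f]] True by (simp add: fourier_def)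
  next
    case False
    then have "m = 0" by simp
    then show ?thesis using a(2) by (simp add: fourier_def)
  qed
  moreover have "norm f \<le> weighted_norm ev 0 a"
  proof (rule tendsto_upperbound[OF tendsto_norm[OF f]])
    have "(norm (P N))\<^sup>2 = S N" for N unfolding P_def S_def by (rule norm_finite_sum) auto
    then have "norm (P N) \<le> weighted_norm ev 0 a" for N
      using S_le[of N] by (intro power2_le_imp_le[OF _ weighted_norm_nonneg]) simp
    then show "\<forall>\<^sub>F N in sequentially. norm (P N) \<le> weighted_norm ev 0 a" by simp
  qed simp
  ultimately show ?thesis by blast
qed

lemma norm_le_weighted_norm: "norm f \<le> weighted_norm ev 0 (fourier \<phi> f)"
  using riesz_fischer[OF fourier_in_power_completion[of 0 f]] fourier_inject by force

text \<open>The inverse of \<open>fourier\<close>; the description has a solution exactly on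
  \<open>power_completion ev 0\<close>.\<close>

definition synth :: "(nat \<Rightarrow> complex) \<Rightarrow> 'h" where
  "synth a = (THE f. fourier \<phi> f = a)"

lemma synth_fourier [simp]: "synth (fourier \<phi> f) = f"
  unfolding synth_def by (rule the_equality) (auto dest: fourier_inject)

lemma fourier_synth: "a \<in> power_completion ev 0 \<Longrightarrow> fourier \<phi> (synth a) = a"
  using riesz_fischer[of a] by auto

lemma zero_in_range: "1 / (2 * \<alpha>) - 1 < 0" "0 < 1 - 1 / (2 * \<alpha>)"
  using alpha_gt_1 by (auto simp: field_simps)

lemma mat_act_in_power_completion:
  assumes "1 / (2 * \<alpha>) - 1 < s" "s < 1 - 1 / (2 * \<alpha>)" "kern_dominated L M" "weighted_summable ev s a"
  shows "mat_act M a \<in> power_completion ev s"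
  using mat_act_bounded(1)[OF assms] by (simp add: power_completion_def mat_act_def)

text \<open>The bridge from infinite sums in H to matrices. The remainder of a finite partial sum
  has the coefficients of M applied to \<open>a - truncate F a\<close>, which the estimate for s = 0
  makes small.\<close>

lemma has_sum_mat_act:
  assumes M: "kern_dominated L M" and a: "weighted_summable ev 0 a"
    and v: "\<And>n p. n \<ge> 1 \<Longrightarrow> p \<ge> 1 \<Longrightarrow> cinner (v n) (\<phi> p) = M p n"
  shows "((\<lambda>n. a n *\<^sub>C v n) has_sum synth (mat_act M a)) {1..}"
proof -
  define g where "g = synth (mat_act M a)"
  define K where "K = kern_const 0 * L"
  have fg: "fourier \<phi> g = mat_act M a"
    unfolding g_def by (intro fourier_synth mat_act_in_power_completion[OF zero_in_range M a])
  have wt: "weighted_summable ev 0 (truncate F a)" for F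
    by (rule weighted_summable_truncate[OF a])
  have "norm ((\<Sum>n\<in>F. a n *\<^sub>C v n) - g) \<le> K * weighted_norm ev 0 (a - truncate F a)"
    if F: "finite F" "F \<subseteq> {1..}" for F
  proof -
    have "fourier \<phi> (\<Sum>n\<in>F. a n *\<^sub>C v n) = mat_act M (truncate F a)"
      using F by (auto simp: fun_eq_iff mat_act_truncate fourier_def cinner_sum_left
          cinner_scaleC_left v subset_iff mult.commute intro!: sum.cong)
    then have "fourier \<phi> (g - (\<Sum>n\<in>F. a n *\<^sub>C v n)) = mat_act M (a - truncate F a)"
      by (simp add: fourier_diff fg mat_act_diff[OF zero_in_range M a wt])
    then have "norm (g - (\<Sum>n\<in>F. a n *\<^sub>C v n)) \<le> weighted_norm ev 0 (mat_act M (a - truncate F a))"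
      using norm_le_weighted_norm[of "g - (\<Sum>n\<in>F. a n *\<^sub>C v n)"] by simp
    also have "\<dots> \<le> K * weighted_norm ev 0 (a - truncate F a)"
      unfolding K_def by (intro mat_act_bounded(2)[OF zero_in_range M] weighted_summable_diff a wt)
    finally show ?thesis by (simp add: norm_minus_commute)
  qed
  then have "\<forall>\<^sub>F F in finite_subsets_at_top {1..}.
      norm ((\<Sum>n\<in>F. a n *\<^sub>C v n) - g) \<le> K * weighted_norm ev 0 (a - truncate F a)"
    by (intro eventually_finite_subsets_at_top_weakI)
  moreover have "((\<lambda>F. K * weighted_norm ev 0 (a - truncate F a)) \<longlongrightarrow> K * 0) (finite_subsets_at_top {1..})"
    by (intro tendsto_intros weighted_norm_truncate_tendsto a)
  ultimately have "((\<lambda>F. (\<Sum>n\<in>F. a n *\<^sub>C v n) - g) \<longlongrightarrow> 0) (finite_subsets_at_top {1..})"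
    unfolding mult_zero_right by (rule Lim_null_comparison)
  then show ?thesis unfolding has_sum_def g_def[symmetric] by (simp add: LIM_zero_iff)
qed

text \<open>The identity matrix is dominated by the kernel, whose diagonal is 1, so this is a case
  of the matrix statement.\<close>

lemma has_sum_fourier_expansion:
  assumes "a \<in> power_completion ev 0"
  shows "((\<lambda>n. a n *\<^sub>C \<phi> n) has_sum synth a) {1..}"
proof -
  define I :: "nat \<Rightarrow> nat \<Rightarrow> complex" where "I p n = (if p = n then 1 else 0)" for p n
  have "kern_dominated 1 I" by (auto simp: kern_dominated_def I_def kern_bounds)
  moreover have "mat_act I a = a"
  proof
    fix p
    have "(\<Sum>\<^sub>\<infinity>n\<in>{1..}. I p n * a n) = (\<Sum>\<^sub>\<infinity>n\<in>{p}. a n)" if "p \<ge> 1"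
      using that by (intro infsum_cong_neutral) (auto simp: I_def)
    then show "mat_act I a p = a p"
      using assms by (cases "p = 0") (auto simp: mat_act_def power_completion_def)
  qed
  ultimately show ?thesis
    using has_sum_mat_act[of 1 I a \<phi>] assms by (auto simp: I_def orthonormal power_completion_def)
qed

text \<open>For s < 0 the matrix, acting on coefficient sequences, is itself the extension of T. For
  s \<ge> 0 the spaces lie in H, and the injectivity of \<open>fourier\<close> carries the sequence
  statements back. The factor 2 accounts for T and its inverse.\<close>

lemma isomorphism_bound_mat_act:
  assumes s: "1 / (2 * \<alpha>) - 1 < s" "s < 1 - 1 / (2 * \<alpha>)"
    and M: "kern_dominated L M" and R: "kern_dominated L R"
    and RM: "\<And>i n. i \<ge> 1 \<Longrightarrow> n \<ge> 1 \<Longrightarrow>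
      ((\<lambda>p. R i p * M p n) has_sum (if i = n then 1 else 0)) {1..}"
    and MR: "\<And>i n. i \<ge> 1 \<Longrightarrow> n \<ge> 1 \<Longrightarrow>
      ((\<lambda>p. M i p * R p n) has_sum (if i = n then 1 else 0)) {1..}"
    and T: "\<And>f. T f = synth (mat_act M (fourier \<phi> f))"
  shows "isomorphism_bound ev \<phi> s T (2 * (kern_const s * L))"
proof -
  define K where "K = kern_const s * L"
  have K: "K \<ge> 0" using M kern_const_pos[OF s] by (simp add: K_def kern_dominated_def)
  have linear: "linear_on_dom (power_completion ev s) (mat_act N)" if N: "kern_dominated L N" for N
    unfolding linear_on_dom_def
  proof (intro conjI ballI allI subspace_power_completion)
    fix a b c assume a: "a \<in> power_completion ev s" 
    then have ws: "weighted_summable ev s a" by (simp add: power_completion_def)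
    show "mat_act N (c *\<^sub>C a) = c *\<^sub>C mat_act N a"
      using mat_act_row_summable[OF s N ws]
      by (auto simp: fun_eq_iff mat_act_def scaleC_fun_def scaleC_complex_def
          mult.left_commute[of _ c] infsum_cmult_right)
    assume "b \<in> power_completion ev s"
    then show "mat_act N (a + b) = mat_act N a + mat_act N b"
      using mat_act_add[OF s N ws] by (simp add: power_completion_def)
  qed
  have into: "mat_act N a \<in> power_completion ev s" "weighted_norm ev s (mat_act N a) \<le> K * weighted_norm ev s a"
    if "kern_dominated L N" "a \<in> power_completion ev s" for N a
    using that mat_act_in_power_completion[OF s that(1)] mat_act_bounded(2)[OF s that(1)]
    by (auto simp: power_completion_def K_def)
  show ?thesis
  proof (cases "s \<ge> 0")
    case False
    have "isomorphism_on (power_completion ev s) (weighted_norm ev s) (mat_act M) \<and>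
      op_norm_on (power_completion ev s) (weighted_norm ev s) (mat_act M) +
       op_norm_on (power_completion ev s) (weighted_norm ev s) (inv_into (power_completion ev s) (mat_act M)) \<le> 2 * K"
      by (rule isomorphism_onI[where R = "mat_act R"])
         (simp_all add: subspace_power_completion weighted_norm_nonneg K linear M R into
            mat_act_inverse[OF s M R RM] mat_act_inverse[OF s R M MR])
    moreover have "mat_act M (fourier \<phi> f) = fourier \<phi> (T f)" for f
      using mat_act_in_power_completion[OF zero_in_range M] fourier_in_power_completion[of 0 f]
      by (simp add: T fourier_synth power_completion_def)
    ultimately show ?thesis using False unfolding isomorphism_bound_def K_def by auto
  next
    case True
    define U where "U N f = synth (mat_act N (fourier \<phi> f))" for N f
    have UM: "T = U M" by (auto simp: U_def T)
    have fU: "fourier \<phi> (U N f) = mat_act N (fourier \<phi> f)" if "kern_dominated L N" for N f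
      using mat_act_in_power_completion[OF zero_in_range that] fourier_in_power_completion[of 0 f]
      by (simp add: U_def fourier_synth power_completion_def)
    have dom: "f \<in> power_dom ev \<phi> s \<longleftrightarrow> fourier \<phi> f \<in> power_completion ev s" for f
      by (auto simp: power_dom_def power_completion_def fourier_def)
    have linU: "linear_on_dom (power_dom ev \<phi> s) (U N)" if N: "kern_dominated L N" for N
      unfolding linear_on_dom_def
    proof (intro conjI ballI allI subspace_power_dom)
      fix f g c assume "f \<in> power_dom ev \<phi> s"
      then show "U N (c *\<^sub>C f) = c *\<^sub>C U N f"
        using linear[OF N]
        by (intro fourier_inject) (auto simp: fU[OF N] fourier_scaleC dom linear_on_dom_def)
      assume "f \<in> power_dom ev \<phi> s" "g \<in> power_dom ev \<phi> s"
      then show "U N (f + g) = U N f + U N g"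
        using linear[OF N]
        by (intro fourier_inject) (auto simp: fU[OF N] fourier_add dom linear_on_dom_def)
    qed
    have inverses: "U R (U M f) = f" "U M (U R f) = f" if "f \<in> power_dom ev \<phi> s" for f
      using that by (auto intro!: fourier_inject simp: fU M R dom mat_act_inverse[OF s M R RM]
          mat_act_inverse[OF s R M MR])
    have "isomorphism_on (power_dom ev \<phi> s) (power_norm ev \<phi> s) (U M) \<and>
      op_norm_on (power_dom ev \<phi> s) (power_norm ev \<phi> s) (U M) +
       op_norm_on (power_dom ev \<phi> s) (power_norm ev \<phi> s) (inv_into (power_dom ev \<phi> s) (U M)) \<le> 2 * K"
      by (rule isomorphism_onI[where R = "U R"])
         (simp_all add: subspace_power_dom K linU M R inverses power_norm_def weighted_norm_nonneg
            dom fU into)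
    then show ?thesis using True unfolding isomorphism_bound_def UM K_def by auto
  qed
qed

end

section \<open>The transformation\<close>

text \<open>A power of \<mu> is a power of y = \<mu>^(1/\<alpha>), and y / r \<le> exp (y / r)
  raised to the power r bounds it by a multiple of exp y.\<close>

lemma one_plus_powr_le_exp:
  fixes \<alpha> q :: real
  assumes \<alpha>: "\<alpha> > 1" and q: "q > 0"
  shows "\<exists>K>0. \<forall>\<mu>\<ge>0. (1 + \<mu>) powr q \<le> K * exp (\<mu> powr (1 / \<alpha>))"
proof -
  define r where "r = \<alpha> * q"
  have r: "r > 0" using \<alpha> q by (simp add: r_def)
  have main: "(1 + \<mu>) powr q \<le> 2 powr q * (1 + r powr r) * exp (\<mu> powr (1 / \<alpha>))" if \<mu>: "\<mu> \<ge> 0" for \<mu>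
  proof -
    define y where "y = \<mu> powr (1 / \<alpha>)"
    have y: "y \<ge> 0" "\<mu> powr q = y powr r" using \<alpha> by (auto simp: y_def r_def powr_powr)
    have "y / r \<le> exp (y / r)" using exp_ge_add_one_self[of "y / r"] by linarith
    then have "(y / r) powr r \<le> exp (y / r) powr r" using y r by (intro powr_mono2) auto
    then have "y powr r \<le> r powr r * exp y"
      using y r by (simp add: powr_divide powr_def[of "exp _"] field_simps)
    moreover have "1 \<le> exp y" using y by simp
    ultimately have *: "1 + \<mu> powr q \<le> (1 + r powr r) * exp y"
      unfolding y(2) distrib_right by linarith
    have "(1 + \<mu>) powr q \<le> (2 * max 1 \<mu>) powr q" using \<mu> q by (intro powr_mono2) auto
    also have "\<dots> = 2 powr q * max 1 \<mu> powr q" by (rule powr_mult)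
    also have "max 1 \<mu> powr q \<le> 1 + \<mu> powr q" using q by (auto simp: max_def)
    also note *
    finally show ?thesis by (simp add: y_def mult.assoc)
  qed
  have "2 powr q * (1 + r powr r) > 0" by (intro mult_pos_pos add_pos_nonneg) auto
  then show ?thesis using main by blast
qed

text \<open>Each element of \<open>E\<close> is close to at most one of \<open>card E + 1\<close> equidistant points.\<close>

lemma exists_point_away_from_finite_set:
  fixes E :: "real set" and N :: real
  assumes "finite E" "card E < K"
  shows "\<exists>\<mu>\<in>{N..N + 1}. N < \<mu> \<and> (\<forall>e\<in>E. 1 / (2 * real K) \<le> \<bar>e - \<mu>\<bar>)"
proof -
  \<comment> \<open>Midpoints of K equal cells; the strict inequality N < \<open>pt k\<close>
    secures \<mu> > 0 even for N = 0.\<close>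
  define pt where "pt k = N + (real k + 1 / 2) / real K" for k
  have K: "real K > 0" using assms by simp
  have range: "N < pt k" "pt k \<le> N + 1" if "k < K" for k
  proof -
    have "real k + 1 / 2 \<le> real K" using that by linarith
    then show "N < pt k" "pt k \<le> N + 1" using K by (auto simp: pt_def divide_le_eq)
  qed
  have "\<exists>k<K. \<forall>e\<in>E. 1 / (2 * real K) \<le> \<bar>e - pt k\<bar>"
  proof (rule ccontr)
    assume "\<not> ?thesis"
    then have "\<forall>k\<in>{..<K}. \<exists>e. e \<in> E \<and> \<bar>e - pt k\<bar> < 1 / (2 * real K)" by (auto simp: not_le)
    then obtain e where e: "\<And>k. k < K \<Longrightarrow> e k \<in> E" "\<And>k. k < K \<Longrightarrow> \<bar>e k - pt k\<bar> < 1 / (2 * real K)"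
      by (auto dest!: bchoice)
    have "inj_on e {..<K}"
    proof (rule inj_onI)
      fix k l assume "k \<in> {..<K}" "l \<in> {..<K}" and eq: "e k = e l"
      then have "\<bar>pt k - pt l\<bar> < 1 / (2 * real K) + 1 / (2 * real K)"
        using e(2)[of k] e(2)[of l] by auto
      then have "\<bar>pt k - pt l\<bar> < 1 / real K" by simp
      moreover have "pt k - pt l = (real k - real l) / real K"
        by (simp add: pt_def diff_divide_distrib add_divide_distrib)
      ultimately have "\<bar>real k - real l\<bar> < 1" using K by (simp add: field_simps)
      then show "k = l" by linarith
    qed
    then have "card {..<K} \<le> card E" using e(1) assms(1) by (intro card_inj_on_le[of e]) auto
    then show False using assms(2) by simp
  qed
  then obtain k where k: "k < K" "\<forall>e\<in>E. 1 / (2 * real K) \<le> \<bar>e - pt k\<bar>" by blast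
  then show ?thesis using range[OF k(1)] by (intro bexI[of _ "pt k"]) auto
qed

text \<open>If p \<noteq> n and the difference has modulus at most N + 2, then both indices are at
  most \<open>J\<close>, because |p - n| \<ge> 1 in the gap condition. So the number of differences
  to be avoided is at most of order N^(2/(\<alpha>-1)).\<close>

lemma (in gap_sequence) exists_separated:
  fixes N :: nat
  shows "\<exists>\<mu> \<delta>. \<mu> \<in> {real N..real N + 1} \<and> \<mu> > 0 \<and> \<delta> > 0 \<and>
    1 / \<delta> \<le> (4 + 2 * (2 / c) powr (2 / (\<alpha> - 1))) * (1 + \<mu>) powr (2 / (\<alpha> - 1)) \<and>
    (\<forall>p\<ge>1. \<forall>n\<ge>1. \<delta> \<le> \<bar>Re (x p - x n) - \<mu>\<bar> \<or> Im (x p - x n) \<noteq> 0)"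
proof -
  define J where "J = ((real N + 2) / c) powr (1 / (\<alpha> - 1))"
  define m where "m = nat \<lfloor>J\<rfloor>"
  \<comment> \<open>The element 0 represents all pairs p = n. Thus \<open>E\<close> has at most m^2
    + 1 elements, and \<open>K\<close> exceeds this by one.\<close>
  define E where "E = insert 0 ((\<lambda>(p, n). Re (x p - x n)) ` ({1..m} \<times> {1..m}))"
  define K where "K = m ^ 2 + 2"
  have J: "J \<ge> 0" by (simp add: J_def)
  have "card ((\<lambda>(p, n). Re (x p - x n)) ` ({1..m} \<times> {1..m})) \<le> card ({1..m} \<times> {1..m})"
    by (intro card_image_le) auto
  then have "card E < K"
    unfolding E_def K_def by (intro le_less_trans[OF card_insert_le_m1[of "m^2 + 1"]]) (auto simp: power2_eq_square)
  then obtain \<mu> where \<mu>: "\<mu> \<in> {real N..real N + 1}" "real N < \<mu>" "\<And>e. e \<in> E \<Longrightarrow> 1 / (2 * real K) \<le> \<bar>e - \<mu>\<bar>"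
    using exists_point_away_from_finite_set[of E K "real N"] unfolding E_def by blast
  define \<delta> where "\<delta> = 1 / (2 * real K)"
  have "1 \<le> real K" by (simp add: K_def)
  then have \<delta>: "\<delta> > 0" "\<delta> \<le> 1" by (auto simp: \<delta>_def divide_le_eq)
  have index_le: "p \<le> m" if "p \<ge> 1" "n \<ge> 1" "p \<noteq> n" "cmod (x p - x n) \<le> real N + 2" for p n
  proof -
    have "real p powr (\<alpha> - 1) * 1 \<le> real p powr (\<alpha> - 1) * \<bar>real p - real n\<bar>"
      using that(3) by (intro mult_left_mono) auto
    then have "c * real p powr (\<alpha> - 1) \<le> c * real p powr (\<alpha> - 1) * \<bar>real p - real n\<bar>"
      using c_pos by (simp add: mult.assoc)
    also have "\<dots> \<le> real N + 2" using gap[OF that(1,2)] that(4) by linarith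
    finally have "real p powr (\<alpha> - 1) \<le> (real N + 2) / c" using c_pos by (simp add: field_simps)
    then have "(real p powr (\<alpha> - 1)) powr (1 / (\<alpha> - 1)) \<le> J"
      unfolding J_def using alpha by (intro powr_mono2) auto
    then have "real p \<le> J" using alpha that(1) by (simp add: powr_powr)
    then show ?thesis by (simp add: m_def le_nat_floor)
  qed
  have "\<delta> \<le> \<bar>Re (x p - x n) - \<mu>\<bar>" if pn: "p \<ge> 1" "n \<ge> 1" "Im (x p - x n) = 0" for p n
  proof (cases "cmod (x p - x n) \<le> real N + 2")
    case True
    have "Re (x p - x n) \<in> E"
    proof (cases "p = n")
      case False
      then have "p \<in> {1..m}" "n \<in> {1..m}"
        using index_le[of p n] index_le[of n p] pn True by (auto simp: norm_minus_commute)
      then show ?thesis unfolding E_def by force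
    qed (simp add: E_def)
    then show ?thesis using \<mu>(3) by (simp add: \<delta>_def)
  next
    \<comment> \<open>A real difference of modulus above N + 2 has distance at least 1 from \<mu>
      \<le> N + 1, and \<delta> \<le> 1.\<close>
    case False
    have "cmod (x p - x n) = \<bar>Re (x p - x n)\<bar>" using pn(3) by (simp add: cmod_def)
    then show ?thesis using False \<mu>(1) \<delta> by auto
  qed
  moreover have "1 / \<delta> \<le> (4 + 2 * (2 / c) powr (2 / (\<alpha> - 1))) * (1 + \<mu>) powr (2 / (\<alpha> - 1))"
  proof -
    \<comment> \<open>The exponent 2/(\<alpha>-1) and the constant in the statement come from 1 /
      \<delta> = 2 m^2 + 4 and N + 2 \<le> 2 (1 + \<mu>).\<close>
    have "real m \<le> J" using J by (simp add: m_def)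
    then have "real m ^ 2 \<le> J ^ 2" by (intro power_mono) auto
    also have "J ^ 2 = ((real N + 2) / c) powr (2 / (\<alpha> - 1))"
      unfolding J_def by (simp add: power2_eq_square flip: powr_add add_divide_distrib)
    also have "\<dots> \<le> (2 / c * (1 + \<mu>)) powr (2 / (\<alpha> - 1))"
      using alpha c_pos \<mu>(1) by (intro powr_mono2) (auto simp: field_simps)
    also have "\<dots> = (2 / c) powr (2 / (\<alpha> - 1)) * (1 + \<mu>) powr (2 / (\<alpha> - 1))" by (rule powr_mult)
    finally have "2 * real m ^ 2 \<le> 2 * (2 / c) powr (2 / (\<alpha> - 1)) * (1 + \<mu>) powr (2 / (\<alpha> - 1))" by simp
    moreover have "1 \<le> (1 + \<mu>) powr (2 / (\<alpha> - 1))"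
      using \<mu>(2) alpha by (intro ge_one_powr_ge_zero) auto
    moreover have "1 / \<delta> = 2 * real m ^ 2 + 4" by (simp add: \<delta>_def K_def)
    ultimately show ?thesis by (simp add: algebra_simps)
  qed
  ultimately show ?thesis using \<mu>(1,2) \<delta>(1) by (intro exI[of _ \<mu>] exI[of _ \<delta>]) auto
qed

section \<open>Identification of T and its inverse; uniform bounds\<close>

lemma T_tilde_inv_eq_gap_prod:
  "T_tilde_inv x \<mu> i j = \<mu>\<^sup>2 / (x j - x i - \<mu>) * gap_prod x (-\<mu>) i * gap_prod x \<mu> j"
  unfolding T_tilde_inv_def gap_prod_def minus_divide_left[symmetric] diff_minus_eq_add ..

text \<open>The product depending on n leaves the sum over j together with one factor \<mu>; the
  rest is the sum rule \<open>gap_prod_sum\<close>.\<close>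

lemma (in separated_gap_sequence) k_coeff_eq:
  assumes "n \<ge> 1"
  shows "k_coeff x b \<mu> n = - \<mu> * gap_prod x (-\<mu>) n / b n"
proof -
  have "(\<Sum>\<^sub>\<infinity>j\<in>{1..}. T_tilde_inv x \<mu> n j)
      = (\<Sum>\<^sub>\<infinity>j\<in>{1..}. (\<mu> * gap_prod x (-\<mu>) n) * (\<mu> * gap_prod x \<mu> j / (x j - x n - \<mu>)))"
    by (intro infsum_cong) (simp add: T_tilde_inv_eq_gap_prod power2_eq_square)
  also have "\<dots> = - \<mu> * gap_prod x (-\<mu>) n"
    unfolding infsum_cmult_right' gap_prod_sum[OF assms] by simp
  finally show ?thesis by (simp add: k_coeff_def)
qed

context standing_assumptions
begin

text \<open>In the bound, \<mu> comes from the coefficients k, \<open>b2 / b1\<close> from a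
  quotient of two pairings, the exponential from one gap product, and the last factor from the
  Cauchy denominators.\<close>

lemma transformation_bound:
  fixes \<mu> c \<delta> b1 b2 :: real
  assumes sep: "separated_gap_sequence ev \<alpha> c (of_real \<mu>) \<delta>" and \<mu>: "\<mu> > 0"
    and b1: "b1 > 0" "\<And>n. n \<ge> 1 \<Longrightarrow> b1 \<le> cmod (B (\<phi> n))"
    and b2: "\<And>n. n \<ge> 1 \<Longrightarrow> cmod (B (\<phi> n)) \<le> b2"
    and s: "1 / (2 * \<alpha>) - 1 < s" "s < 1 - 1 / (2 * \<alpha>)"
  shows "isomorphism_bound ev \<phi> s (T_op ev \<phi> (\<lambda>n. B (\<phi> n)) (of_real \<mu>))
    (2 * (kern_const s * (\<mu> * (b2 / b1) * exp (gap_sequence.growth ev \<alpha> * \<mu> powr (1 / \<alpha>))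
      * (1 + (1 + \<mu>) / \<delta>))))"
proof -
  define m where "m = complex_of_real \<mu>"
  interpret separated_gap_sequence ev \<alpha> c m \<delta> using sep by (simp add: m_def)
  interpret refl: separated_gap_sequence ev \<alpha> c "-m" \<delta> by (rule reflected)
  define b where "b n = B (\<phi> n)" for n
  define P where "P n = gap_prod ev (-m) n" for n
  define Q where "Q n = gap_prod ev m n" for n
  define d where "d p n = ev p - ev n - m" for p n
  define E where "E = exp (growth * \<mu> powr (1 / \<alpha>))"
  define L where "L = \<mu> * (b2 / b1) * E * res_const"
  define M where "M p n = - m * (b p / b n) * P n / d p n" for p n
  \<comment> \<open>The orthogonality relation dictates this inverse: up to diagonal scaling, the
    transposed Cauchy matrix with \<open>Q\<close> in place of \<open>P\<close>.\<close>
  define R where "R n p = - m * (b n / b p) * Q p / d p n" for n p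
  have b0: "b n \<noteq> 0" if "n \<ge> 1" for n using b1(1) b1(2)[OF that] by (auto simp: b_def)
  have b_ratio: "cmod (b p / b n) \<le> b2 / b1" if "p \<ge> 1" "n \<ge> 1" for p n
    using that b1 b2 unfolding b_def norm_divide
    by (intro frac_le) (auto intro: order_trans[OF norm_ge_zero])
  have b21: "b2 / b1 \<ge> 0" using b_ratio[of 1 1] by (auto intro: order_trans[OF norm_ge_zero])
  have E: "E \<ge> 0" by (simp add: E_def)
  have L: "L \<ge> 0" unfolding L_def using \<mu> res_const_ge_1 by (intro mult_nonneg_nonneg b21 E) auto
  have mu: "cmod m = \<mu>" using \<mu> by (simp add: m_def)
  have PQ: "cmod (P n) \<le> E" "cmod (Q n) \<le> E" if "n \<ge> 1" for n
    using gap_prod_le[OF that, of "-m"] gap_prod_le[OF that, of m] by (auto simp: P_def Q_def E_def mu)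
  have dom: "kern_dominated L M" "kern_dominated L R"
  proof -
    have bound: "cmod (- m * u * v / d p n) \<le> L * kern ev p n"
      if "p \<ge> 1" "n \<ge> 1" "cmod u \<le> b2 / b1" "cmod v \<le> E" for u v p n
    proof -
      have "cmod (- m * u * v / d p n) = \<mu> * cmod u * cmod v * (1 / cmod (d p n))"
        by (simp add: norm_mult norm_divide mu)
      also have "\<dots> \<le> \<mu> * (b2 / b1) * E * (res_const * kern ev p n)"
        unfolding d_def using that \<mu>
        by (intro mult_mono resolvent_bound mult_nonneg_nonneg b21 E) (auto intro: b21 E)
      finally show ?thesis by (simp add: L_def mult.assoc)
    qed
    show "kern_dominated L M"
      unfolding kern_dominated_def M_def by (intro conjI L allI impI bound b_ratio PQ)
    show "kern_dominated L R"
      unfolding kern_dominated_def R_def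
    proof (intro conjI L allI impI)
      fix n p :: nat assume "n \<ge> 1" "p \<ge> 1"
      then show "cmod (- m * (b n / b p) * Q p / d p n) \<le> L * kern ev n p"
        unfolding kern_commute[of ev n p] by (intro bound b_ratio PQ)
    qed
  qed
  have RM: "((\<lambda>p. R i p * M p n) has_sum (if i = n then 1 else 0)) {1..}" if "i \<ge> 1" "n \<ge> 1" for i n
  proof -
    define S where "S = (\<Sum>\<^sub>\<infinity>p\<in>{1..}. Q p / (d p i * d p n))"
    have S: "((\<lambda>p. Q p / (d p i * d p n)) has_sum S) {1..}" "m\<^sup>2 * P i * S = (if i = n then 1 else 0)"
      using gap_prod_orthogonality[OF that] by (auto simp: S_def Q_def P_def d_def)
    have sums: "((\<lambda>p. m\<^sup>2 * (b i / b n) * P n * (Q p / (d p i * d p n))) has_sum m\<^sup>2 * (b i / b n) * P n * S) {1..}"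
      by (intro has_sum_cmult_right S)
    have total_eq: "m\<^sup>2 * (b i / b n) * P n * S = (if i = n then 1 else 0)"
    proof (cases "i = n")
      case False
      \<comment> \<open>The orthogonality relation carries \<open>P i\<close>, the matrix product
        \<open>P n\<close>. Off the diagonal, \<open>P i\<close> \<noteq> 0 shows that
        \<open>S\<close> itself vanishes.\<close>
      then have "S = 0" using S(2) mu_nonzero gap_prod_nonzero[OF that(1)] by (auto simp: P_def)
      then show ?thesis using False by simp
    qed (use S(2) b0 that in simp)
    have entry: "R i p * M p n = m\<^sup>2 * (b i / b n) * P n * (Q p / (d p i * d p n))" if "p \<in> {1..}" for p
      using b0[of p] that by (simp add: R_def M_def power2_eq_square mult_ac)
    show ?thesis by (rule has_sum_cong[THEN iffD2, rotated, OF sums[unfolded total_eq]]) (rule entry)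
  qed
  have MR: "((\<lambda>p. M i p * R p n) has_sum (if i = n then 1 else 0)) {1..}" if "i \<ge> 1" "n \<ge> 1" for i n
  proof -
    define S where "S = (\<Sum>\<^sub>\<infinity>p\<in>{1..}. P p / (d i p * d n p))"
    \<comment> \<open>The two changes of sign cancel, so the relation for -m applies to the product
      in the other order.\<close>
    have dd: "(ev p - ev i - - m) * (ev p - ev n - - m) = d i p * d n p" for p
      by (simp add: d_def algebra_simps)
    have S: "((\<lambda>p. P p / (d i p * d n p)) has_sum S) {1..}" "m\<^sup>2 * Q i * S = (if i = n then 1 else 0)"
      using refl.gap_prod_orthogonality[OF that] unfolding dd by (auto simp: S_def Q_def P_def)
    have sums: "((\<lambda>p. m\<^sup>2 * (b i / b n) * Q n * (P p / (d i p * d n p))) has_sum m\<^sup>2 * (b i / b n) * Q n * S) {1..}"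
      by (intro has_sum_cmult_right S)
    have total_eq: "m\<^sup>2 * (b i / b n) * Q n * S = (if i = n then 1 else 0)"
    proof (cases "i = n")
      case False
      then have "S = 0" using S(2) mu_nonzero refl.gap_prod_nonzero[OF that(1)] by (auto simp: Q_def)
      then show ?thesis using False by simp
    qed (use S(2) b0 that in simp)
    have entry: "M i p * R p n = m\<^sup>2 * (b i / b n) * Q n * (P p / (d i p * d n p))" if "p \<in> {1..}" for p
      using b0[of p] that by (simp add: R_def M_def power2_eq_square mult_ac)
    show ?thesis by (rule has_sum_cong[THEN iffD2, rotated, OF sums[unfolded total_eq]]) (rule entry)
  qed
  have basis: "cinner (T_basis ev \<phi> b m n) (\<phi> p) = M p n" if n: "n \<ge> 1" and p: "p \<ge> 1" for n p
  proof -
    define a where "a p = (if p \<ge> 1 then b p / d p n else 0)" for p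
    define C where "C p n = b p / d p n" for p n
    \<comment> \<open>The inner sum of \<open>T_basis\<close> converges in H because its
      coefficients are column n of a kernel-dominated matrix, the image of a unit sequence.\<close>
    have "kern_dominated (b2 * res_const) C"
      unfolding kern_dominated_def
    proof (intro conjI allI impI)
      have "b2 \<ge> 0" using b2[of 1] by (auto intro: order_trans[OF norm_ge_zero])
      then show "b2 * res_const \<ge> 0" using res_const_ge_1 by simp
      fix p n :: nat assume pn: "p \<ge> 1" "n \<ge> 1"
      have "cmod (C p n) = cmod (b p) * (1 / cmod (d p n))" by (simp add: C_def norm_divide)
      also have "\<dots> \<le> b2 * (res_const * kern ev p n)"
        unfolding d_def b_def using \<open>b2 \<ge> 0\<close> by (intro mult_mono b2 resolvent_bound pn) auto
      finally show "cmod (C p n) \<le> b2 * res_const * kern ev p n" by (simp add: mult.assoc)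
    qed
    moreover have "weighted_summable ev 0 (truncate {n} (\<lambda>_. 1))"
      unfolding weighted_summable_def
      by (rule finite_nonzero_values_imp_summable_on, rule finite_subset[of _ "{n}"])
        (auto simp: truncate_def)
    ultimately have "mat_act C (truncate {n} (\<lambda>_. 1)) \<in> power_completion ev 0"
      by (intro mat_act_in_power_completion[OF zero_in_range])
    also have "mat_act C (truncate {n} (\<lambda>_. 1)) = a"
      using n by (auto simp: fun_eq_iff mat_act_truncate a_def C_def)
    finally have a: "a \<in> power_completion ev 0" .
    have "(\<Sum>\<^sub>\<infinity>p\<in>{1..}. (b p / (ev p - ev n - m)) *\<^sub>C \<phi> p) = (\<Sum>\<^sub>\<infinity>p\<in>{1..}. a p *\<^sub>C \<phi> p)"
      by (intro infsum_cong) (simp add: a_def d_def)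
    also have "\<dots> = synth a" by (rule infsumI[OF has_sum_fourier_expansion[OF a]])
    finally have "cinner (T_basis ev \<phi> b m n) (\<phi> p) = k_coeff ev b m n * cinner (synth a) (\<phi> p)"
      by (simp add: T_basis_def cinner_scaleC_left)
    also have "cinner (synth a) (\<phi> p) = b p / d p n"
      using fun_cong[OF fourier_synth[OF a], of p] p by (simp add: fourier_def a_def)
    finally show ?thesis by (simp add: k_coeff_eq[OF n] M_def P_def)
  qed
  have T: "T_op ev \<phi> b m f = synth (mat_act M (fourier \<phi> f))" for f
  proof -
    have "T_op ev \<phi> b m f = (\<Sum>\<^sub>\<infinity>n\<in>{1..}. fourier \<phi> f n *\<^sub>C T_basis ev \<phi> b m n)"
      unfolding T_op_def by (intro infsum_cong) (simp add: fourier_def)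
    also have "\<dots> = synth (mat_act M (fourier \<phi> f))"
      using fourier_in_power_completion[of 0 f]
      by (intro infsumI has_sum_mat_act[OF dom(1)] basis) (auto simp: power_completion_def)
    finally show ?thesis .
  qed
  have "isomorphism_bound ev \<phi> s (T_op ev \<phi> b m) (2 * (kern_const s * L))"
    by (rule isomorphism_bound_mat_act[OF s dom RM MR T])
  then show ?thesis unfolding L_def E_def res_const_def mu unfolding b_def[abs_def] m_def .
qed

lemma isomorphism_bound_mono:
  "isomorphism_bound ev \<phi> s T K \<Longrightarrow> K \<le> K' \<Longrightarrow> isomorphism_bound ev \<phi> s T K'"
  unfolding isomorphism_bound_def by (force split: if_splits)

text \<open>Common to both cases: q measures the polynomial loss in the distance \<delta>. C and Cs
  are fixed before \<mu> and \<delta>, which gives the required uniformity.\<close>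

lemma uniform_transformation_bound:
  assumes gap: "gap_sequence ev \<alpha> c" and q: "q \<ge> 0" and K0: "K0 > 0"
  shows "\<exists>C>0. \<exists>Cs :: real \<Rightarrow> real.
    (\<forall>s\<in>{1 / (2 * \<alpha>) - 1 <..< 1 - 1 / (2 * \<alpha>)}. Cs s > 0) \<and>
    (\<forall>\<mu> \<delta>. \<mu> > 0 \<and> \<delta> > 0 \<and> 1 / \<delta> \<le> K0 * (1 + \<mu>) powr q \<and>
        (\<forall>p\<ge>1. \<forall>n\<ge>1. \<delta> \<le> cmod (ev p - ev n - complex_of_real \<mu>)) \<longrightarrow>
      (\<forall>s\<in>{1 / (2 * \<alpha>) - 1 <..< 1 - 1 / (2 * \<alpha>)}.
        isomorphism_bound ev \<phi> s (T_op ev \<phi> (\<lambda>n. B (\<phi> n)) (complex_of_real \<mu>))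
          (Cs s * exp (C * \<mu> powr (1 / \<alpha>)))))"
proof -
  interpret gap_sequence ev \<alpha> c by (rule gap)
  obtain b1 b2 where b: "b1 > 0" "b2 > 0"
    "\<And>n. n \<ge> 1 \<Longrightarrow> B (\<phi> n) \<in> \<real> \<and> b1 \<le> Re (B (\<phi> n)) \<and> Re (B (\<phi> n)) \<le> b2"
    using B_bounds by blast
  have Bn: "cmod (B (\<phi> n)) = Re (B (\<phi> n))" if "n \<ge> 1" for n
    using b(1) b(3)[OF that] by (auto simp: complex_is_Real_iff cmod_def)
  \<comment> \<open>To the q powers lost in 1 / \<delta> come one for the factor \<mu> and one for
    the numerator 1 + \<mu>.\<close>
  obtain K where K: "K > 0" "\<And>\<mu>. \<mu> \<ge> 0 \<Longrightarrow> (1 + \<mu>) powr (q + 2) \<le> K * exp (\<mu> powr (1 / \<alpha>))"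
    using one_plus_powr_le_exp[OF alpha_gt_1, of "q + 2"] q by auto
  define Cs where "Cs s = 2 * kern_const s * (b2 / b1) * (1 + K0) * K" for s
  show ?thesis
  \<comment> \<open>The 1 added to \<open>growth\<close> pays for the polynomial factors.\<close>
  proof (intro exI[of _ "growth + 1"] exI[of _ Cs] conjI ballI allI impI)
    show "growth + 1 > 0" using growth_pos by simp
  next
    fix s assume "s \<in> {1 / (2 * \<alpha>) - 1 <..< 1 - 1 / (2 * \<alpha>)}"
    then show "Cs s > 0" using kern_const_pos[of s] b K K0 by (simp add: Cs_def)
  next
    fix \<mu> \<delta> s
    assume *: "\<mu> > 0 \<and> \<delta> > 0 \<and> 1 / \<delta> \<le> K0 * (1 + \<mu>) powr q \<and>
        (\<forall>p\<ge>1. \<forall>n\<ge>1. \<delta> \<le> cmod (ev p - ev n - complex_of_real \<mu>))"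
      and "s \<in> {1 / (2 * \<alpha>) - 1 <..< 1 - 1 / (2 * \<alpha>)}"
    then have s: "1 / (2 * \<alpha>) - 1 < s" "s < 1 - 1 / (2 * \<alpha>)" by auto
    have sep: "separated_gap_sequence ev \<alpha> c (of_real \<mu>) \<delta>"
      using * by unfold_locales auto
    have "\<mu> * (1 + (1 + \<mu>) / \<delta>) \<le> (1 + K0) * (1 + \<mu>) powr (q + 2)"
    proof -
      have one: "1 \<le> (1 + \<mu>) powr q" using * q by (intro ge_one_powr_ge_zero) auto
      have "1 + (1 + \<mu>) * (1 / \<delta>) \<le> (1 + \<mu>) * (1 + \<mu>) powr q + (1 + \<mu>) * (K0 * (1 + \<mu>) powr q)"
        using * one mult_mono[of 1 "1 + \<mu>" 1 "(1 + \<mu>) powr q"] by (intro add_mono mult_left_mono) auto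
      also have "\<dots> = (1 + K0) * ((1 + \<mu>) * (1 + \<mu>) powr q)" by (simp add: algebra_simps)
      finally have "\<mu> * (1 + (1 + \<mu>) / \<delta>) \<le> (1 + \<mu>) * ((1 + K0) * ((1 + \<mu>) * (1 + \<mu>) powr q))"
        using * by (intro mult_mono) auto
      also have "\<dots> = (1 + K0) * (1 + \<mu>) powr (q + 2)"
        using * by (simp add: powr_add power2_eq_square mult_ac)
      finally show ?thesis .
    qed
    also have "\<dots> \<le> (1 + K0) * (K * exp (\<mu> powr (1 / \<alpha>)))"
      using K(2)[of \<mu>] K0 * by (intro mult_left_mono) auto
    finally have "2 * kern_const s * (b2 / b1) * exp (growth * \<mu> powr (1 / \<alpha>)) * (\<mu> * (1 + (1 + \<mu>) / \<delta>))
        \<le> 2 * kern_const s * (b2 / b1) * exp (growth * \<mu> powr (1 / \<alpha>)) * ((1 + K0) * (K * exp (\<mu> powr (1 / \<alpha>))))"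
      using kern_const_pos[OF s] b by (intro mult_left_mono) auto
    also have "\<dots> = Cs s * exp ((growth + 1) * \<mu> powr (1 / \<alpha>))"
    proof -
      have "exp ((growth + 1) * \<mu> powr (1 / \<alpha>)) = exp (growth * \<mu> powr (1 / \<alpha>)) * exp (\<mu> powr (1 / \<alpha>))"
        by (simp add: exp_add distrib_right)
      then show ?thesis by (simp only: Cs_def mult_ac)
    qed
    finally have le: "2 * (kern_const s * (\<mu> * (b2 / b1) * exp (growth * \<mu> powr (1 / \<alpha>)) * (1 + (1 + \<mu>) / \<delta>)))
        \<le> Cs s * exp ((growth + 1) * \<mu> powr (1 / \<alpha>))"
      by (simp only: mult_ac)
    show "isomorphism_bound ev \<phi> s (T_op ev \<phi> (\<lambda>n. B (\<phi> n)) (complex_of_real \<mu>))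
        (Cs s * exp ((growth + 1) * \<mu> powr (1 / \<alpha>)))"
      using * b Bn by (intro isomorphism_bound_mono[OF transformation_bound[OF sep _ b(1) _ _ s] le]) auto
  qed
qed

text \<open>The differences are real, so \<open>exists_separated\<close> applies; the positive
  distance of \<mu> to all of them also shows that \<mu> is none of them.\<close>

lemma self_adjoint_bound:
  assumes "self_adjoint D A"
  shows "\<exists>C>0. \<exists>Cs :: real \<Rightarrow> real.
         (\<forall>s\<in>{1 / (2 * \<alpha>) - 1 <..< 1 - 1 / (2 * \<alpha>)}. Cs s > 0) \<and>
         (\<forall>N::nat. \<exists>\<mu>\<in>{real N..real N + 1}.
            \<mu> > 0 \<and> complex_of_real \<mu> \<notin> eigenvalue_differences ev \<and>
            (\<forall>s\<in>{1 / (2 * \<alpha>) - 1 <..< 1 - 1 / (2 * \<alpha>)}.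
               isomorphism_bound ev \<phi> s (T_op ev \<phi> (\<lambda>n. B (\<phi> n)) (complex_of_real \<mu>))
                 (Cs s * exp (C * \<mu> powr (1 / \<alpha>)))))"
proof -
  obtain c where "gap_sequence ev \<alpha> c" using gap_sequence_ev by blast
  then interpret gap_sequence ev \<alpha> c .
  have im: "Im (ev n) = 0" if "n \<ge> 1" for n
    using self_adjoint_order[OF assms] that by (simp add: complex_is_Real_iff)
  define q where "q = 2 / (\<alpha> - 1)"
  define K0 where "K0 = 4 + 2 * (2 / c) powr q"
  have "q \<ge> 0" using alpha by (simp add: q_def)
  moreover have "K0 > 0" unfolding K0_def by (intro add_pos_nonneg) auto
  ultimately obtain C Cs where C: "C > 0"
    "\<forall>s\<in>{1 / (2 * \<alpha>) - 1 <..< 1 - 1 / (2 * \<alpha>)}. Cs s > (0::real)"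
    "\<And>\<mu> \<delta>. \<mu> > 0 \<Longrightarrow> \<delta> > 0 \<Longrightarrow> 1 / \<delta> \<le> K0 * (1 + \<mu>) powr q \<Longrightarrow>
      \<forall>p\<ge>1. \<forall>n\<ge>1. \<delta> \<le> cmod (ev p - ev n - complex_of_real \<mu>) \<Longrightarrow>
      \<forall>s\<in>{1 / (2 * \<alpha>) - 1 <..< 1 - 1 / (2 * \<alpha>)}.
        isomorphism_bound ev \<phi> s (T_op ev \<phi> (\<lambda>n. B (\<phi> n)) (complex_of_real \<mu>))
          (Cs s * exp (C * \<mu> powr (1 / \<alpha>)))"
    using uniform_transformation_bound[OF gap_sequence_axioms] by metis
  have "\<exists>\<mu>\<in>{real N..real N + 1}. \<mu> > 0 \<and> complex_of_real \<mu> \<notin> eigenvalue_differences ev \<and>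
      (\<forall>s\<in>{1 / (2 * \<alpha>) - 1 <..< 1 - 1 / (2 * \<alpha>)}.
         isomorphism_bound ev \<phi> s (T_op ev \<phi> (\<lambda>n. B (\<phi> n)) (complex_of_real \<mu>))
           (Cs s * exp (C * \<mu> powr (1 / \<alpha>))))" for N
  proof -
    obtain \<mu> \<delta> where \<mu>: "\<mu> \<in> {real N..real N + 1}" "\<mu> > 0" "\<delta> > 0" "1 / \<delta> \<le> K0 * (1 + \<mu>) powr q"
      "\<And>p n. p \<ge> 1 \<Longrightarrow> n \<ge> 1 \<Longrightarrow> \<delta> \<le> \<bar>Re (ev p - ev n) - \<mu>\<bar> \<or> Im (ev p - ev n) \<noteq> 0"
      using exists_separated[of N] unfolding K0_def q_def by blast
    have sep: "\<delta> \<le> cmod (ev p - ev n - complex_of_real \<mu>)" if "p \<ge> 1" "n \<ge> 1" for p n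
      using \<mu>(5)[OF that] im that abs_Re_le_cmod[of "ev p - ev n - complex_of_real \<mu>"] by simp
    have "complex_of_real \<mu> \<notin> eigenvalue_differences ev"
    proof
      assume "complex_of_real \<mu> \<in> eigenvalue_differences ev"
      then obtain p n where "p \<ge> 1" "n \<ge> 1" "complex_of_real \<mu> = ev p - ev n"
        by (auto simp: eigenvalue_differences_def)
      then show False using sep[of p n] \<mu>(3) by simp
    qed
    then show ?thesis using C(3)[OF \<mu>(2,3,4)] sep \<mu>(1,2) by blast
  qed
  then show ?thesis using C(1,2) by blast
qed

text \<open>The differences are imaginary and \<mu> is real, so every distance is at least \<mu>
  \<ge> 1, and \<delta> = 1 with q = 0 serves for all \<mu>.\<close>

lemma skew_adjoint_bound:
  assumes "skew_adjoint D A"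
  shows "\<exists>C>0. \<exists>Cs :: real \<Rightarrow> real.
         (\<forall>s\<in>{1 / (2 * \<alpha>) - 1 <..< 1 - 1 / (2 * \<alpha>)}. Cs s > 0) \<and>
         (\<forall>\<mu>\<ge>1.
            (\<forall>s\<in>{1 / (2 * \<alpha>) - 1 <..< 1 - 1 / (2 * \<alpha>)}.
               isomorphism_bound ev \<phi> s (T_op ev \<phi> (\<lambda>n. B (\<phi> n)) (complex_of_real \<mu>))
                 (Cs s * exp (C * \<mu> powr (1 / \<alpha>)))))"
proof -
  obtain c where gap: "gap_sequence ev \<alpha> c" using gap_sequence_ev by blast
  have re: "Re (ev n) = 0" if "n \<ge> 1" for n
    using skew_adjoint_order[OF assms] that by (simp add: complex_is_Real_iff)
  obtain C Cs where C: "C > 0"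
    "\<forall>s\<in>{1 / (2 * \<alpha>) - 1 <..< 1 - 1 / (2 * \<alpha>)}. Cs s > (0::real)"
    "\<And>\<mu> \<delta>. \<mu> > 0 \<Longrightarrow> \<delta> > 0 \<Longrightarrow> 1 / \<delta> \<le> 1 * (1 + \<mu>) powr 0 \<Longrightarrow>
      \<forall>p\<ge>1. \<forall>n\<ge>1. \<delta> \<le> cmod (ev p - ev n - complex_of_real \<mu>) \<Longrightarrow>
      \<forall>s\<in>{1 / (2 * \<alpha>) - 1 <..< 1 - 1 / (2 * \<alpha>)}.
        isomorphism_bound ev \<phi> s (T_op ev \<phi> (\<lambda>n. B (\<phi> n)) (complex_of_real \<mu>))
          (Cs s * exp (C * \<mu> powr (1 / \<alpha>)))"
    using uniform_transformation_bound[OF gap, of 0 1] by (metis order_refl zero_less_one)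
  have "\<forall>s\<in>{1 / (2 * \<alpha>) - 1 <..< 1 - 1 / (2 * \<alpha>)}.
      isomorphism_bound ev \<phi> s (T_op ev \<phi> (\<lambda>n. B (\<phi> n)) (complex_of_real \<mu>))
        (Cs s * exp (C * \<mu> powr (1 / \<alpha>)))" if "\<mu> \<ge> 1" for \<mu>
  proof -
    have "1 \<le> cmod (ev p - ev n - complex_of_real \<mu>)" if "p \<ge> 1" "n \<ge> 1" for p n
      using abs_Re_le_cmod[of "ev p - ev n - complex_of_real \<mu>"] re that \<open>\<mu> \<ge> 1\<close> by simp
    then show ?thesis using that by (intro C(3)[of \<mu> 1]) auto
  qed
  then show ?thesis using C(1,2) by blast
qed

end

theorem theorem4p5:
  fixes D :: "'h::complex_hilbert_space set" and A :: "'h \<Rightarrow> 'h"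
    and ev :: "nat \<Rightarrow> complex" and \<phi> :: "nat \<Rightarrow> 'h"
    and B :: "'h \<Rightarrow> complex" and \<alpha> :: real
  assumes "standing_assumptions D A ev \<phi> B \<alpha>"
  shows "(self_adjoint D A \<longrightarrow>
      (\<exists>C>0. \<exists>Cs :: real \<Rightarrow> real.
         (\<forall>s\<in>{1 / (2 * \<alpha>) - 1 <..< 1 - 1 / (2 * \<alpha>)}. Cs s > 0) \<and>
         (\<forall>N::nat. \<exists>\<mu>\<in>{real N..real N + 1}.
            \<mu> > 0 \<and> complex_of_real \<mu> \<notin> eigenvalue_differences ev \<and>
            (\<forall>s\<in>{1 / (2 * \<alpha>) - 1 <..< 1 - 1 / (2 * \<alpha>)}.
               isomorphism_bound ev \<phi> s (T_op ev \<phi> (\<lambda>n. B (\<phi> n)) (complex_of_real \<mu>))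
                 (Cs s * exp (C * \<mu> powr (1 / \<alpha>)))))))
    \<and> (skew_adjoint D A \<longrightarrow>
      (\<exists>C>0. \<exists>Cs :: real \<Rightarrow> real.
         (\<forall>s\<in>{1 / (2 * \<alpha>) - 1 <..< 1 - 1 / (2 * \<alpha>)}. Cs s > 0) \<and>
         (\<forall>\<mu>\<ge>1.
            (\<forall>s\<in>{1 / (2 * \<alpha>) - 1 <..< 1 - 1 / (2 * \<alpha>)}.
               isomorphism_bound ev \<phi> s (T_op ev \<phi> (\<lambda>n. B (\<phi> n)) (complex_of_real \<mu>))
                 (Cs s * exp (C * \<mu> powr (1 / \<alpha>)))))))"
  using standing_assumptions.self_adjoint_bound[OF assms]
    standing_assumptions.skew_adjoint_bound[OF assms] by blast

end
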